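(* Let $H$ be a finitely generated group acting properly by isometries on a proper geodesic metric space $X$ with basepoint $\mathfrak{o}\in X$, and let $\Lambda H\subseteq \partial X_{\mathfrak{o}}$ be its limit set in the Morse boundary of $X$. The following are equivalent: (1) Any $H$-orbit in $X$ is a stable embedding of $H\rightarrow X$ (that is, the orbit maps $h\mapsto hx$, $x\in X$, are stable embeddings). (2) $H$ acts boundary convex cocompactly on $X$. (3) Every point in $\Lambda H$ is a (Morse) conical limit point of $H\mathfrak{o}$, $\Lambda H\neq\emptyset$, and $\Lambda H$ is a compact subset of the Morse boundary of $X$. (4) Every point in $\Lambda H$ is a (Morse) horospherical limit point of $H\mathfrak{o}$, $\Lambda H\neq\emptyset$, and $\Lambda H$ is a compact subset of the Morse boundary of $X$.
   Context: Quasi-geodesics and Morse gauges. A map $\varphi:I\to X$ from a closed interval $I\subseteq\mathbb{R}$ is a $(K,C)$-quasi-geodesic ($K\ge1$, $C\ge 0$) if $\frac1K|s-t|-C\le d(\varphi(s),\varphi(t))\le K|s-t|+C$ for all $s,t\in I$. A Morse gauge is a function $N:[1,\infty)\times[0,\infty)\to[0,\infty)$. A (quasi-)geodesic $\gamma$ is $N$-Morse if every $(K,C)$-quasi-geodesic with endpoints on $\gamma$ lies in the closed $N(K,C)$-neighborhood of $\gamma$; it is Morse if it is $N$-Morse for some $N$. Set $\delta_N=\max\{4N(1,2N(5,0))+2N(5,0),\,8N(3,0)\}+N(5,0)$. $\mathcal{N}_K(A)$ is the closed $K$-neighborhood of $A$. Morse boundary. The stratum $X^N_{\mathfrak{o}}$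 is the set of $x\in X$ such that $[\mathfrak{o},x]$ is an $N$-Morse geodesic. $\partial_\infty X^N_{\mathfrak{o}}$ is the set of $N$-Morse geodesic rays from $\mathfrak{o}$ modulo finite Hausdorff distance, with neighborhood basis of $\alpha(\infty)$ given by $U(\alpha,r,n)=\{\beta(\infty): d(\alpha(t),\beta(t))\le r \text{ for all } t\le n\}$, $n\ge 0$ ($r$ a sufficiently large constant depending only on $N$). The Morse boundary is $\partial X_{\mathfrak{o}}=\varinjlim_N \partial_\infty X^N_{\mathfrak{o}}$ with the direct limit topology, Morse gauges being ordered pointwise. For a Morse geodesic ray $\alpha$ with any starting point, $\alpha(\infty)\in\partial X_{\mathfrak{o}}$ is the class of rays from $\mathfrak{o}$ at finite Hausdorff distance from $\alpha$. Limit set. For $A\subseteq X$, $\Lambda A$ is the set of $x\in\partial X_{\mathfrak{o}}$ such that for some Morse gauge $N$ there is a sequence $a_k\in A\cap X^N_{\mathfrak{o}}$ with $[\mathfrak{o},a_k]$ converging uniformly on compact sets to a geodesic ray $\alpha$ with $\alpha(\infty)=x$. $\Lambda H:=\Lambda(H\mathfrak{o})$. The weak convex hull $WCH(A)$ of $A\subseteq X\cup\partial X_{\mathfrak{o}}$ is the union of all geodesic segments, rays and lines of $X$ with both endpoints in $A$. Stability. A quasi-isometric embedding $f:Y\to X$ is a stable embedding if there is a Morse gauge $N$ such that every pair of points of $f(Y)$ can be connected by an $N$-Morse quasi-geodesic in $X$. $H$ carries a word metric of a finite generating set (equivalently is replaced by its Cayley graph). $H$ acts boundary convex cocompactly on $X$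 if: $H$ acts properly on $X$; $\Lambda H$ is nonempty and compact; and the action of $H$ on $WCH(\Lambda H)$ is cobounded. Limit points. Geodesic rays $\alpha:[a,\infty)\to X$ and $\beta:[b,\infty)\to X$ satisfy $\alpha\sim_K\beta$ if there is $T$ with $d(\alpha(t),\beta(t))\le K$ for all $t\ge T$. For an $N'$-Morse geodesic ray $\alpha:[a,\infty)\to X$ and a Morse gauge $N$, the $N$-Morse horoball is $H^N_{\mathfrak{o}}(\alpha)=\{x\in X^N_{\mathfrak{o}} : \exists \text{ a geodesic ray } \beta:[b,\infty)\to X \text{ with } \beta\sim_{\delta_{N'}}\alpha,\ b\ge a,\ \beta(b)=x\}$. A point $x\in\partial X_{\mathfrak{o}}$ is a horospherical limit point of $A\subseteq X$ if for every Morse geodesic ray $\alpha$ with $\alpha(\infty)=x$ there is a Morse gauge $N$ with $H^N_{\mathfrak{o}}(\alpha)\cap A\ne\emptyset$. It is a conical limit point of $A$ if there is $K>0$ such that for every Morse geodesic ray $\alpha$ with $\alpha(\infty)=x$ one has $\mathcal{N}_K(\alpha)\cap A\ne\emptyset$.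
   Formalization: H is assumed infinite (for finite H, (1) always holds but ΛH is empty, so (2)–(4) fail), and a cobounded action on WCH(ΛH) is taken to require WCH(ΛH) nonempty (otherwise a parabolic isometry of the hyperbolic plane satisfies (2) but not (1)). *)

theory Defs
  imports "HOL-Analysis.Analysis" "HOL-Algebra.Group_Action" "HOL-Algebra.Generated_Groups"
begin

section \<open>Geodesics, quasi-geodesics and Morse gauges\<close>

text \<open>Paths are total functions on \<^typ>\<open>real\<close>; only their values on the interval named in the
  predicate matter.\<close>

definition geodesic :: "real set \<Rightarrow> (real \<Rightarrow> 'x::metric_space) \<Rightarrow> bool" where
  "geodesic I \<gamma> \<longleftrightarrow> closed I \<and> is_interval I \<and> I \<noteq> {} \<and>
     (\<forall>s\<in>I. \<forall>t\<in>I. dist (\<gamma> s) (\<gamma> t) = \<bar>s - t\<bar>)"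

definition quasi_geodesic :: "real \<Rightarrow> real \<Rightarrow> real set \<Rightarrow> (real \<Rightarrow> 'x::metric_space) \<Rightarrow> bool" where
  "quasi_geodesic K C I \<phi> \<longleftrightarrow> K \<ge> 1 \<and> C \<ge> 0 \<and> closed I \<and> is_interval I \<and> I \<noteq> {} \<and>
     (\<forall>s\<in>I. \<forall>t\<in>I. 1 / K * \<bar>s - t\<bar> - C \<le> dist (\<phi> s) (\<phi> t) \<and>
                  dist (\<phi> s) (\<phi> t) \<le> K * \<bar>s - t\<bar> + C)"

definition geodesic_segment :: "'x::metric_space \<Rightarrow> 'x \<Rightarrow> (real \<Rightarrow> 'x) \<Rightarrow> bool" where
  "geodesic_segment x y \<gamma> \<longleftrightarrow> geodesic {0..dist x y} \<gamma> \<and> \<gamma> 0 = x \<and> \<gamma> (dist x y) = y"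

text \<open>The guard is needed because \<^term>\<open>infdist x {} = 0\<close>.\<close>

definition closed_nbhd :: "real \<Rightarrow> 'x::metric_space set \<Rightarrow> 'x set" where
  "closed_nbhd K A = {x. A \<noteq> {} \<and> infdist x A \<le> K}"

definition finite_hausdorff_dist :: "'x::metric_space set \<Rightarrow> 'x set \<Rightarrow> bool" where
  "finite_hausdorff_dist A B \<longleftrightarrow> (\<exists>K. A \<subseteq> closed_nbhd K B \<and> B \<subseteq> closed_nbhd K A)"

text \<open>A gauge is a function on $[1,\infty)\times[0,\infty)$; values elsewhere are never used.\<close>

type_synonym gauge_fun = "real \<Rightarrow> real \<Rightarrow> real"

definition morse_gauge :: "gauge_fun \<Rightarrow> bool" where
  "morse_gauge N \<longleftrightarrow> (\<forall>K\<ge>1. \<forall>C\<ge>0. N K C \<ge> 0)"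

text \<open>The Morse property of a (quasi-)geodesic depends only on its image \<^term>\<open>A\<close>.\<close>

definition is_morse :: "gauge_fun \<Rightarrow> 'x::metric_space set \<Rightarrow> bool" where
  "is_morse N A \<longleftrightarrow> (\<forall>K C a b \<phi>. a \<le> b \<and> quasi_geodesic K C {a..b} \<phi> \<and> \<phi> a \<in> A \<and> \<phi> b \<in> A \<longrightarrow>
     \<phi> ` {a..b} \<subseteq> closed_nbhd (N K C) A)"

definition morse_delta :: "gauge_fun \<Rightarrow> real" where
  "morse_delta N = max (4 * N 1 (2 * N 5 0) + 2 * N 5 0) (8 * N 3 0) + N 5 0"

text \<open>Morse geodesic rays $[a,\infty)\to X$ with arbitrary starting point.\<close>

definition morse_ray :: "real \<Rightarrow> (real \<Rightarrow> 'x::metric_space) \<Rightarrow> bool" where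
  "morse_ray a \<alpha> \<longleftrightarrow> geodesic {a..} \<alpha> \<and> (\<exists>N. morse_gauge N \<and> is_morse N (\<alpha> ` {a..}))"

section \<open>The Morse boundary\<close>

definition stratum :: "'x::metric_space \<Rightarrow> gauge_fun \<Rightarrow> 'x set" where
  "stratum \<oo> N = {x. \<exists>\<gamma>. geodesic_segment \<oo> x \<gamma> \<and> is_morse N (\<gamma> ` {0..dist \<oo> x})}"

definition gauge_rays_from :: "'x::metric_space \<Rightarrow> gauge_fun \<Rightarrow> (real \<Rightarrow> 'x) set" where
  "gauge_rays_from \<oo> N = {\<alpha>. geodesic {0..} \<alpha> \<and> \<alpha> 0 = \<oo> \<and> is_morse N (\<alpha> ` {0..})}"

definition morse_rays_from :: "'x::metric_space \<Rightarrow> (real \<Rightarrow> 'x) set" where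
  "morse_rays_from \<oo> = {\<alpha>. morse_ray 0 \<alpha> \<and> \<alpha> 0 = \<oo>}"

text \<open>Boundary points are equivalence classes of Morse rays from the basepoint.
  \<^term>\<open>ray_end \<oo> a \<alpha>\<close> is $\alpha(\infty)$ for $\alpha:[a,\infty)\to X$.\<close>

type_synonym 'x boundary_point = "(real \<Rightarrow> 'x) set"

definition ray_end :: "'x::metric_space \<Rightarrow> real \<Rightarrow> (real \<Rightarrow> 'x) \<Rightarrow> 'x boundary_point" where
  "ray_end \<oo> a \<alpha> = {\<beta> \<in> morse_rays_from \<oo>. finite_hausdorff_dist (\<beta> ` {0..}) (\<alpha> ` {a..})}"

definition morse_boundary :: "'x::metric_space \<Rightarrow> 'x boundary_point set" where
  "morse_boundary \<oo> = ray_end \<oo> 0 ` morse_rays_from \<oo>"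

text \<open>The quotient of the N-Morse rays is identified with its image under the (injective) map to the
  direct limit, so the direct limit is the union of the strata.\<close>

definition boundary_stratum :: "'x::metric_space \<Rightarrow> gauge_fun \<Rightarrow> 'x boundary_point set" where
  "boundary_stratum \<oo> N = ray_end \<oo> 0 ` gauge_rays_from \<oo> N"

definition boundary_nbhd ::
  "'x::metric_space \<Rightarrow> gauge_fun \<Rightarrow> (real \<Rightarrow> 'x) \<Rightarrow> real \<Rightarrow> real \<Rightarrow> 'x boundary_point set" where
  "boundary_nbhd \<oo> N \<alpha> r n =
     ray_end \<oo> 0 ` {\<beta> \<in> gauge_rays_from \<oo> N. \<forall>t\<in>{0..n}. dist (\<alpha> t) (\<beta> t) \<le> r}"

text \<open>Any \<^term>\<open>r \<ge> morse_delta N\<close> gives the same topology: if N-Morse rays from \<^term>\<open>\<oo>\<close> are at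
  bounded distance at time n, they are within 2 N(3,0) of each other up to time n minus a constant
  depending on that bound.\<close>

definition stratum_topology :: "'x::metric_space \<Rightarrow> gauge_fun \<Rightarrow> 'x boundary_point topology" where
  "stratum_topology \<oo> N = topology (\<lambda>U. U \<subseteq> boundary_stratum \<oo> N \<and>
     (\<forall>\<alpha>\<in>gauge_rays_from \<oo> N. ray_end \<oo> 0 \<alpha> \<in> U \<longrightarrow>
        (\<exists>n\<ge>0. boundary_nbhd \<oo> N \<alpha> (morse_delta N) n \<subseteq> U)))"

definition morse_boundary_topology :: "'x::metric_space \<Rightarrow> 'x boundary_point topology" where
  "morse_boundary_topology \<oo> = topology (\<lambda>U. U \<subseteq> morse_boundary \<oo> \<and>
     (\<forall>N. morse_gauge N \<longrightarrow> openin (stratum_topology \<oo> N) (U \<inter> boundary_stratum \<oo> N)))"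

lemma boundary_nbhd_antimono:
  "m \<le> n \<Longrightarrow> boundary_nbhd \<oo> N \<alpha> r n \<subseteq> boundary_nbhd \<oo> N \<alpha> r m"
  unfolding boundary_nbhd_def by (rule image_mono) auto

lemma openin_stratum_topology:
  "openin (stratum_topology \<oo> N) U \<longleftrightarrow> U \<subseteq> boundary_stratum \<oo> N \<and>
     (\<forall>\<alpha>\<in>gauge_rays_from \<oo> N. ray_end \<oo> 0 \<alpha> \<in> U \<longrightarrow>
        (\<exists>n\<ge>0. boundary_nbhd \<oo> N \<alpha> (morse_delta N) n \<subseteq> U))"
proof -
  let ?B = "\<lambda>\<alpha>. boundary_nbhd \<oo> N \<alpha> (morse_delta N)"
  define P where "P = (\<lambda>U. U \<subseteq> boundary_stratum \<oo> N \<and>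
     (\<forall>\<alpha>\<in>gauge_rays_from \<oo> N. ray_end \<oo> 0 \<alpha> \<in> U \<longrightarrow> (\<exists>n\<ge>0. ?B \<alpha> n \<subseteq> U)))"
  have inter: "P (S \<inter> T)" if S: "P S" and T: "P T" for S T
    unfolding P_def
  proof (intro conjI ballI impI)
    show "S \<inter> T \<subseteq> boundary_stratum \<oo> N" using S unfolding P_def by (meson inf.coboundedI1)
    fix \<alpha> assume "\<alpha> \<in> gauge_rays_from \<oo> N" and "ray_end \<oo> 0 \<alpha> \<in> S \<inter> T"
    with S T obtain m n where mn: "m \<ge> 0" "?B \<alpha> m \<subseteq> S" "n \<ge> 0" "?B \<alpha> n \<subseteq> T"
      unfolding P_def by (meson IntD1 IntD2)
    have "?B \<alpha> (max m n) \<subseteq> S \<inter> T"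
      by (rule Int_greatest;
          rule order_trans[OF boundary_nbhd_antimono mn(2)] order_trans[OF boundary_nbhd_antimono mn(4)];
          simp)
    moreover have "max m n \<ge> 0" using mn by simp
    ultimately show "\<exists>n\<ge>0. ?B \<alpha> n \<subseteq> S \<inter> T" by blast
  qed
  have union: "P (\<Union>\<K>)" if H: "\<And>K. K \<in> \<K> \<Longrightarrow> P K" for \<K>
    unfolding P_def
  proof (intro conjI ballI impI)
    show "\<Union>\<K> \<subseteq> boundary_stratum \<oo> N" using H unfolding P_def by (meson Union_least)
    fix \<alpha> assume a: "\<alpha> \<in> gauge_rays_from \<oo> N" and "ray_end \<oo> 0 \<alpha> \<in> \<Union>\<K>"
    then obtain K where K: "K \<in> \<K>" "ray_end \<oo> 0 \<alpha> \<in> K" by blast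
    with H a obtain n where "n \<ge> 0" "?B \<alpha> n \<subseteq> K" unfolding P_def by meson
    with K show "\<exists>n\<ge>0. ?B \<alpha> n \<subseteq> \<Union>\<K>" by (meson Union_upper order_trans)
  qed
  have "istopology P" unfolding istopology_def using inter union by blast
  then have "openin (topology P) = P" by (rule topology_inverse')
  then show ?thesis unfolding stratum_topology_def P_def by (rule fun_cong)
qed

lemma openin_morse_boundary_topology:
  "openin (morse_boundary_topology \<oo>) U \<longleftrightarrow> U \<subseteq> morse_boundary \<oo> \<and>
     (\<forall>N. morse_gauge N \<longrightarrow> openin (stratum_topology \<oo> N) (U \<inter> boundary_stratum \<oo> N))"
proof -
  define P where "P = (\<lambda>U. U \<subseteq> morse_boundary \<oo> \<and>
     (\<forall>N. morse_gauge N \<longrightarrow> openin (stratum_topology \<oo> N) (U \<inter> boundary_stratum \<oo> N)))"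
  have inter: "P (S \<inter> T)" if S: "P S" and T: "P T" for S T
    unfolding P_def
  proof (intro conjI allI impI)
    show "S \<inter> T \<subseteq> morse_boundary \<oo>" using S unfolding P_def by (meson inf.coboundedI1)
    fix N assume "morse_gauge N"
    with S T have "openin (stratum_topology \<oo> N) (S \<inter> boundary_stratum \<oo> N)"
      and "openin (stratum_topology \<oo> N) (T \<inter> boundary_stratum \<oo> N)"
      unfolding P_def by simp_all
    then have "openin (stratum_topology \<oo> N)
        ((S \<inter> boundary_stratum \<oo> N) \<inter> (T \<inter> boundary_stratum \<oo> N))"
      by (rule openin_Int)
    moreover have "(S \<inter> boundary_stratum \<oo> N) \<inter> (T \<inter> boundary_stratum \<oo> N) =
        S \<inter> T \<inter> boundary_stratum \<oo> N"
      by auto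
    ultimately show "openin (stratum_topology \<oo> N) (S \<inter> T \<inter> boundary_stratum \<oo> N)" by simp
  qed
  have union: "P (\<Union>\<K>)" if H: "\<And>K. K \<in> \<K> \<Longrightarrow> P K" for \<K>
    unfolding P_def
  proof (intro conjI allI impI)
    show "\<Union>\<K> \<subseteq> morse_boundary \<oo>" using H unfolding P_def by (meson Union_least)
    fix N assume "morse_gauge N"
    with H have "openin (stratum_topology \<oo> N) (\<Union>K\<in>\<K>. K \<inter> boundary_stratum \<oo> N)"
      unfolding P_def by (intro openin_Union) auto
    moreover have "(\<Union>K\<in>\<K>. K \<inter> boundary_stratum \<oo> N) = \<Union>\<K> \<inter> boundary_stratum \<oo> N" by auto
    ultimately show "openin (stratum_topology \<oo> N) (\<Union>\<K> \<inter> boundary_stratum \<oo> N)" by simp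
  qed
  have "istopology P" unfolding istopology_def using inter union by blast
  then have "openin (topology P) = P" by (rule topology_inverse')
  then show ?thesis unfolding morse_boundary_topology_def P_def by (rule fun_cong)
qed

section \<open>Limit sets, weak convex hulls, limit points\<close>

text \<open>The segment \<^term>\<open>\<gamma> k\<close> from \<^term>\<open>\<oo>\<close> to \<^term>\<open>a k\<close> is only meaningful on
  \<^term>\<open>{0..dist \<oo> (a k)}\<close>, so uniform convergence on \<^term>\<open>{0..T}\<close> includes that these
  intervals eventually contain \<^term>\<open>{0..T}\<close>.\<close>

definition limit_set :: "'x::metric_space \<Rightarrow> 'x set \<Rightarrow> 'x boundary_point set" where
  "limit_set \<oo> A = {x \<in> morse_boundary \<oo>. \<exists>N a \<gamma> \<alpha>. morse_gauge N \<and>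
     (\<forall>k::nat. a k \<in> A \<inter> stratum \<oo> N \<and> geodesic_segment \<oo> (a k) (\<gamma> k) \<and>
               is_morse N (\<gamma> k ` {0..dist \<oo> (a k)})) \<and>
     (\<forall>T\<ge>0. (\<forall>\<^sub>F k in sequentially. T \<le> dist \<oo> (a k)) \<and> uniform_limit {0..T} \<gamma> \<alpha> sequentially) \<and>
     \<alpha> \<in> morse_rays_from \<oo> \<and> ray_end \<oo> 0 \<alpha> = x}"

text \<open>Subsets of $X\cup\partial X$ are sets over the sum type. A ray has an endpoint at infinity in
  the Morse boundary only if it is Morse; for a line this applies to both half-lines.\<close>

definition weak_convex_hull ::
  "'x::metric_space \<Rightarrow> ('x + 'x boundary_point) set \<Rightarrow> 'x set" where
  "weak_convex_hull \<oo> A =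
     \<Union>{\<gamma> ` {a..b} | a b \<gamma>. a \<le> b \<and> geodesic {a..b} \<gamma> \<and> Inl (\<gamma> a) \<in> A \<and> Inl (\<gamma> b) \<in> A} \<union>
     \<Union>{\<gamma> ` {a..} | a \<gamma>. morse_ray a \<gamma> \<and> Inl (\<gamma> a) \<in> A \<and> Inr (ray_end \<oo> a \<gamma>) \<in> A} \<union>
     \<Union>{range \<gamma> | \<gamma>. geodesic UNIV \<gamma> \<and>
          morse_ray 0 \<gamma> \<and> Inr (ray_end \<oo> 0 \<gamma>) \<in> A \<and>
          morse_ray 0 (\<lambda>t. \<gamma> (- t)) \<and> Inr (ray_end \<oo> 0 (\<lambda>t. \<gamma> (- t))) \<in> A}"

definition rays_asymptotic ::
  "real \<Rightarrow> real \<Rightarrow> (real \<Rightarrow> 'x::metric_space) \<Rightarrow> real \<Rightarrow> (real \<Rightarrow> 'x) \<Rightarrow> bool" where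
  "rays_asymptotic K a \<alpha> b \<beta> \<longleftrightarrow> (\<exists>T\<ge>max a b. \<forall>t\<ge>T. dist (\<alpha> t) (\<beta> t) \<le> K)"

text \<open>The horoball of an N'-Morse ray depends on the gauge N' through $\delta_{N'}$, so N' is an
  argument.\<close>

definition morse_horoball ::
  "'x::metric_space \<Rightarrow> gauge_fun \<Rightarrow> gauge_fun \<Rightarrow> real \<Rightarrow> (real \<Rightarrow> 'x) \<Rightarrow> 'x set" where
  "morse_horoball \<oo> N N' a \<alpha> = {x \<in> stratum \<oo> N. \<exists>b \<beta>. geodesic {b..} \<beta> \<and>
     rays_asymptotic (morse_delta N') b \<beta> a \<alpha> \<and> b \<ge> a \<and> \<beta> b = x}"

definition horospherical_limit_point ::
  "'x::metric_space \<Rightarrow> 'x set \<Rightarrow> 'x boundary_point \<Rightarrow> bool" where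
  "horospherical_limit_point \<oo> A x \<longleftrightarrow> x \<in> morse_boundary \<oo> \<and>
     (\<forall>N' a \<alpha>. morse_gauge N' \<and> geodesic {a..} \<alpha> \<and> is_morse N' (\<alpha> ` {a..}) \<and> ray_end \<oo> a \<alpha> = x \<longrightarrow>
        (\<exists>N. morse_gauge N \<and> morse_horoball \<oo> N N' a \<alpha> \<inter> A \<noteq> {}))"

definition conical_limit_point ::
  "'x::metric_space \<Rightarrow> 'x set \<Rightarrow> 'x boundary_point \<Rightarrow> bool" where
  "conical_limit_point \<oo> A x \<longleftrightarrow> x \<in> morse_boundary \<oo> \<and>
     (\<exists>K>0. \<forall>a \<alpha>. morse_ray a \<alpha> \<and> ray_end \<oo> a \<alpha> = x \<longrightarrow> closed_nbhd K (\<alpha> ` {a..}) \<inter> A \<noteq> {})"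

section \<open>Group actions and stability\<close>

definition word_length :: "('g, 'r) monoid_scheme \<Rightarrow> 'g set \<Rightarrow> 'g \<Rightarrow> nat" where
  "word_length H S h = (LEAST n. \<exists>ws. length ws = n \<and> set ws \<subseteq> S \<union> m_inv H ` S \<and>
     foldr (mult H) ws (one H) = h)"

definition word_dist :: "('g, 'r) monoid_scheme \<Rightarrow> 'g set \<Rightarrow> 'g \<Rightarrow> 'g \<Rightarrow> real" where
  "word_dist H S g h = real (word_length H S (inv\<^bsub>H\<^esub> g \<otimes>\<^bsub>H\<^esub> h))"

definition qi_embedding :: "'y set \<Rightarrow> ('y \<Rightarrow> 'y \<Rightarrow> real) \<Rightarrow> ('y \<Rightarrow> 'x::metric_space) \<Rightarrow> bool" where
  "qi_embedding Y d f \<longleftrightarrow> (\<exists>K\<ge>1. \<exists>C\<ge>0. \<forall>y\<in>Y. \<forall>z\<in>Y.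
     1 / K * d y z - C \<le> dist (f y) (f z) \<and> dist (f y) (f z) \<le> K * d y z + C)"

text \<open>The quasi-geodesic constants are uniform over all pairs. Otherwise a pair could be joined by
  an arbitrary bounded set, since every map from a compact interval with bounded image is a
  quasi-geodesic for some constants.\<close>

definition stable_embedding ::
  "'y set \<Rightarrow> ('y \<Rightarrow> 'y \<Rightarrow> real) \<Rightarrow> ('y \<Rightarrow> 'x::metric_space) \<Rightarrow> bool" where
  "stable_embedding Y d f \<longleftrightarrow> qi_embedding Y d f \<and>
     (\<exists>N K C. morse_gauge N \<and> (\<forall>p\<in>f ` Y. \<forall>q\<in>f ` Y. \<exists>a b \<gamma>. a \<le> b \<and>
        quasi_geodesic K C {a..b} \<gamma> \<and> \<gamma> a = p \<and> \<gamma> b = q \<and> is_morse N (\<gamma> ` {a..b})))"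

definition isometric_action ::
  "('g, 'r) monoid_scheme \<Rightarrow> ('g \<Rightarrow> 'x::metric_space \<Rightarrow> 'x) \<Rightarrow> bool" where
  "isometric_action H \<phi> \<longleftrightarrow> group_action H UNIV \<phi> \<and>
     (\<forall>h\<in>carrier H. \<forall>x y. dist (\<phi> h x) (\<phi> h y) = dist x y)"

definition proper_action ::
  "('g, 'r) monoid_scheme \<Rightarrow> ('g \<Rightarrow> 'x::metric_space \<Rightarrow> 'x) \<Rightarrow> bool" where
  "proper_action H \<phi> \<longleftrightarrow> (\<forall>K. compact K \<longrightarrow> finite {h \<in> carrier H. \<phi> h ` K \<inter> K \<noteq> {}})"

text \<open>The centre of the ball lies in \<^term>\<open>Y\<close>, so the action on the empty set is not cobounded. This
  matters for a parabolic isometry of the hyperbolic plane: the limit set is a single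
  point, whose weak convex hull is empty.\<close>

definition cobounded_on ::
  "('g, 'r) monoid_scheme \<Rightarrow> ('g \<Rightarrow> 'x::metric_space \<Rightarrow> 'x) \<Rightarrow> 'x set \<Rightarrow> bool" where
  "cobounded_on H \<phi> Y \<longleftrightarrow> (\<exists>x\<in>Y. \<exists>R. Y \<subseteq> (\<Union>h\<in>carrier H. \<phi> h ` cball x R))"

definition group_limit_set ::
  "('g, 'r) monoid_scheme \<Rightarrow> ('g \<Rightarrow> 'x::metric_space \<Rightarrow> 'x) \<Rightarrow> 'x \<Rightarrow> 'x boundary_point set" where
  "group_limit_set H \<phi> \<oo> = limit_set \<oo> (orbit H \<phi> \<oo>)"

definition boundary_convex_cocompact ::
  "('g, 'r) monoid_scheme \<Rightarrow> ('g \<Rightarrow> 'x::metric_space \<Rightarrow> 'x) \<Rightarrow> 'x \<Rightarrow> bool" where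
  "boundary_convex_cocompact H \<phi> \<oo> \<longleftrightarrow> proper_action H \<phi> \<and>
     group_limit_set H \<phi> \<oo> \<noteq> {} \<and>
     compactin (morse_boundary_topology \<oo>) (group_limit_set H \<phi> \<oo>) \<and>
     cobounded_on H \<phi> (weak_convex_hull \<oo> (Inr ` group_limit_set H \<phi> \<oo>))"

end

theory Submission
  imports Defs
begin

text \<open>The Morse property of a geodesic is replaced by a property of pairs of points: any two
  quasi-geodesics with the same constants joining the points are uniformly close. It survives moving
  the points by a bounded amount, passing to limits, and passing from two sides of a triangle to the
  third: cutting a quasi-geodesic from x to y at a point nearest to the third vertex m and continuing
  to m gives quasi-geodesics from x to m and from y to m.

  All four conditions are equivalent to: geodesics between orbit points are uniformly Morse and stay
  uniformly close to the orbit. Compactness of the limit set bounds the gauges of its points, since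
  points with unbounded gauges form an infinite closed discrete set; as the limit set is invariant,
  any two orbit points are two vertices of an ideal triangle with uniformly Morse rays as sides, so
  the segment between them is uniformly Morse. If such segments leave every neighbourhood of the
  orbit, then translating the nearest orbit points to the basepoint yields in the limit a ray to a
  limit point along which the distance to the orbit is t up to a constant. Its horoballs far out miss
  the orbit, and it runs away from the weak convex hull.\<close>

section \<open>Quasi-geodesic paths\<close>

text \<open>Quasi-geodesics need not be continuous, so a path may have no point nearest to a given
  point and no intermediate value property; points nearest up to 1 and parameters at distance at
  most 1 take their place. In return, endpoints can be moved at the price of an additive constant.
  The recurring values have this origin: continuing a path from an almost nearest point to the
  vertex turns \<open>(K, C)\<close> into \<open>(3 * K, C + 2)\<close>, hence \<open>M 3 2\<close>
  for one such cut of a geodesic and \<open>M 9 4\<close> for two. The delicate estimates concern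
  asymptotic rays: their Hausdorff distance is finite but uncontrolled, and the bounds must involve
  the gauge alone, or neither the gauges of segments between orbit points nor the conical constant
  would be uniform. The weak convex hull of a set of boundary points consists of lines only, so
  comparing it with an escaping ray requires a line with the same end. The second limit point for
  such a line is found because coboundedness supplies a point of the hull.\<close>

definition near :: "real \<Rightarrow> 'x::metric_space set \<Rightarrow> 'x set \<Rightarrow> bool" where
  "near D A B \<longleftrightarrow> (\<forall>x\<in>A. \<exists>y\<in>B. dist x y \<le> D)"

lemma nearD: "near D A B \<Longrightarrow> x \<in> A \<Longrightarrow> \<exists>y\<in>B. dist x y \<le> D"
  by (simp add: near_def)

lemma near_nonneg: "near D A B \<Longrightarrow> A \<noteq> {} \<Longrightarrow> D \<ge> 0"
  unfolding near_def by (meson zero_le_dist ex_in_conv order_trans)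

lemma closed_nbhdI: "y \<in> A \<Longrightarrow> dist x y \<le> K \<Longrightarrow> x \<in> closed_nbhd K A"
  unfolding closed_nbhd_def using infdist_le2 by blast

text \<open>\<open>closed_nbhd\<close> is defined by an infimum, which need not be attained on the
  image of a discontinuous path. The slack \<open>e\<close> buys an actual point, and
  \<open>near\<close> records such points directly.\<close>

lemma closed_nbhdD:
  assumes "x \<in> closed_nbhd K A" "e > 0"
  shows "\<exists>y\<in>A. dist x y \<le> K + e"
proof -
  have A: "A \<noteq> {}" "infdist x A < K + e" using assms by (auto simp: closed_nbhd_def)
  then have "(INF a\<in>A. dist x a) < K + e" by (simp add: infdist_notempty)
  moreover have "bdd_below (dist x ` A)" by (auto simp: bdd_below_def intro: exI[of _ 0])
  ultimately obtain a where "a \<in> A" "dist x a < K + e"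
    using A(1) cINF_less_iff[of A "dist x" "K + e"] by auto
  then show ?thesis by (intro bexI[of _ a]) auto
qed

lemma near_imp_closed_nbhd: "near D A B \<Longrightarrow> A \<subseteq> closed_nbhd D B"
  unfolding near_def using closed_nbhdI by blast

lemma closed_nbhd_imp_near: "A \<subseteq> closed_nbhd D B \<Longrightarrow> e > 0 \<Longrightarrow> near (D + e) A B"
  unfolding near_def using closed_nbhdD by blast

definition qg_path :: "real \<Rightarrow> real \<Rightarrow> real \<Rightarrow> real \<Rightarrow> (real \<Rightarrow> 'x::metric_space) \<Rightarrow> 'x \<Rightarrow> 'x \<Rightarrow> bool" where
  "qg_path K C a b \<phi> x y \<longleftrightarrow> a \<le> b \<and> quasi_geodesic K C {a..b} \<phi> \<and> \<phi> a = x \<and> \<phi> b = y"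

lemma qg_pathI:
  assumes "K \<ge> 1" "C \<ge> 0" "a \<le> b" "\<phi> a = x" "\<phi> b = y"
    "\<And>s t. a \<le> s \<Longrightarrow> s \<le> t \<Longrightarrow> t \<le> b \<Longrightarrow> (t - s) / K - C \<le> dist (\<phi> s) (\<phi> t)"
    "\<And>s t. a \<le> s \<Longrightarrow> s \<le> t \<Longrightarrow> t \<le> b \<Longrightarrow> dist (\<phi> s) (\<phi> t) \<le> K * (t - s) + C"
  shows "qg_path K C a b \<phi> x y"
proof -
  have "1 / K * \<bar>s - t\<bar> - C \<le> dist (\<phi> s) (\<phi> t) \<and> dist (\<phi> s) (\<phi> t) \<le> K * \<bar>s - t\<bar> + C"
    if "s \<in> {a..b}" "t \<in> {a..b}" for s t
  proof (cases "s \<le> t")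
    case True then show ?thesis using assms(6,7)[of s t] that by simp
  next
    case False then show ?thesis using assms(6,7)[of t s] that by (simp add: dist_commute)
  qed
  then show ?thesis unfolding qg_path_def quasi_geodesic_def using assms(1-5) by (simp add: is_interval_cc)
qed

lemma qg_pathD:
  assumes "qg_path K C a b \<phi> x y"
  shows "K \<ge> 1" "C \<ge> 0" "a \<le> b" "\<phi> a = x" "\<phi> b = y"
    "\<And>s t. s \<in> {a..b} \<Longrightarrow> t \<in> {a..b} \<Longrightarrow> \<bar>s - t\<bar> / K - C \<le> dist (\<phi> s) (\<phi> t)"
    "\<And>s t. s \<in> {a..b} \<Longrightarrow> t \<in> {a..b} \<Longrightarrow> dist (\<phi> s) (\<phi> t) \<le> K * \<bar>s - t\<bar> + C"
    "\<And>s t. s \<in> {a..b} \<Longrightarrow> t \<in> {a..b} \<Longrightarrow> \<bar>s - t\<bar> \<le> K * (dist (\<phi> s) (\<phi> t) + C)"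
proof -
  show *: "K \<ge> 1" "C \<ge> 0" "a \<le> b" "\<phi> a = x" "\<phi> b = y"
    "\<And>s t. s \<in> {a..b} \<Longrightarrow> t \<in> {a..b} \<Longrightarrow> \<bar>s - t\<bar> / K - C \<le> dist (\<phi> s) (\<phi> t)"
    "\<And>s t. s \<in> {a..b} \<Longrightarrow> t \<in> {a..b} \<Longrightarrow> dist (\<phi> s) (\<phi> t) \<le> K * \<bar>s - t\<bar> + C"
    using assms unfolding qg_path_def quasi_geodesic_def by auto
  fix s t assume st: "s \<in> {a..b}" "t \<in> {a..b}"
  have "\<bar>s - t\<bar> / K \<le> dist (\<phi> s) (\<phi> t) + C" using *(6)[OF st] by linarith
  then show "\<bar>s - t\<bar> \<le> K * (dist (\<phi> s) (\<phi> t) + C)"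
    using *(1) by (simp add: pos_divide_le_eq mult.commute)
qed

lemma qg_path_mono:
  assumes "qg_path K C a b \<phi> x y" "K \<le> K'" "C \<le> C'"
  shows "qg_path K' C' a b \<phi> x y"
proof (rule qg_pathI)
  note q = qg_pathD[OF assms(1)]
  show "K' \<ge> 1" "C' \<ge> 0" "a \<le> b" "\<phi> a = x" "\<phi> b = y" using q assms by auto
  fix s t assume st: "a \<le> s" "s \<le> t" "t \<le> b"
  have "(t - s) / K' \<le> (t - s) / K" using q(1) assms st by (intro divide_left_mono) auto
  then show "(t - s) / K' - C' \<le> dist (\<phi> s) (\<phi> t)" using q(6)[of s t] assms(3) st by auto
  have "K * (t - s) \<le> K' * (t - s)" using assms st by (intro mult_right_mono) auto
  then show "dist (\<phi> s) (\<phi> t) \<le> K' * (t - s) + C'" using q(7)[of s t] assms(3) st by auto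
qed

lemma qg_path_reverse:
  assumes "qg_path K C a b \<phi> x y"
  shows "qg_path K C (- b) (- a) (\<lambda>t. \<phi> (- t)) y x"
proof (rule qg_pathI)
  note q = qg_pathD[OF assms]
  show "K \<ge> 1" "C \<ge> 0" "- b \<le> - a" "\<phi> (- (- b)) = y" "\<phi> (- (- a)) = x" using q by auto
  fix s t assume st: "- b \<le> s" "s \<le> t" "t \<le> - a"
  show "(t - s) / K - C \<le> dist (\<phi> (- s)) (\<phi> (- t))" using q(6)[of "-s" "-t"] st by auto
  show "dist (\<phi> (- s)) (\<phi> (- t)) \<le> K * (t - s) + C" using q(7)[of "-s" "-t"] st by auto
qed

lemma image_reverse: "(\<lambda>t. \<phi> (- t)) ` {- b..- a :: real} = \<phi> ` {a..b}"
proof -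
  have "uminus ` {- b..- a} = {a..b}" by simp
  then show ?thesis by (metis image_image)
qed

text \<open>Quasi-geodesics may be discontinuous, so moving the endpoints of a path to nearby points costs only
  an additive constant. The interval is enlarged because it may consist of a single point.\<close>

definition extend_path :: "real \<Rightarrow> real \<Rightarrow> (real \<Rightarrow> 'x) \<Rightarrow> 'x \<Rightarrow> 'x \<Rightarrow> real \<Rightarrow> 'x" where
  "extend_path a b \<phi> x y t = (if t < a then x else if t > b then y else \<phi> t)"

lemma qg_path_extend:
  assumes q: "qg_path K C a b \<phi> x' y'" and r: "dist x x' \<le> r" "dist y y' \<le> r"
  shows "qg_path K (C + 2 * r + 2) (a - 1) (b + 1) (extend_path a b \<phi> x y) x y"
proof -
  note q' = qg_pathD[OF q]
  have r0: "r \<ge> 0" using r(1) zero_le_dist order_trans by blast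
  \<comment> \<open>Clamping the parameter to \<open>{a..b}\<close> moves it by at most 1 at either
    end, which accounts for the summand 2; replacing the values at the two ends costs
    \<open>r\<close> each, which accounts for \<open>2 * r\<close>.\<close>
  define c where "c t = max a (min b t)" for t
  have c: "c t \<in> {a..b}" for t using q'(3) unfolding c_def by auto
  have d: "dist (extend_path a b \<phi> x y t) (\<phi> (c t)) \<le> r" for t
    using q'(3,4,5) r r0 unfolding c_def extend_path_def by (auto simp: max_def min_def)
  show ?thesis
  proof (rule qg_pathI)
    show "K \<ge> 1" "C + 2 * r + 2 \<ge> 0" "a - 1 \<le> b + 1"
      "extend_path a b \<phi> x y (a - 1) = x" "extend_path a b \<phi> x y (b + 1) = y"
      using q'(1-3) r0 by (auto simp: extend_path_def)
    fix s t assume st: "a - 1 \<le> s" "s \<le> t" "t \<le> b + 1"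
    let ?e = "extend_path a b \<phi> x y"
    have cl: "t - s - 2 \<le> c t - c s" "c t - c s \<le> t - s" "0 \<le> c t - c s"
      using st q'(3) unfolding c_def by auto
    have d1: "\<bar>dist (?e s) (?e t) - dist (\<phi> (c s)) (\<phi> (c t))\<bar> \<le> 2 * r"
      using d[of s] d[of t] by metric
    have "(t - s) / K - 2 \<le> (t - s) / K - 2 / K" using q'(1) by (simp add: divide_le_eq)
    also have "\<dots> = (t - s - 2) / K" by (simp add: diff_divide_distrib)
    also have "\<dots> \<le> (c t - c s) / K" using cl q'(1) by (intro divide_right_mono) auto
    finally have "(t - s) / K - 2 \<le> (c t - c s) / K" .
    then show "(t - s) / K - (C + 2 * r + 2) \<le> dist (?e s) (?e t)"
      using q'(6)[OF c c, of s t] d1 cl(3) unfolding abs_minus_commute[of "c s"] abs_of_nonneg[OF cl(3)]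
      by linarith
    have "K * (c t - c s) \<le> K * (t - s)" using cl q'(1) by (intro mult_left_mono) auto
    then show "dist (?e s) (?e t) \<le> K * (t - s) + (C + 2 * r + 2)"
      using q'(7)[OF c c, of s t] d1 cl(3) unfolding abs_minus_commute[of "c s"] abs_of_nonneg[OF cl(3)]
      by linarith
  qed
qed

lemma extend_path_image:
  assumes "a \<le> b"
  shows "\<phi> ` {a..b} \<subseteq> extend_path a b \<phi> x y ` {a - 1..b + 1}"
    "extend_path a b \<phi> x y ` {a - 1..b + 1} \<subseteq> insert x (insert y (\<phi> ` {a..b}))"
proof -
  have "extend_path a b \<phi> x y t = \<phi> t" if "t \<in> {a..b}" for t using that by (auto simp: extend_path_def)
  then have "\<phi> ` {a..b} = extend_path a b \<phi> x y ` {a..b}" by (auto intro: image_cong)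
  also have "\<dots> \<subseteq> extend_path a b \<phi> x y ` {a - 1..b + 1}" by (intro image_mono) auto
  finally show "\<phi> ` {a..b} \<subseteq> extend_path a b \<phi> x y ` {a - 1..b + 1}" .
  show "extend_path a b \<phi> x y ` {a - 1..b + 1} \<subseteq> insert x (insert y (\<phi> ` {a..b}))"
    by (auto simp: extend_path_def)
qed

lemma geodesicD:
  "geodesic I \<gamma> \<Longrightarrow> s \<in> I \<Longrightarrow> t \<in> I \<Longrightarrow> dist (\<gamma> s) (\<gamma> t) = \<bar>s - t\<bar>"
  by (simp add: geodesic_def)

lemma geodesic_sub:
  assumes "geodesic I \<gamma>" "J \<subseteq> I" "closed J" "is_interval J" "J \<noteq> {}"
  shows "geodesic J \<gamma>"
  using assms unfolding geodesic_def by blast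

lemma geodesic_iccI:
  assumes "a \<le> b" "\<And>s t. a \<le> s \<Longrightarrow> s \<le> t \<Longrightarrow> t \<le> b \<Longrightarrow> dist (\<gamma> s) (\<gamma> t) = t - s"
  shows "geodesic {a..b} \<gamma>"
proof -
  have "dist (\<gamma> s) (\<gamma> t) = \<bar>s - t\<bar>" if "s \<in> {a..b}" "t \<in> {a..b}" for s t
    using assms(2)[of s t] assms(2)[of t s] that by (cases "s \<le> t") (auto simp: dist_commute)
  then show ?thesis using assms(1) unfolding geodesic_def by (simp add: is_interval_cc)
qed

lemma geodesic_iciI:
  assumes "\<And>s t. a \<le> s \<Longrightarrow> s \<le> t \<Longrightarrow> dist (\<gamma> s) (\<gamma> t) = t - s"
  shows "geodesic {a..} \<gamma>"
proof -
  have "dist (\<gamma> s) (\<gamma> t) = \<bar>s - t\<bar>" if "s \<in> {a..}" "t \<in> {a..}" for s t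
    using assms(1)[of s t] assms(1)[of t s] that by (cases "s \<le> t") (auto simp: dist_commute)
  then show ?thesis unfolding geodesic_def by (simp add: is_interval_ci)
qed

lemma geodesic_qg_path:
  assumes "geodesic I \<gamma>" "s \<le> t" "{s..t} \<subseteq> I"
  shows "qg_path 1 0 s t \<gamma> (\<gamma> s) (\<gamma> t)"
  using assms geodesicD[OF assms(1)]
  by (intro qg_pathI) (auto simp: subset_iff)

lemma geodesic_is_interval: "geodesic I \<gamma> \<Longrightarrow> s \<in> I \<Longrightarrow> t \<in> I \<Longrightarrow> {s..t} \<subseteq> I"
  unfolding geodesic_def by (meson atLeastAtMost_iff is_interval_1 subsetI)

lemma geodesic_segmentD:
  assumes "geodesic_segment x y \<gamma>"
  shows "geodesic {0..dist x y} \<gamma>" "\<gamma> 0 = x" "\<gamma> (dist x y) = y"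
    "qg_path 1 0 0 (dist x y) \<gamma> x y"
  using assms geodesic_qg_path[of "{0..dist x y}" \<gamma> 0 "dist x y"] unfolding geodesic_segment_def by auto

lemma geodesic_segmentI:
  assumes "geodesic {0..b} \<gamma>" "b \<ge> 0"
  shows "geodesic_segment (\<gamma> 0) (\<gamma> b) \<gamma>"
  using geodesicD[OF assms(1), of 0 b] assms by (simp add: geodesic_segment_def)

definition concat_at :: "real \<Rightarrow> (real \<Rightarrow> 'x) \<Rightarrow> (real \<Rightarrow> 'x) \<Rightarrow> real \<Rightarrow> 'x" where
  "concat_at u \<phi> c t = (if t \<le> u then \<phi> t else c (t - u))"

lemma concat_at_image:
  assumes "a \<le> u" "A \<ge> 0" "c 0 = \<phi> u"
  shows "concat_at u \<phi> c ` {a..u + A} = \<phi> ` {a..u} \<union> c ` {0..A}"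
proof (intro equalityI subsetI)
  fix z assume "z \<in> concat_at u \<phi> c ` {a..u + A}"
  then obtain t where t: "t \<in> {a..u + A}" "z = concat_at u \<phi> c t" by auto
  show "z \<in> \<phi> ` {a..u} \<union> c ` {0..A}"
    using t by (cases "t \<le> u") (auto simp: concat_at_def)
next
  fix z assume "z \<in> \<phi> ` {a..u} \<union> c ` {0..A}"
  then consider t where "t \<in> {a..u}" "z = \<phi> t" | t where "t \<in> {0..A}" "z = c t" by auto
  then show "z \<in> concat_at u \<phi> c ` {a..u + A}"
  proof cases
    case 1 then show ?thesis using assms by (intro image_eqI[of _ _ t]) (auto simp: concat_at_def)
  next
    case 2 then show ?thesis using assms
      by (intro image_eqI[of _ _ "u + t"]) (auto simp: concat_at_def)
  qed
qed

text \<open>Take a point of the path at parameter distance \<open>l\<close> before \<open>u\<close>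
  and a point of the geodesic at distance \<open>a'\<close> after the corner. Since
  \<open>\<phi> u\<close> is almost nearest to \<open>m\<close>, their distance is at least
  \<open>a' - e\<close>; by the triangle inequality it is at least \<open>l / K - C - a'\<close>.
  Twice the first bound plus the second gives \<open>3 * d \<ge> a' + l / K - C - 2 * e\<close>,
  whence the factor 3.\<close>

lemma qg_path_concat:
  assumes q: "qg_path K C a b \<phi> x y" and u: "u \<in> {a..b}" and c: "geodesic_segment (\<phi> u) m c"
    and e: "e \<ge> 0" "\<And>t. t \<in> {a..u} \<Longrightarrow> dist m (\<phi> u) \<le> dist m (\<phi> t) + e"
  shows "qg_path (3 * K) (C + 2 * e) a (u + dist (\<phi> u) m) (concat_at u \<phi> c) x m"
proof -
  note q' = qg_pathD[OF q]
  let ?A = "dist (\<phi> u) m"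
  note c' = geodesic_segmentD[OF c]
  let ?h = "concat_at u \<phi> c"
  have K: "K \<ge> 1" using q'(1) .
  have mono1: "l / (3 * K) \<le> l / K" if "l \<ge> 0" for l
    using that K by (intro divide_left_mono) auto
  have mono2: "l / (3 * K) \<le> l" if "l \<ge> 0" for l
    using that K mult_left_mono[of 1 K l] by (simp add: divide_le_eq)
  have mono3: "l \<le> 3 * K * l" "K * l \<le> 3 * K * l" if "l \<ge> 0" for l
    using that K mult_right_mono[of 1 K l] by auto
  show ?thesis
  proof (rule qg_pathI)
    show "3 * K \<ge> 1" "C + 2 * e \<ge> 0" "a \<le> u + ?A" "?h a = x" using q' u e(1) by (auto simp: concat_at_def add_increasing2)
    show "?h (u + ?A) = m" using c' by (auto simp: concat_at_def)
    fix s t assume st: "a \<le> s" "s \<le> t" "t \<le> u + ?A"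
    consider "t \<le> u" | "s \<le> u" "u < t" | "u < s" using st by linarith
    then have "(t - s) / (3 * K) - (C + 2 * e) \<le> dist (?h s) (?h t) \<and> dist (?h s) (?h t) \<le> 3 * K * (t - s) + (C + 2 * e)"
    proof cases
      case 1
      then have "?h s = \<phi> s" "?h t = \<phi> t" using st by (auto simp: concat_at_def)
      moreover have "(t - s) / K - C \<le> dist (\<phi> s) (\<phi> t)" "dist (\<phi> s) (\<phi> t) \<le> K * (t - s) + C"
        using q'(6,7)[of s t] st u 1 by auto
      ultimately show ?thesis using mono1[of "t - s"] mono3[of "t - s"] st e(1) q'(2) by auto
    next
      case 3
      then have "dist (?h s) (?h t) = t - s"
        using st geodesicD[OF c'(1), of "s - u" "t - u"] by (auto simp: concat_at_def)
      then show ?thesis using mono2[of "t - s"] mono3[of "t - s"] st e(1) q'(2) by auto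
    next
      case 2
      define a' l where "a' = t - u" and "l = u - s"
      have al: "a' \<ge> 0" "l \<ge> 0" "t - s = a' + l" "a' \<le> ?A" using 2 st by (auto simp: a'_def l_def)
      have h: "?h s = \<phi> s" "?h t = c a'" using 2 by (auto simp: concat_at_def a'_def)
      have d1: "dist (\<phi> u) (c a') = a'" "dist (c a') m = ?A - a'"
        using geodesicD[OF c'(1), of 0 a'] geodesicD[OF c'(1), of a' ?A] c' al by auto
      have d2: "dist m (\<phi> u) \<le> dist m (\<phi> s) + e" using e(2)[of s] 2 st by auto
      have d3: "l / K - C \<le> dist (\<phi> s) (\<phi> u)" "dist (\<phi> s) (\<phi> u) \<le> K * l + C"
        using q'(6,7)[of s u] st u 2 by (auto simp: l_def)
      have f1: "dist (\<phi> s) (c a') \<ge> a' - e"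
        using d1 d2 by metric
      have f2: "dist (\<phi> s) (c a') \<ge> l / K - C - a'"
        using d1 d3 by metric
      have f3: "dist (\<phi> s) (c a') \<le> K * l + C + a'"
        using d1 d3 by metric
      have "a' / K \<le> a'" using al K mult_left_mono[of 1 K a'] by (simp add: divide_le_eq)
      then have "(a' + l) / K \<le> 3 * dist (\<phi> s) (c a') + 2 * e + C"
        using f1 f2 unfolding add_divide_distrib by linarith
      moreover have "(a' + l) / (3 * K) = (a' + l) / K / 3" by simp
      ultimately have "(a' + l) / (3 * K) - (C + 2 * e) \<le> dist (\<phi> s) (c a')"
        using e(1) q'(2) by linarith
      moreover have "K * l + C + a' \<le> 3 * K * (a' + l) + (C + 2 * e)"
        using mono3[of l] mono3[of a'] al e(1) by (simp add: ring_distribs)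
      ultimately show ?thesis using f3 h al(3) by auto
    qed
    then show "(t - s) / (3 * K) - (C + 2 * e) \<le> dist (?h s) (?h t)" "dist (?h s) (?h t) \<le> 3 * K * (t - s) + (C + 2 * e)"
      by auto
  qed
qed

text \<open>Substitute for a nearest point, which a discontinuous path may fail to have.\<close>

lemma approx_minimizer:
  fixes f :: "'a \<Rightarrow> real"
  assumes "S \<noteq> {}" "\<And>t. t \<in> S \<Longrightarrow> f t \<ge> 0" "e > 0"
  shows "\<exists>u\<in>S. \<forall>t\<in>S. f u \<le> f t + e"
proof -
  have bdd: "bdd_below (f ` S)" using assms(2) by (auto simp: bdd_below_def)
  have "Inf (f ` S) < Inf (f ` S) + e" using assms(3) by simp
  then obtain u where u: "u \<in> S" "f u < Inf (f ` S) + e"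
    using cInf_less_iff[OF _ bdd, of "Inf (f ` S) + e"] assms(1) by auto
  then have "f u \<le> f t + e" if "t \<in> S" for t
    using cInf_lower[OF _ bdd, of "f t"] that by fastforce
  then show ?thesis using u by blast
qed

section \<open>Pairs of points joined by uniformly close quasi-geodesics\<close>

text \<open>The two paths play symmetric parts, so this bounds their Hausdorff distance. It mentions
  no geodesic, which is why endpoints can be moved freely.\<close>

definition morse_pair :: "gauge_fun \<Rightarrow> 'x::metric_space \<Rightarrow> 'x \<Rightarrow> bool" where
  "morse_pair M x y \<longleftrightarrow> (\<forall>K C a b \<phi> c d \<psi>. qg_path K C a b \<phi> x y \<and> qg_path K C c d \<psi> x y \<longrightarrow>
     near (M K C) (\<phi> ` {a..b}) (\<psi> ` {c..d}))"

definition morse_pairs :: "gauge_fun \<Rightarrow> 'x::metric_space set \<Rightarrow> bool" where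
  "morse_pairs M A \<longleftrightarrow> (\<forall>x\<in>A. \<forall>y\<in>A. morse_pair M x y)"

lemma morse_pairsD: "morse_pairs M A \<Longrightarrow> x \<in> A \<Longrightarrow> y \<in> A \<Longrightarrow> morse_pair M x y"
  by (simp add: morse_pairs_def)

lemma morse_pairs_subset: "morse_pairs M A \<Longrightarrow> B \<subseteq> A \<Longrightarrow> morse_pairs M B"
  unfolding morse_pairs_def by blast

lemma morse_pairD:
  assumes "morse_pair M x y" "qg_path K C a b \<phi> x y" "qg_path K C c d \<psi> x y" "t \<in> {a..b}"
  shows "\<exists>s\<in>{c..d}. dist (\<phi> t) (\<psi> s) \<le> M K C"
proof -
  have "near (M K C) (\<phi> ` {a..b}) (\<psi> ` {c..d})" using assms(1-3) unfolding morse_pair_def by blast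
  then show ?thesis using assms(4) unfolding near_def by auto
qed

lemma morse_pairI:
  assumes "\<And>K C a b \<phi> c d \<psi> t. qg_path K C a b \<phi> x y \<Longrightarrow> qg_path K C c d \<psi> x y \<Longrightarrow> t \<in> {a..b} \<Longrightarrow>
     \<exists>s\<in>{c..d}. dist (\<phi> t) (\<psi> s) \<le> M K C"
  shows "morse_pair M x y"
  unfolding morse_pair_def near_def
proof (intro allI impI ballI)
  fix K C a b \<phi> c d \<psi> z
  assume q: "qg_path K C a b \<phi> x y \<and> qg_path K C c d \<psi> x y" and "z \<in> \<phi> ` {a..b}"
  then obtain t where t: "t \<in> {a..b}" "z = \<phi> t" by auto
  obtain s where "s \<in> {c..d}" "dist (\<phi> t) (\<psi> s) \<le> M K C" using assms[OF conjunct1[OF q] conjunct2[OF q] t(1)] by auto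
  then show "\<exists>w\<in>\<psi> ` {c..d}. dist z w \<le> M K C" using t by auto
qed

lemma morse_pair_sym: assumes "morse_pair M x y" shows "morse_pair M y x"
proof (rule morse_pairI)
  fix K C a b \<phi> c d \<psi> t
  assume a: "qg_path K C a b \<phi> y x" "qg_path K C c d \<psi> y x" "t \<in> {a..b}"
  obtain s where "s \<in> {-d..-c}" "dist (\<phi> t) (\<psi> (- s)) \<le> M K C"
    using morse_pairD[OF assms qg_path_reverse[OF a(1)] qg_path_reverse[OF a(2)], of "- t"] a(3) by auto
  then show "\<exists>s\<in>{c..d}. dist (\<phi> t) (\<psi> s) \<le> M K C" by (intro bexI[of _ "- s"]) auto
qed

lemma morse_pair_mono:
  assumes "morse_pair M x y" "\<And>K C. K \<ge> 1 \<Longrightarrow> C \<ge> 0 \<Longrightarrow> M K C \<le> M' K C"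
  shows "morse_pair M' x y"
proof (rule morse_pairI)
  fix K C a b \<phi> c d \<psi> t
  assume a: "qg_path K C a b \<phi> x y" "qg_path K C c d \<psi> x y" "t \<in> {a..b}"
  then obtain s where "s \<in> {c..d}" "dist (\<phi> t) (\<psi> s) \<le> M K C" using morse_pairD[OF assms(1) a] by auto
  moreover have "M K C \<le> M' K C" using assms(2) qg_pathD(1,2)[OF a(1)] .
  ultimately show "\<exists>s\<in>{c..d}. dist (\<phi> t) (\<psi> s) \<le> M' K C" by force
qed

lemma morse_pairs_mono:
  assumes "morse_pairs M A" "\<And>K C. K \<ge> 1 \<Longrightarrow> C \<ge> 0 \<Longrightarrow> M K C \<le> M' K C"
  shows "morse_pairs M' A"
  using assms morse_pair_mono unfolding morse_pairs_def by blast

lemma qg_path_isometry: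
  assumes "\<And>u v. dist (g u) (g v) = dist u v" "qg_path K C a b \<phi> x y"
  shows "qg_path K C a b (\<lambda>t. g (\<phi> t)) (g x) (g y)"
  using assms unfolding qg_path_def quasi_geodesic_def by simp

text \<open>The property is pulled back, since paths between \<open>x\<close> and \<open>y\<close>
  are pushed forward by \<open>g\<close>; no inverse of \<open>g\<close> is required.\<close>

lemma morse_pair_isometry:
  assumes g: "\<And>u v. dist (g u) (g v) = dist u v" and G: "morse_pair M (g x) (g y)"
  shows "morse_pair M x y"
proof (rule morse_pairI)
  fix K C a b \<phi> c d \<psi> t
  assume a: "qg_path K C a b \<phi> x y" "qg_path K C c d \<psi> x y" "t \<in> {a..b}"
  show "\<exists>s\<in>{c..d}. dist (\<phi> t) (\<psi> s) \<le> M K C"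
    using morse_pairD[OF G qg_path_isometry[OF g a(1)] qg_path_isometry[OF g a(2)] a(3)] g by auto
qed

text \<open>The additive constant is that of \<open>qg_path_extend\<close>; the final
  \<open>r\<close> covers the case where the nearby point is one of the moved endpoints.\<close>

definition perturbed :: "real \<Rightarrow> gauge_fun \<Rightarrow> gauge_fun" where
  "perturbed r M K C = M K (C + 2 * r + 2) + r"

lemma morse_pair_perturb:
  assumes G: "morse_pair M x y" and r: "dist x x' \<le> r" "dist y y' \<le> r"
  shows "morse_pair (perturbed r M) x' y'"
proof (rule morse_pairI)
  fix K C a b \<phi> c d \<psi> t
  assume a: "qg_path K C a b \<phi> x' y'" "qg_path K C c d \<psi> x' y'" "t \<in> {a..b}"
  have r': "dist x' x \<le> r" "dist y' y \<le> r" using r by (auto simp: dist_commute)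
  have cd: "c \<le> d" "\<psi> c = x'" "\<psi> d = y'" using qg_pathD[OF a(2)] by auto
  have r0: "r \<ge> 0" using r(1) zero_le_dist order_trans by blast
  have t: "t \<in> {a - 1..b + 1}" "extend_path a b \<phi> x y t = \<phi> t" using a(3) by (auto simp: extend_path_def)
  obtain s where s: "s \<in> {c - 1..d + 1}" "dist (\<phi> t) (extend_path c d \<psi> x y s) \<le> M K (C + 2 * r + 2)"
    using morse_pairD[OF G qg_path_extend[OF a(1) r] qg_path_extend[OF a(2) r] t(1)] t(2) by auto
  \<comment> \<open>Outside \<open>{c..d}\<close> the extended path sits at \<open>x\<close> or
    \<open>y\<close>, which is within \<open>r\<close> of the corresponding end of
    \<open>\<psi>\<close>.\<close>
  define s' where "s' = max c (min d s)"
  have "dist (extend_path c d \<psi> x y s) (\<psi> s') \<le> r" using cd r r0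
    unfolding s'_def extend_path_def by (auto simp: max_def min_def)
  then have "dist (\<phi> t) (\<psi> s') \<le> perturbed r M K C"
    using s(2) unfolding perturbed_def by metric
  moreover have "s' \<in> {c..d}" using cd unfolding s'_def by auto
  ultimately show "\<exists>s\<in>{c..d}. dist (\<phi> t) (\<psi> s) \<le> perturbed r M K C" by blast
qed

lemma morse_pairs_near:
  assumes "morse_pairs M A" "near r B A"
  shows "morse_pairs (perturbed r M) B"
  unfolding morse_pairs_def
proof (intro ballI)
  fix x y assume "x \<in> B" "y \<in> B"
  then obtain x' y' where "x' \<in> A" "dist x' x \<le> r" "y' \<in> A" "dist y' y \<le> r"
    using assms(2) unfolding near_def by (metis dist_commute)
  then show "morse_pair (perturbed r M) x y" using morse_pair_perturb morse_pairsD[OF assms(1)] by blast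
qed

text \<open>A coarse intermediate value argument: close parameters of \<phi> have close projections \<^term>\<open>p\<close>, so
  \<^term>\<open>p\<close> cannot jump over \<^term>\<open>r\<close>.\<close>

lemma qg_path_crosses:
  assumes q: "qg_path K C a b \<phi> x y" and D: "D \<ge> 0" and K0: "K0 \<ge> 1" "C0 \<ge> 0"
    and gam: "quasi_geodesic K0 C0 I \<gamma>" and r: "r \<in> I"
    and p: "\<And>u. u \<in> {a..b} \<Longrightarrow> p u \<in> I \<and> dist (\<phi> u) (\<gamma> (p u)) \<le> D"
    and u0: "u0 \<in> {a..b}" "p u0 \<le> r" "r \<le> p b"
  shows "\<exists>u\<in>{u0..b}. dist (\<gamma> r) (\<phi> u) \<le> K0 * (K0 * (K + C + 2 * D + C0)) + C0 + D"
proof -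
  note q' = qg_pathD[OF q]
  define S where "S = {u \<in> {u0..b}. p u \<le> r}"
  have S: "u0 \<in> S" "bdd_above S" using u0 unfolding S_def by (auto simp: bdd_above_def)
  define us where "us = Sup S"
  have "Sup S \<le> b" using S(1) by (intro cSup_least) (auto simp: S_def)
  then have us: "u0 \<le> us" "us \<le> b" using cSup_upper[OF S(1) S(2)] unfolding us_def by auto
  \<comment> \<open>The supremum need not belong to \<open>S\<close>. Parameters within 1/2 on
    either side of it have projections on opposite sides of \<open>r\<close> and are at most 1
    apart, so \<open>\<phi>\<close> moves by at most \<open>K + C\<close> between them.\<close>
  have "us - 1/2 < Sup S" unfolding us_def by simp
  then obtain u1 where u1: "u1 \<in> S" "us - 1/2 < u1" using less_cSup_iff[of S "us - 1/2"] S by auto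
  have u1': "u1 \<le> us" using cSup_upper[OF u1(1) S(2)] us_def by simp
  obtain u2 where u2: "u2 \<in> {u1..b}" "u2 - u1 \<le> 1" "r \<le> p u2"
  proof (cases "us = b")
    case True then show ?thesis using u1 u1' u0 that[of b] us by auto
  next
    case False
    define u2 where "u2 = min b (us + 1/2)"
    have "u2 > us" "u2 \<le> b" "u2 \<le> us + 1/2" using False us unfolding u2_def by auto
    moreover then have "u2 \<notin> S" using cSup_upper[OF _ S(2), of u2] us_def by auto
    ultimately show ?thesis using that[of u2] u1 u1' us unfolding S_def by auto
  qed
  have mem: "u1 \<in> {a..b}" "u2 \<in> {a..b}" "p u1 \<le> r" "u0 \<le> u1" using u1 u2 u0 unfolding S_def by auto
  have "dist (\<phi> u1) (\<phi> u2) \<le> K * \<bar>u1 - u2\<bar> + C" using q'(7) mem by blast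
  also have "\<dots> \<le> K + C" using u2 q'(1) mult_left_mono[of "u2 - u1" 1 K] by auto
  finally have "dist (\<phi> u1) (\<phi> u2) \<le> K + C" .
  then have "dist (\<gamma> (p u1)) (\<gamma> (p u2)) \<le> K + C + 2 * D"
    using p[OF mem(1)] p[OF mem(2)] by metric
  moreover have g: "1 / K0 * \<bar>s - t\<bar> - C0 \<le> dist (\<gamma> s) (\<gamma> t)" "dist (\<gamma> s) (\<gamma> t) \<le> K0 * \<bar>s - t\<bar> + C0"
    if "s \<in> I" "t \<in> I" for s t using gam that unfolding quasi_geodesic_def by auto
  ultimately have "\<bar>p u1 - p u2\<bar> / K0 \<le> K + C + 2 * D + C0"
    using g(1)[of "p u1" "p u2"] p mem by fastforce
  then have "\<bar>p u1 - p u2\<bar> \<le> K0 * (K + C + 2 * D + C0)" using K0 by (simp add: pos_divide_le_eq mult.commute)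
  then have "\<bar>r - p u1\<bar> \<le> K0 * (K + C + 2 * D + C0)" using mem(3) u2(3) by linarith
  then have "K0 * \<bar>r - p u1\<bar> \<le> K0 * (K0 * (K + C + 2 * D + C0))" using K0 by (intro mult_left_mono) auto
  then have "dist (\<gamma> r) (\<gamma> (p u1)) \<le> K0 * (K0 * (K + C + 2 * D + C0)) + C0"
    using g(2)[OF r, of "p u1"] p[OF mem(1)] by linarith
  then have "dist (\<gamma> r) (\<phi> u1) \<le> K0 * (K0 * (K + C + 2 * D + C0)) + C0 + D"
    using p[OF mem(1)] dist_triangle[of "\<gamma> r" "\<phi> u1" "\<gamma> (p u1)"] dist_commute[of "\<phi> u1" "\<gamma> (p u1)"] by linarith
  then show ?thesis using mem by (intro bexI[of _ u1]) auto
qed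

text \<open>The bound of \<open>qg_path_crosses\<close> with \<open>D = N K C + 1\<close>, where the
  1 turns a closed neighbourhood into attained points.\<close>

definition cross_const :: "real \<Rightarrow> real \<Rightarrow> gauge_fun \<Rightarrow> gauge_fun" where
  "cross_const K0 C0 N K C = K0 * (K0 * (K + C + 2 * (N K C + 1) + C0)) + C0 + (N K C + 1)"

text \<open>All but the last \<open>E\<close> bounds the distance from a path to the piece of
  \<open>\<gamma>\<close> between its endpoints; the last \<open>E\<close> leads from that piece to
  the other path.\<close>

definition pair_gauge :: "real \<Rightarrow> real \<Rightarrow> gauge_fun \<Rightarrow> gauge_fun" where
  "pair_gauge K0 C0 N K C = (let E = cross_const K0 C0 N K C in K * (K * (E + C)) + C + E + E)"

text \<open>The Morse condition only places the path near the whole of \<open>\<gamma>\<close>. Its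
  projection runs from \<open>s\<close> to \<open>t\<close>, so it crosses every \<open>r\<close> in
  between, which is the first claim. If a point projects before \<open>s\<close>, the path must
  later cross \<open>s\<close> again, close to where it started; a quasi-geodesic returns only after
  bounded time, so the point is itself close to \<open>\<gamma> s\<close>. The case beyond
  \<open>t\<close> is symmetric.\<close>

lemma is_morse_between:
  assumes N: "morse_gauge N" and K0: "K0 \<ge> 1" "C0 \<ge> 0" and gam: "quasi_geodesic K0 C0 I \<gamma>" and m: "is_morse N (\<gamma> ` I)"
    and st: "s \<in> I" "t \<in> I" "s \<le> t" and q: "qg_path K C a b \<phi> (\<gamma> s) (\<gamma> t)"
  defines "E \<equiv> cross_const K0 C0 N K C"
  shows "\<And>r. r \<in> {s..t} \<Longrightarrow> \<exists>u\<in>{a..b}. dist (\<gamma> r) (\<phi> u) \<le> E"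
    "\<And>u. u \<in> {a..b} \<Longrightarrow> \<exists>r\<in>{s..t}. dist (\<phi> u) (\<gamma> r) \<le> K * (K * (E + C)) + C + E"
proof -
  note q' = qg_pathD[OF q]
  have KC: "K \<ge> 1" "C \<ge> 0" using q' by auto
  define D where "D = N K C + 1"
  have D: "D \<ge> 0" using N KC unfolding D_def morse_gauge_def by (simp add: add_nonneg_pos less_imp_le)
  have E: "E = K0 * (K0 * (K + C + 2 * D + C0)) + C0 + D" unfolding E_def D_def cross_const_def by simp
  have "K0 * (K0 * (K + C + 2 * D + C0)) \<ge> 0" using KC K0 D by (intro mult_nonneg_nonneg) auto
  then have DE: "D \<le> E" using K0 E by simp
  have "\<phi> ` {a..b} \<subseteq> closed_nbhd (N K C) (\<gamma> ` I)"
    using m q st q'(4,5) unfolding is_morse_def qg_path_def by (metis imageI)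
  then have "near D (\<phi> ` {a..b}) (\<gamma> ` I)" unfolding D_def by (rule closed_nbhd_imp_near) simp
  then have "\<forall>u\<in>{a..b}. \<exists>p. p \<in> I \<and> dist (\<phi> u) (\<gamma> p) \<le> D" unfolding near_def by auto
  then have "\<exists>p0. \<forall>u\<in>{a..b}. p0 u \<in> I \<and> dist (\<phi> u) (\<gamma> (p0 u)) \<le> D" by (rule bchoice)
  then obtain p0 where p0: "\<And>u. u \<in> {a..b} \<Longrightarrow> p0 u \<in> I \<and> dist (\<phi> u) (\<gamma> (p0 u)) \<le> D" by fastforce
  \<comment> \<open>Pinning the projection at both ends makes it start at \<open>s\<close> and end
    at \<open>t\<close> exactly. This is inconsistent when \<open>a = b\<close>, which is therefore
    treated apart.\<close>
  define p where "p u = (if u = a then s else if u = b then t else p0 u)" for u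
  have p: "p u \<in> I \<and> dist (\<phi> u) (\<gamma> (p u)) \<le> D" if "u \<in> {a..b}" for u
    using p0[OF that] st q' D unfolding p_def by auto
  have pa: "p a = s" unfolding p_def by simp
  have I: "{s..t} \<subseteq> I" using gam st unfolding quasi_geodesic_def
    by (meson atLeastAtMost_iff is_interval_1 subsetI)
  show cross: "\<exists>u\<in>{a..b}. dist (\<gamma> r) (\<phi> u) \<le> E" if r: "r \<in> {s..t}" for r
  proof (cases "a = b")
    case False
    then have "p b = t" unfolding p_def by auto
    then show ?thesis using qg_path_crosses[OF q D K0 gam _ p, of r a] r I q'(3) pa unfolding E by auto
  next
    \<comment> \<open>The path is a single point, so \<open>\<gamma> s = \<gamma> t\<close> and the
      lower quasi-geodesic bound limits \<open>t - s\<close> to \<open>K0 * C0\<close>.\<close>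
    case True
    then have "\<gamma> s = \<gamma> t" using q' by simp
    then have "\<bar>s - t\<bar> \<le> K0 * C0" using gam st K0 unfolding quasi_geodesic_def
      by (force simp: divide_simps mult.commute)
    then have "\<bar>s - r\<bar> \<le> K0 * C0" using r by auto
    moreover have "r \<in> I" using r I by blast
    then have "dist (\<gamma> r) (\<gamma> s) \<le> K0 * \<bar>r - s\<bar> + C0" using gam st(1) unfolding quasi_geodesic_def by blast
    ultimately have "dist (\<gamma> r) (\<gamma> s) \<le> K0 * (K0 * C0) + C0"
      using K0 mult_left_mono[of "\<bar>r - s\<bar>" "K0 * C0" K0] abs_minus_commute[of r s] by linarith
    also have "K0 * (K0 * C0) \<le> K0 * (K0 * (K + C + 2 * D + C0))"
      using K0 KC D by (intro mult_left_mono) auto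
    then have "K0 * (K0 * C0) + C0 \<le> E" unfolding E using D by simp
    finally show ?thesis using q'(3,4) by (intro bexI[of _ a]) auto
  qed
  show "\<exists>r\<in>{s..t}. dist (\<phi> u) (\<gamma> r) \<le> K * (K * (E + C)) + C + E" if u: "u \<in> {a..b}" for u
  proof -
    have E0: "E \<ge> 0" using DE D by simp
    have F: "K * (K * (E + C)) + C + E \<ge> D" using KC E0 DE by (simp add: add_increasing)
    consider "p u \<in> {s..t}" | "p u < s" | "p u > t" by fastforce
    then show ?thesis
    proof cases
      case 1
      then show ?thesis using p[OF u] F by (intro bexI[of _ "p u"]) auto
    next
      case 2
      then have ne: "a \<noteq> b" using pa u by auto
      then have "p b = t" unfolding p_def by auto
      then obtain u1 where u1: "u1 \<in> {u..b}" "dist (\<gamma> s) (\<phi> u1) \<le> E"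
        using qg_path_crosses[OF q D K0 gam _ p, of s u] st u 2 unfolding E by auto
      have "\<bar>a - u1\<bar> \<le> K * (dist (\<phi> a) (\<phi> u1) + C)" using q'(8)[of a u1] u1 u q'(3) by auto
      also have "\<dots> \<le> K * (E + C)" using u1 KC q'(4) by (intro mult_left_mono) auto
      finally have "\<bar>u - a\<bar> \<le> K * (E + C)" using u u1 by auto
      then have "K * \<bar>u - a\<bar> \<le> K * (K * (E + C))" using KC by (intro mult_left_mono) auto
      then have "dist (\<phi> u) (\<gamma> s) \<le> K * (K * (E + C)) + C + E"
        using q'(7)[of u a] u q'(3,4) E0 by auto
      then show ?thesis using st by (intro bexI[of _ s]) auto
    next
      case 3
      then have ne: "a \<noteq> b" using pa u st by auto
      then have pb: "p b = t" unfolding p_def by auto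
      \<comment> \<open>Mirror image of the previous case: reversing both paths turns a projection
        beyond \<open>t\<close> into one before \<open>- t\<close>, so the crossing is found between
        \<open>a\<close> and \<open>u\<close>.\<close>
      have I': "quasi_geodesic K0 C0 (uminus ` I) (\<lambda>r. \<gamma> (- r))"
      proof -
        have "is_interval (uminus ` I)" using gam unfolding quasi_geodesic_def by simp
        then show ?thesis using gam closed_negations[of I] unfolding quasi_geodesic_def 
          by (auto simp: abs_minus_commute)
      qed
      have "\<exists>v\<in>{- u..- a}. dist (\<gamma> (- (- t))) (\<phi> (- v)) \<le> K0 * (K0 * (K + C + 2 * D + C0)) + C0 + D"
        by (rule qg_path_crosses[OF qg_path_reverse[OF q] D K0 I', where p = "\<lambda>v. - p (- v)"])
           (use st u 3 pa pb p in auto)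
      then obtain v where v: "v \<in> {- u..- a}" "dist (\<gamma> t) (\<phi> (- v)) \<le> E" unfolding E by auto
      then obtain u1 where u1: "u1 \<in> {a..u}" "dist (\<gamma> t) (\<phi> u1) \<le> E"
        by (metis atLeastAtMost_iff minus_le_iff le_minus_iff)
      have "\<bar>b - u1\<bar> \<le> K * (dist (\<phi> b) (\<phi> u1) + C)" using q'(8)[of b u1] u1 u q'(3) by auto
      also have "\<dots> \<le> K * (E + C)" using u1 KC q'(5) by (intro mult_left_mono) auto
      finally have "\<bar>u - b\<bar> \<le> K * (E + C)" using u u1 by auto
      then have "K * \<bar>u - b\<bar> \<le> K * (K * (E + C))" using KC by (intro mult_left_mono) auto
      then have "dist (\<phi> u) (\<gamma> t) \<le> K * (K * (E + C)) + C + E"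
        using q'(7)[of u b] u q'(3,5) E0 by auto
      then show ?thesis using st by (intro bexI[of _ t]) auto
    qed
  qed
qed

text \<open>The piece of \<open>\<gamma>\<close> between the two points serves as intermediary: one
  path is near the piece, and the piece is near the other path.\<close>

lemma is_morse_imp_morse_pairs:
  assumes N: "morse_gauge N" and gam: "quasi_geodesic K0 C0 I \<gamma>" and m: "is_morse N (\<gamma> ` I)"
  shows "morse_pairs (pair_gauge K0 C0 N) (\<gamma> ` I)"
proof -
  have K0: "K0 \<ge> 1" "C0 \<ge> 0" using gam unfolding quasi_geodesic_def by auto
  have *: "morse_pair (pair_gauge K0 C0 N) (\<gamma> s) (\<gamma> t)" if st: "s \<in> I" "t \<in> I" "s \<le> t" for s t
  proof (rule morse_pairI)
    fix K C a b \<phi> c d \<psi> u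
    assume a: "qg_path K C a b \<phi> (\<gamma> s) (\<gamma> t)" "qg_path K C c d \<psi> (\<gamma> s) (\<gamma> t)" "u \<in> {a..b}"
    let ?E = "cross_const K0 C0 N K C"
    obtain r where r: "r \<in> {s..t}" "dist (\<phi> u) (\<gamma> r) \<le> K * (K * (?E + C)) + C + ?E"
      using is_morse_between(2)[OF N K0 gam m st a(1,3)] by auto
    obtain v where v: "v \<in> {c..d}" "dist (\<gamma> r) (\<psi> v) \<le> ?E"
      using is_morse_between(1)[OF N K0 gam m st a(2) r(1)] by auto
    have "dist (\<phi> u) (\<psi> v) \<le> pair_gauge K0 C0 N K C"
      using r v unfolding pair_gauge_def Let_def by metric
    then show "\<exists>v\<in>{c..d}. dist (\<phi> u) (\<psi> v) \<le> pair_gauge K0 C0 N K C" using v by blast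
  qed
  show ?thesis unfolding morse_pairs_def
  proof (intro ballI)
    fix x y assume "x \<in> \<gamma> ` I" "y \<in> \<gamma> ` I"
    then obtain s t where "s \<in> I" "t \<in> I" "x = \<gamma> s" "y = \<gamma> t" by auto
    then show "morse_pair (pair_gauge K0 C0 N) x y" using *[of s t] morse_pair_sym[OF *[of t s]] by (cases "s \<le> t") auto
  qed
qed

lemma geodesic_is_quasi_geodesic: "geodesic I \<gamma> \<Longrightarrow> quasi_geodesic 1 0 I \<gamma>"
  unfolding geodesic_def quasi_geodesic_def by simp

lemma morse_pairs_geodesic_sub_path:
  assumes "geodesic I \<gamma>" "x \<in> \<gamma> ` I" "y \<in> \<gamma> ` I"
  obtains a b \<psi> where "qg_path 1 0 a b \<psi> x y" "\<psi> ` {a..b} \<subseteq> \<gamma> ` I"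
proof -
  obtain s t where st: "s \<in> I" "t \<in> I" "\<gamma> s = x" "\<gamma> t = y" using assms by auto
  show thesis
  proof (cases "s \<le> t")
    case True
    have I: "{s..t} \<subseteq> I" using geodesic_is_interval[OF assms(1)] st by auto
    show thesis using that[OF geodesic_qg_path[OF assms(1) True I, unfolded st(3,4)]] image_mono[OF I] .
  next
    case False
    then have ts: "{t..s} \<subseteq> I" "t \<le> s" using geodesic_is_interval[OF assms(1) st(2,1)] by auto
    have "qg_path 1 0 (- s) (- t) (\<lambda>t. \<gamma> (- t)) x y"
      using qg_path_reverse[OF geodesic_qg_path[OF assms(1) ts(2,1)]] st by simp
    moreover have "(\<lambda>t. \<gamma> (- t)) ` {- s..- t} \<subseteq> \<gamma> ` I" unfolding image_reverse using ts by blast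
    ultimately show thesis using that by blast
  qed
qed

lemma morse_pairs_path_near:
  assumes g: "geodesic I \<gamma>" and h: "morse_pairs M (\<gamma> ` I)"
    and q: "qg_path K C a b \<phi> x y" "x \<in> \<gamma> ` I" "y \<in> \<gamma> ` I"
  shows "near (M K C) (\<phi> ` {a..b}) (\<gamma> ` I)"
proof -
  obtain c d \<psi> where p: "qg_path 1 0 c d \<psi> x y" "\<psi> ` {c..d} \<subseteq> \<gamma> ` I"
    using morse_pairs_geodesic_sub_path[OF g q(2,3)] .
  have p': "qg_path K C c d \<psi> x y" using qg_path_mono[OF p(1)] qg_pathD(1,2)[OF q(1)] by auto
  show ?thesis unfolding near_def
  proof
    fix z assume "z \<in> \<phi> ` {a..b}"
    then obtain t where "t \<in> {a..b}" "z = \<phi> t" by auto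
    then show "\<exists>y\<in>\<gamma> ` I. dist z y \<le> M K C" using morse_pairD[OF morse_pairsD[OF h q(2,3)] q(1) p'] p(2) by blast
  qed
qed

lemma morse_pairs_imp_is_morse:
  assumes "geodesic I \<gamma>" "morse_pairs M (\<gamma> ` I)"
  shows "is_morse M (\<gamma> ` I)"
  unfolding is_morse_def
proof (intro allI impI)
  fix K C a b \<phi> assume "a \<le> b \<and> quasi_geodesic K C {a..b} \<phi> \<and> \<phi> a \<in> \<gamma> ` I \<and> \<phi> b \<in> \<gamma> ` I"
  then have "qg_path K C a b \<phi> (\<phi> a) (\<phi> b)" "\<phi> a \<in> \<gamma> ` I" "\<phi> b \<in> \<gamma> ` I" unfolding qg_path_def by auto
  then show "\<phi> ` {a..b} \<subseteq> closed_nbhd (M K C) (\<gamma> ` I)"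
    using near_imp_closed_nbhd[OF morse_pairs_path_near[OF assms]] by blast
qed

text \<open>\<open>morse_pairs\<close> puts no sign condition on its gauge, whereas
  \<open>morse_gauge\<close> demands nonnegative values.\<close>

definition pos_gauge :: "gauge_fun \<Rightarrow> gauge_fun" where "pos_gauge M K C = max 0 (M K C)"

lemma morse_gauge_pos_gauge: "morse_gauge (pos_gauge M)"
  by (simp add: morse_gauge_def pos_gauge_def)

lemma morse_pairs_pos_gauge: "morse_pairs M A \<Longrightarrow> morse_pairs (pos_gauge M) A"
  by (erule morse_pairs_mono) (simp add: pos_gauge_def)

lemma morse_ray_iff_morse_pairs: "morse_ray a \<alpha> \<longleftrightarrow> geodesic {a..} \<alpha> \<and> (\<exists>M. morse_pairs M (\<alpha> ` {a..}))"
  unfolding morse_ray_def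
  using morse_pairs_imp_is_morse[of "{a..}" \<alpha>] morse_pairs_pos_gauge[of _ "\<alpha> ` {a..}"] morse_gauge_pos_gauge
    is_morse_imp_morse_pairs[OF _ geodesic_is_quasi_geodesic] by metis

section \<open>Triangles and asymptotic rays\<close>

text \<open>\<open>D\<close> is the gauge at the constants of \<open>qg_path_concat\<close> with
  \<open>e = 1\<close>. The summand up to \<open>C + D\<close> bounds how much farther from the
  third vertex one path stays than the other, 1 is the error of the nearest point, and
  \<open>2 * D\<close> comes from two applications of closeness.\<close>

definition triangle_gauge :: "gauge_fun \<Rightarrow> gauge_fun" where
  "triangle_gauge M K C = (let D = M (3 * K) (C + 2) in K * (K * (2 * D + C)) + C + D + 1 + 2 * D)"

text \<open>\<open>M 3 2\<close> is the thinness constant of the triangle, by which the third side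
  is a perturbation of the union of the other two. The maximum covers pairs on one side as well as
  on different sides.\<close>

definition third_side_gauge :: "gauge_fun \<Rightarrow> gauge_fun" where
  "third_side_gauge M = perturbed (M 3 2) (\<lambda>K C. max (M K C) (triangle_gauge M K C))"

lemma concat_paths_near:
  assumes G: "morse_pair M x m" and p: "qg_path K C a b \<phi> x y" "qg_path K C c d \<psi> x y'"
    and u: "u \<in> {a..b}" "\<And>t. t \<in> {a..b} \<Longrightarrow> dist m (\<phi> u) \<le> dist m (\<phi> t) + 1"
    and v: "v \<in> {c..d}" "\<And>t. t \<in> {c..d} \<Longrightarrow> dist m (\<psi> v) \<le> dist m (\<psi> t) + 1"
    and s: "geodesic_segment (\<phi> u) m f" "geodesic_segment (\<psi> v) m g"
  shows "near (M (3 * K) (C + 2)) (\<phi> ` {a..u} \<union> f ` {0..dist (\<phi> u) m}) (\<psi> ` {c..v} \<union> g ` {0..dist (\<psi> v) m})"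
proof -
  have 1: "qg_path (3 * K) (C + 2 * 1) a (u + dist (\<phi> u) m) (concat_at u \<phi> f) x m"
    by (rule qg_path_concat[OF p(1) u(1) s(1)]) (use u in auto)
  have 2: "qg_path (3 * K) (C + 2 * 1) c (v + dist (\<psi> v) m) (concat_at v \<psi> g) x m"
    by (rule qg_path_concat[OF p(2) v(1) s(2)]) (use v in auto)
  have "near (M (3 * K) (C + 2)) (concat_at u \<phi> f ` {a..u + dist (\<phi> u) m}) (concat_at v \<psi> g ` {c..v + dist (\<psi> v) m})"
    using G 1 2 unfolding morse_pair_def by simp
  then show ?thesis
    using concat_at_image[of a u "dist (\<phi> u) m" f \<phi>] concat_at_image[of c v "dist (\<psi> v) m" g \<psi>]
      u(1) v(1) geodesic_segmentD(2)[OF s(1)] geodesic_segmentD(2)[OF s(2)] by simp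
qed

lemma near_Un: "near D A C \<Longrightarrow> near D B C' \<Longrightarrow> near D (A \<union> B) (C \<union> C')"
  unfolding near_def by blast

lemma near_subset: "near D A B \<Longrightarrow> A' \<subseteq> A \<Longrightarrow> near D A' B"
  unfolding near_def by blast

lemma geodesic_segment_endpoints:
  assumes "geodesic_segment x y \<gamma>"
  shows "x \<in> \<gamma> ` {0..dist x y}" "y \<in> \<gamma> ` {0..dist x y}"
proof -
  have "\<gamma> 0 \<in> \<gamma> ` {0..dist x y}" "\<gamma> (dist x y) \<in> \<gamma> ` {0..dist x y}" by simp_all
  then show "x \<in> \<gamma> ` {0..dist x y}" "y \<in> \<gamma> ` {0..dist x y}" by (simp_all add: geodesic_segmentD(2,3)[OF assms])
qed

lemma approx_nearest:
  fixes \<phi> :: "real \<Rightarrow> 'x::metric_space"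
  assumes "(a::real) \<le> b"
  obtains u where "u \<in> {a..b}" "\<And>t. t \<in> {a..b} \<Longrightarrow> dist m (\<phi> u) \<le> dist m (\<phi> t) + 1"
proof -
  have "\<exists>u\<in>{a..b}. \<forall>t\<in>{a..b}. dist m (\<phi> u) \<le> dist m (\<phi> t) + 1"
    by (rule approx_minimizer) (use assms in auto)
  then show thesis using that by blast
qed

locale proper_geodesic_space =
  fixes \<oo> :: "'x::metric_space"
  assumes proper_space: "\<And>(x::'x) r. compact (cball x r)"
    and geodesic_space: "\<And>x y::'x. \<exists>\<gamma>. geodesic_segment x y \<gamma>"
begin

text \<open>Cut both paths where they are almost nearest to \<open>m\<close> and continue to
  \<open>m\<close>. The resulting paths are close on the side of \<open>x\<close> and on the side of
  \<open>y\<close>. What remains to exclude is that a point of \<open>\<phi>\<close> is close only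
  to the added geodesic \<open>g\<close>, far from \<open>\<psi>\<close>; this is controlled by
  comparing the distances \<open>A\<close> and \<open>B\<close> of the two paths from
  \<open>m\<close>.\<close>

lemma morse_pair_triangle:
  fixes x y m :: 'x
  assumes G: "morse_pair M x m" "morse_pair M y m"
  shows "morse_pair (triangle_gauge M) x y"
proof (rule morse_pairI)
  fix K C a b \<phi> c d \<psi> t
  assume p: "qg_path K C a b \<phi> x y" "qg_path K C c d \<psi> x y" and t: "t \<in> {a..b}"
  note q = qg_pathD[OF p(1)]
  obtain u where u: "u \<in> {a..b}" "\<And>t. t \<in> {a..b} \<Longrightarrow> dist m (\<phi> u) \<le> dist m (\<phi> t) + 1"
    using approx_nearest[OF qg_pathD(3)[OF p(1)]] by blast
  obtain v where v: "v \<in> {c..d}" "\<And>t. t \<in> {c..d} \<Longrightarrow> dist m (\<psi> v) \<le> dist m (\<psi> t) + 1"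
    using approx_nearest[OF qg_pathD(3)[OF p(2)]] by blast
  obtain f g where s: "geodesic_segment (\<phi> u) m f" "geodesic_segment (\<psi> v) m g"
    using geodesic_space by blast
  note f = geodesic_segmentD[OF s(1)] and g = geodesic_segmentD[OF s(2)]
  define A B D where "A = dist (\<phi> u) m" and "B = dist (\<psi> v) m" and "D = M (3 * K) (C + 2)"
  define E where "E = K * (K * (2 * D + C)) + C + D"
  have n1: "near D (\<phi> ` {a..u} \<union> f ` {0..A}) (\<psi> ` {c..v} \<union> g ` {0..B})"
    unfolding A_def B_def D_def by (rule concat_paths_near[OF G(1) p u v s])
  have m1: "near D (\<psi> ` {c..v} \<union> g ` {0..B}) (\<phi> ` {a..u} \<union> f ` {0..A})"
    unfolding A_def B_def D_def by (rule concat_paths_near[OF G(1) p(2,1) v u s(2,1)])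
  have n2: "near D (\<phi> ` {u..b} \<union> f ` {0..A}) (\<psi> ` {v..d} \<union> g ` {0..B})"
    using concat_paths_near[OF G(2) qg_path_reverse[OF p(1)] qg_path_reverse[OF p(2)], of "-u" "-v" f g] u v s
    unfolding A_def B_def D_def image_reverse by auto
  have m2: "near D (\<psi> ` {v..d} \<union> g ` {0..B}) (\<phi> ` {u..b} \<union> f ` {0..A})"
    using concat_paths_near[OF G(2) qg_path_reverse[OF p(2)] qg_path_reverse[OF p(1)], of "-v" "-u" g f] u v s
    unfolding A_def B_def D_def image_reverse by auto
  have D0: "D \<ge> 0" using near_nonneg[OF n1] u by auto
  have KC: "K \<ge> 1" "C \<ge> 0" using q by auto
  have "K * (K * (2 * D + C)) \<ge> 0" using KC D0 by (intro mult_nonneg_nonneg) auto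
  then have E0: "D \<le> E" "0 \<le> E" using KC D0 unfolding E_def by auto
  have fm: "dist (f r) m \<le> A" if "r \<in> {0..A}" for r
    using geodesicD[OF f(1), of r A] f that unfolding A_def by auto
  have gm: "dist (g r) (\<psi> v) = B - dist (g r) m" if "r \<in> {0..B}" for r
    using geodesicD[OF g(1), of r B] geodesicD[OF g(1), of r 0] g that unfolding B_def by auto
  \<comment> \<open>\<open>\<psi> v\<close> lies on both continued paths, so it is near the
    continued \<open>\<phi>\<close> from either side. If one of the nearby points is on
    \<open>f\<close>, the bound is immediate. Otherwise they are \<open>\<phi> u1\<close> and
    \<open>\<phi> u2\<close> with \<open>u1 \<le> u \<le> u2\<close>; these are close together, so
    \<open>u\<close> is trapped between close parameters and \<open>\<psi> v\<close> is near
    \<open>\<phi> u\<close>.\<close>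
  have BA: "B \<le> A + E"
  proof -
    obtain z1 where z1: "z1 \<in> \<phi> ` {a..u} \<union> f ` {0..A}" "dist (\<psi> v) z1 \<le> D"
      using nearD[OF m1, of "\<psi> v"] v by auto
    obtain z2 where z2: "z2 \<in> \<phi> ` {u..b} \<union> f ` {0..A}" "dist (\<psi> v) z2 \<le> D"
      using nearD[OF m2, of "\<psi> v"] v by auto
    have *: "B \<le> A + E" if "z \<in> f ` {0..A}" "dist (\<psi> v) z \<le> D" for z
      using fm that E0 dist_triangle[of "\<psi> v" m z] unfolding B_def by force
    show ?thesis
    proof (cases "z1 \<in> f ` {0..A} \<or> z2 \<in> f ` {0..A}")
      case True then show ?thesis using * z1 z2 by blast
    next
      case False
      then obtain u1 u2 where w: "u1 \<in> {a..u}" "z1 = \<phi> u1" "u2 \<in> {u..b}" "z2 = \<phi> u2" using z1 z2 by auto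
      have "\<bar>u1 - u2\<bar> \<le> K * (dist (\<phi> u1) (\<phi> u2) + C)" using q(8)[of u1 u2] w u by auto
      also have "\<dots> \<le> K * (2 * D + C)"
        using KC w z1 z2 dist_triangle[of z1 z2 "\<psi> v"] dist_commute[of z1 "\<psi> v"] by (intro mult_left_mono) auto
      finally have "\<bar>u - u1\<bar> \<le> K * (2 * D + C)" using w by auto
      then have "K * \<bar>u - u1\<bar> \<le> K * (K * (2 * D + C))" using KC by (intro mult_left_mono) auto
      then have "dist (\<phi> u) z1 \<le> K * (K * (2 * D + C)) + C" using q(7)[of u u1] u w by auto
      then show ?thesis using z1 unfolding A_def B_def E_def by metric
    qed
  qed
  \<comment> \<open>No point of \<open>\<phi>\<close> is much closer to \<open>m\<close> than
    \<open>A\<close>, so a point of \<open>g\<close> near \<open>\<phi> t\<close> cannot be far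
    along \<open>g\<close>; as \<open>B\<close> is at most \<open>A + E\<close>, it is near the
    start \<open>\<psi> v\<close> of \<open>g\<close>.\<close>
  have fin: "\<exists>s\<in>{c..d}. dist (\<phi> t) (\<psi> s) \<le> triangle_gauge M K C"
    if z: "z \<in> \<psi> ` {c..d} \<union> g ` {0..B}" "dist (\<phi> t) z \<le> D" for z
  proof (cases "z \<in> \<psi> ` {c..d}")
    case True
    moreover have "D \<le> triangle_gauge M K C" using E0 D0 unfolding triangle_gauge_def E_def D_def Let_def by linarith
    ultimately show ?thesis using z by force
  next
    case False
    then obtain r where r: "r \<in> {0..B}" "z = g r" using z by auto
    have "A - 1 \<le> dist m (\<phi> t)" using u(2)[OF t] unfolding A_def by (simp add: dist_commute)
    then have "dist z m \<ge> A - 1 - D" using z(2) by metric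
    then have "dist z (\<psi> v) \<le> E + 1 + D" using gm[OF r(1)] r(2) BA by auto
    then have "dist (\<phi> t) (\<psi> v) \<le> triangle_gauge M K C" using z(2) unfolding triangle_gauge_def E_def D_def Let_def by metric
    then show ?thesis using v by blast
  qed
  show "\<exists>s\<in>{c..d}. dist (\<phi> t) (\<psi> s) \<le> triangle_gauge M K C"
  proof (cases "t \<le> u")
    case True
    then obtain z where z: "z \<in> \<psi> ` {c..v} \<union> g ` {0..B}" "dist (\<phi> t) z \<le> D" using nearD[OF n1, of "\<phi> t"] t by auto
    show ?thesis by (rule fin[OF _ z(2)]) (use z(1) v in auto)
  next
    case False
    then obtain z where z: "z \<in> \<psi> ` {v..d} \<union> g ` {0..B}" "dist (\<phi> t) z \<le> D" using nearD[OF n2, of "\<phi> t"] t by auto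
    show ?thesis by (rule fin[OF _ z(2)]) (use z(1) v in auto)
  qed
qed

text \<open>Beyond thinness this records that the segment from the cut point to the third vertex is
  near both other sides. That is what later forces two rays to fellow travel when the cut point is
  far from the vertex.\<close>

lemma triangle_center:
  fixes x y m :: 'x
  assumes G: "morse_pair M x m" "morse_pair M y m" and \<gamma>: "geodesic_segment x y \<gamma>"
    and g: "geodesic_segment x m g1" "geodesic_segment y m g2"
  obtains u f where "u \<in> {0..dist x y}" "geodesic_segment (\<gamma> u) m f"
    "near (M 3 2) (\<gamma> ` {0..u} \<union> f ` {0..dist (\<gamma> u) m}) (g1 ` {0..dist x m})"
    "near (M 3 2) (\<gamma> ` {u..dist x y} \<union> f ` {0..dist (\<gamma> u) m}) (g2 ` {0..dist y m})"
proof -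
  note \<gamma>' = geodesic_segmentD[OF \<gamma>]
  obtain u where u: "u \<in> {0..dist x y}" "\<And>t. t \<in> {0..dist x y} \<Longrightarrow> dist m (\<gamma> u) \<le> dist m (\<gamma> t) + 1"
    using approx_nearest[of 0 "dist x y" m \<gamma>] by auto
  obtain f where f: "geodesic_segment (\<gamma> u) m f" using geodesic_space by blast
  have e: "geodesic_segment (g1 (dist x m)) m (\<lambda>_. m)" "geodesic_segment (g2 (dist y m)) m (\<lambda>_. m)"
    using geodesic_segmentD(3)[OF g(1)] geodesic_segmentD(3)[OF g(2)]
    by (simp_all add: geodesic_segment_def geodesic_def is_interval_1)
  have near1: "near (M 3 2) (\<phi> ` {a..u'} \<union> f ` {0..dist (\<phi> u') m}) (g' ` {0..dist x' m})"
    if "morse_pair M x' m" "qg_path 1 0 a b \<phi> x' y'" "u' \<in> {a..b}" "\<And>t. t \<in> {a..b} \<Longrightarrow> dist m (\<phi> u') \<le> dist m (\<phi> t) + 1"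
      "geodesic_segment (\<phi> u') m f" "geodesic_segment x' m g'" for x' y' a b \<phi> g' u'
  proof -
    note g'' = geodesic_segmentD[OF that(6)]
    have 1: "qg_path (3 * 1) (0 + 2 * 1) a (u' + dist (\<phi> u') m) (concat_at u' \<phi> f) x' m"
      by (rule qg_path_concat[OF that(2,3,5)]) (use that in auto)
    have 2: "qg_path (3 * 1) (0 + 2 * 1) 0 (dist x' m) g' x' m" by (rule qg_path_mono[OF g''(4)]) auto
    show ?thesis using that(1) 1 2 concat_at_image[of a u' "dist (\<phi> u') m" f \<phi>] that(3) geodesic_segmentD(2)[OF that(5)]
      unfolding morse_pair_def by force
  qed
  have "near (M 3 2) (\<gamma> ` {0..u} \<union> f ` {0..dist (\<gamma> u) m}) (g1 ` {0..dist x m})"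
    by (rule near1[OF G(1) \<gamma>'(4) u f g(1)])
  moreover have "near (M 3 2) (\<gamma> ` {u..dist x y} \<union> f ` {0..dist (\<gamma> u) m}) (g2 ` {0..dist y m})"
    using near1[OF G(2) qg_path_reverse[OF \<gamma>'(4)], of "- u" g2] u f g(2) unfolding image_reverse by simp
  ultimately show thesis using that u f by blast
qed

lemma thin_triangle:
  fixes x y m :: 'x
  assumes G: "morse_pair M x m" "morse_pair M y m" and \<gamma>: "geodesic_segment x y \<gamma>"
    and g: "geodesic_segment x m g1" "geodesic_segment y m g2"
  shows "near (M 3 2) (\<gamma> ` {0..dist x y}) (g1 ` {0..dist x m} \<union> g2 ` {0..dist y m})"
proof -
  obtain u f where u: "u \<in> {0..dist x y}" 
    "near (M 3 2) (\<gamma> ` {0..u} \<union> f ` {0..dist (\<gamma> u) m}) (g1 ` {0..dist x m})"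
    "near (M 3 2) (\<gamma> ` {u..dist x y} \<union> f ` {0..dist (\<gamma> u) m}) (g2 ` {0..dist y m})"
    using triangle_center[OF assms] by metis
  have "{0..dist x y} = {0..u} \<union> {u..dist x y}" using u(1) by auto
  then have "\<gamma> ` {0..dist x y} = \<gamma> ` {0..u} \<union> \<gamma> ` {u..dist x y}" by blast
  then show ?thesis using near_Un[OF near_subset[OF u(2)] near_subset[OF u(3)]] by simp
qed

text \<open>Each point on the two sides forms a Morse pair with the common vertex \<open>m\<close>,
  so any two of them form a Morse pair by \<open>morse_pair_triangle\<close>. The third side is near
  this union.\<close>

lemma morse_pairs_third_side:
  fixes x y m :: 'x
  assumes H: "morse_pairs M (g1 ` {0..dist x m})" "morse_pairs M (g2 ` {0..dist y m})" and \<gamma>: "geodesic_segment x y \<gamma>"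
    and g: "geodesic_segment x m g1" "geodesic_segment y m g2"
  shows "morse_pairs (third_side_gauge M) (\<gamma> ` {0..dist x y})"
proof -
  have mem: "x \<in> g1 ` {0..dist x m}" "m \<in> g1 ` {0..dist x m}" "y \<in> g2 ` {0..dist y m}" "m \<in> g2 ` {0..dist y m}"
    using geodesic_segment_endpoints[OF g(1)] geodesic_segment_endpoints[OF g(2)] by simp_all
  let ?M = "\<lambda>K C. max (M K C) (triangle_gauge M K C)"
  have le: "morse_pair M p q \<Longrightarrow> morse_pair ?M p q" "morse_pair (triangle_gauge M) p q \<Longrightarrow> morse_pair ?M p q" for p q :: 'x
    by (erule morse_pair_mono, simp)+
  have "morse_pairs ?M (g1 ` {0..dist x m} \<union> g2 ` {0..dist y m})"
    unfolding morse_pairs_def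
  proof (intro ballI)
    fix p q assume pq: "p \<in> g1 ` {0..dist x m} \<union> g2 ` {0..dist y m}" "q \<in> g1 ` {0..dist x m} \<union> g2 ` {0..dist y m}"
    then have "morse_pair M p m" "morse_pair M q m" using morse_pairsD[OF H(1) _ mem(2)] morse_pairsD[OF H(2) _ mem(4)] by blast+
    then show "morse_pair ?M p q" using morse_pair_triangle le(2) by blast
  qed
  then show ?thesis unfolding third_side_gauge_def
    using morse_pairs_near thin_triangle[OF morse_pairsD[OF H(1) mem(1,2)] morse_pairsD[OF H(2) mem(3,4)] \<gamma> g] by blast
qed

text \<open>\<open>D\<close> only decides from where on the bound holds, not its size. A far point
  of \<open>\<sigma>\<close> is joined to \<open>\<tau>\<close>, which is followed backwards past
  \<open>\<tau> s\<close> and then left for \<open>\<sigma> s0\<close>. Leaving at almost nearest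
  points makes this a \<open>(9, 4)\<close>-quasi-geodesic however long the two connections are, and
  its endpoints lie on \<open>\<sigma>\<close>.\<close>

lemma rays_close:
  fixes \<sigma> \<tau> :: "real \<Rightarrow> 'x"
  assumes \<sigma>: "geodesic {s0..} \<sigma>" "morse_pairs M (\<sigma> ` {s0..})" and \<tau>: "geodesic {t0..} \<tau>"
    and D: "near D (\<sigma> ` {s0..}) (\<tau> ` {t0..})"
  shows "\<exists>S\<ge>t0. \<forall>s\<ge>S. \<exists>s'\<ge>s0. dist (\<tau> s) (\<sigma> s') \<le> M 9 4"
proof -
  obtain s1 where s1: "s1 \<ge> t0" "dist (\<sigma> s0) (\<tau> s1) \<le> D" using nearD[OF D, of "\<sigma> s0"] by auto
  have D0: "D \<ge> 0" using s1(2) zero_le_dist order_trans by blast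
  \<comment> \<open>The second cut turns out to be within \<open>3 * (2 * D + 3)\<close> of the
    parameter \<open>s1\<close>; beyond \<open>S\<close> the point \<open>\<tau> s\<close> is not
    cut off.\<close>
  define S where "S = s1 + 3 * (2 * D + 4)"
  have "\<exists>s'\<ge>s0. dist (\<tau> s) (\<sigma> s') \<le> M 9 4" if s: "s \<ge> S" for s
  proof -
    have ss: "s1 \<le> s" "t0 \<le> s" using s D0 s1 unfolding S_def by auto
    \<comment> \<open>So far out that every point of \<open>\<tau>\<close> within
      \<open>D + 1\<close> of \<open>\<sigma> T2\<close> has parameter at least
      \<open>s\<close>.\<close>
    define T2 where "T2 = s0 + (s - t0) + dist (\<sigma> s0) (\<tau> t0) + D + 1"
    have T2: "T2 \<ge> s0" using ss D0 unfolding T2_def by (simp add: add_nonneg_nonneg add.assoc)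
    obtain b0 where b0: "b0 \<ge> t0" "dist (\<sigma> T2) (\<tau> b0) \<le> D" using nearD[OF D, of "\<sigma> T2"] T2 by auto
    define b where "b = max b0 s"
    have b: "b \<ge> t0" "b0 \<in> {t0..b}" "s1 \<in> {t0..b}" using b0 ss s1 unfolding b_def by auto
    have q1: "qg_path 1 0 t0 b \<tau> (\<tau> t0) (\<tau> b)" by (rule geodesic_qg_path[OF \<tau>]) (use b in auto)
    obtain t2 where t2: "t2 \<in> {t0..b}" "\<And>t. t \<in> {t0..b} \<Longrightarrow> dist (\<sigma> T2) (\<tau> t2) \<le> dist (\<sigma> T2) (\<tau> t) + 1"
      using approx_nearest[OF b(1)] by blast
    have A: "dist (\<sigma> T2) (\<tau> t2) \<le> D + 1" using t2(2)[OF b(2)] b0 by simp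
    have "T2 - s0 = dist (\<sigma> T2) (\<sigma> s0)" using geodesicD[OF \<sigma>(1), of T2 s0] T2 by auto
    also have "\<dots> \<le> dist (\<sigma> T2) (\<tau> t2) + dist (\<tau> t2) (\<tau> t0) + dist (\<sigma> s0) (\<tau> t0)"
      by metric
    also have "dist (\<tau> t2) (\<tau> t0) = t2 - t0" using geodesicD[OF \<tau>, of t2 t0] t2 by auto
    finally have t2s: "t2 \<ge> s" using A unfolding T2_def by linarith
    obtain f where f: "geodesic_segment (\<tau> t2) (\<sigma> T2) f" using geodesic_space by blast
    define A where "A = dist (\<tau> t2) (\<sigma> T2)"
    have "qg_path (3 * 1) (0 + 2 * 1) t0 (t2 + A) (concat_at t2 \<tau> f) (\<tau> t0) (\<sigma> T2)"
      unfolding A_def by (rule qg_path_concat[OF q1 t2(1) f]) (use t2 in auto)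
    then have q2: "qg_path 3 2 t0 (t2 + A) (concat_at t2 \<tau> f) (\<tau> t0) (\<sigma> T2)" by simp
    \<comment> \<open>Reversal puts the start of \<open>\<tau>\<close> at the end of the path, where
      \<open>qg_path_concat\<close> makes the second cut: \<open>3 * 3 = 9\<close> and
      \<open>2 + 2 * 1 = 4\<close>.\<close>
    define h where "h t = concat_at t2 \<tau> f (- t)" for t
    have q3: "qg_path 3 2 (- (t2 + A)) (- t0) h (\<sigma> T2) (\<tau> t0)" 
      using qg_path_reverse[OF q2] unfolding h_def .
    obtain w where w: "w \<in> {- (t2 + A)..- t0}" "\<And>t. t \<in> {- (t2 + A)..- t0} \<Longrightarrow> dist (\<sigma> s0) (h w) \<le> dist (\<sigma> s0) (h t) + 1"
      using approx_nearest[OF qg_pathD(3)[OF q3]] by blast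
    obtain g where g: "geodesic_segment (h w) (\<sigma> s0) g" using geodesic_space by blast
    have "qg_path (3 * 3) (2 + 2 * 1) (- (t2 + A)) (w + dist (h w) (\<sigma> s0)) (concat_at w h g) (\<sigma> T2) (\<sigma> s0)"
      by (rule qg_path_concat[OF q3 w(1) g]) (use w in auto)
    then have q4: "qg_path 9 4 (- (t2 + A)) (w + dist (h w) (\<sigma> s0)) (concat_at w h g) (\<sigma> T2) (\<sigma> s0)" by simp
    have A0: "A \<ge> 0" unfolding A_def by simp
    have hs: "h (- r) = \<tau> r" if "r \<le> t2" for r using that unfolding h_def concat_at_def by simp
    have m1: "- s1 \<in> {- (t2 + A)..- t0}" using s1 ss t2s A0 by auto
    have "dist (\<sigma> s0) (h w) \<le> D + 1" using w(2)[OF m1] hs[of s1] ss t2s s1 by auto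
    then have "dist (h w) (h (- s1)) \<le> 2 * D + 1" using hs[of s1] ss t2s s1 
      dist_triangle[of "h w" "\<tau> s1" "\<sigma> s0"] dist_commute[of "h w" "\<sigma> s0"] by auto
    moreover have "\<bar>w - (- s1)\<bar> \<le> 3 * (dist (h w) (h (- s1)) + 2)" by (rule qg_pathD(8)[OF q3 w(1) m1])
    ultimately have "\<bar>w + s1\<bar> \<le> 3 * (2 * D + 1 + 2)" by simp
    then have "- (w + s1) \<le> 3 * (2 * D + 1 + 2)" by (simp add: abs_le_iff)
    then have ws: "- s \<le> w" using s D0 unfolding S_def by (simp add: algebra_simps)
    have ms: "- s \<in> {- (t2 + A)..w + dist (h w) (\<sigma> s0)}" using ws t2s A0 by (auto simp: add_increasing2)
    have "concat_at w h g (- s) = \<tau> s" using ws hs[OF t2s] unfolding concat_at_def by simp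
    then show ?thesis using nearD[OF morse_pairs_path_near[OF \<sigma> q4], of "\<tau> s"] T2 ms by force
  qed
  moreover have "S \<ge> t0" using D0 s1 unfolding S_def by auto
  ultimately show ?thesis by blast
qed

text \<open>By \<open>rays_close\<close> a far endpoint of one ray needs to be moved by at most
  \<open>M 9 4\<close> to lie on the other, and then an initial piece is within
  \<open>M 1 (2 * M 9 4 + 2)\<close> of it. The factor 2 passes to equal parameters, which are the
  distances from the common starting point.\<close>

definition ray_const :: "gauge_fun \<Rightarrow> real" where
  "ray_const M = 2 * M 1 (2 * M 9 4 + 2)"

lemma rays_from_close:
  fixes \<alpha> \<beta> :: "real \<Rightarrow> 'x"
  assumes \<beta>: "geodesic {0..} \<beta>" "morse_pairs M (\<beta> ` {0..})" and \<alpha>: "geodesic {0..} \<alpha>" "\<alpha> 0 = \<beta> 0"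
    and D: "near D (\<beta> ` {0..}) (\<alpha> ` {0..})" and t: "t \<ge> 0"
  shows "dist (\<alpha> t) (\<beta> t) \<le> ray_const M"
proof -
  obtain S where S: "\<And>s. s \<ge> S \<Longrightarrow> \<exists>s'\<ge>0. dist (\<alpha> s) (\<beta> s') \<le> M 9 4" using rays_close[OF \<beta> \<alpha>(1) D] by auto
  define s where "s = max S t"
  obtain s' where s': "s' \<ge> 0" "dist (\<alpha> s) (\<beta> s') \<le> M 9 4" using S[of s] unfolding s_def by auto
  have s: "s \<ge> t" "s \<ge> 0" using t unfolding s_def by auto
  have R0: "M 9 4 \<ge> 0" using s'(2) zero_le_dist order_trans by blast
  have q: "qg_path 1 (0 + 2 * M 9 4 + 2) (0 - 1) (s + 1) (extend_path 0 s \<alpha> (\<beta> 0) (\<beta> s')) (\<beta> 0) (\<beta> s')"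
    by (rule qg_path_extend[OF geodesic_qg_path[OF \<alpha>(1)]]) (use s s' \<alpha>(2) R0 in \<open>auto simp: dist_commute\<close>)
  have "near (M 1 (0 + 2 * M 9 4 + 2)) (extend_path 0 s \<alpha> (\<beta> 0) (\<beta> s') ` {0 - 1..s + 1}) (\<beta> ` {0..})"
    by (rule morse_pairs_path_near[OF \<beta> q]) (use s' in auto)
  moreover have "\<alpha> t \<in> extend_path 0 s \<alpha> (\<beta> 0) (\<beta> s') ` {0 - 1..s + 1}"
    using subsetD[OF extend_path_image(1)[OF s(2)], of "\<alpha> t" \<alpha>] s t by auto
  ultimately have "\<exists>y\<in>\<beta> ` {0..}. dist (\<alpha> t) y \<le> M 1 (0 + 2 * M 9 4 + 2)" by (rule nearD)
  then obtain r where r: "r \<ge> 0" "dist (\<alpha> t) (\<beta> r) \<le> M 1 (2 * M 9 4 + 2)" by auto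
  have "dist (\<alpha> t) (\<alpha> 0) = t" "dist (\<beta> r) (\<beta> 0) = r" "dist (\<beta> r) (\<beta> t) = \<bar>r - t\<bar>"
    using geodesicD[OF \<alpha>(1), of t 0] geodesicD[OF \<beta>(1), of r 0] geodesicD[OF \<beta>(1), of r t] r t by auto
  then show ?thesis using r(2) \<alpha>(2) dist_triangle[of "\<alpha> t" "\<alpha> 0" "\<beta> r"] dist_triangle[of "\<beta> r" "\<beta> 0" "\<alpha> t"]
    dist_triangle[of "\<alpha> t" "\<beta> t" "\<beta> r"] dist_commute[of "\<beta> r" "\<alpha> t"] unfolding ray_const_def by auto
qed

text \<open>A quasi-geodesic between points at distance at most \<open>L\<close> has a parameter
  interval of length at most \<open>K * (L + C)\<close>. Hence it stays near its first point, which
  it shares with the other path.\<close>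

lemma bounded_morse_pairs:
  fixes A :: "'x set"
  assumes AA: "\<And>x y. x \<in> A \<Longrightarrow> y \<in> A \<Longrightarrow> dist x y \<le> L"
  shows "morse_pairs (\<lambda>K C. K * (K * (L + C)) + C) A"
  unfolding morse_pairs_def
proof (intro ballI morse_pairI)
  fix x y K C a b \<phi> c d \<psi> t
  assume xy: "x \<in> A" "y \<in> A" and p: "qg_path K C a b \<phi> x y" "qg_path K C c d \<psi> x y" and t: "t \<in> {a..b}"
  note q = qg_pathD[OF p(1)]
  have "\<bar>a - b\<bar> \<le> K * (dist (\<phi> a) (\<phi> b) + C)" using q(3) q(8)[of a b] by auto
  also have "\<dots> \<le> K * (L + C)" using q(1,4,5) AA[OF xy] by (intro mult_left_mono) auto
  finally have "\<bar>t - a\<bar> \<le> K * (L + C)" using t by auto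
  then have "K * \<bar>t - a\<bar> \<le> K * (K * (L + C))" using q(1) by (intro mult_left_mono) auto
  then have "dist (\<phi> t) (\<psi> c) \<le> K * (K * (L + C)) + C" using q(7)[of t a] t q(3,4) qg_pathD(4)[OF p(2)] by auto
  then show "\<exists>s\<in>{c..d}. dist (\<phi> t) (\<psi> s) \<le> K * (K * (L + C)) + C" using qg_pathD(3)[OF p(2)] by force
qed

end

section \<open>Boundary points and limits of rays\<close>

lemma finite_hausdorff_dist_iff_near:
  "finite_hausdorff_dist A B \<longleftrightarrow> (\<exists>D. near D A B \<and> near D B A)"
proof
  assume "finite_hausdorff_dist A B"
  then obtain K where "A \<subseteq> closed_nbhd K B" "B \<subseteq> closed_nbhd K A" unfolding finite_hausdorff_dist_def by blast
  then show "\<exists>D. near D A B \<and> near D B A" using closed_nbhd_imp_near[of _ K _ 1] by (meson zero_less_one)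
next
  assume "\<exists>D. near D A B \<and> near D B A"
  then show "finite_hausdorff_dist A B" unfolding finite_hausdorff_dist_def using near_imp_closed_nbhd by blast
qed

lemma near_trans: "near D A B \<Longrightarrow> near E B C \<Longrightarrow> near (D + E) A C"
  unfolding near_def
proof
  fix x assume a: "\<forall>x\<in>A. \<exists>y\<in>B. dist x y \<le> D" "\<forall>x\<in>B. \<exists>y\<in>C. dist x y \<le> E" "x \<in> A"
  then obtain y z where "y \<in> B" "dist x y \<le> D" "z \<in> C" "dist y z \<le> E" by metis
  then show "\<exists>y\<in>C. dist x y \<le> D + E" using dist_triangle[of x z y] by (intro bexI[of _ z]) auto
qed

lemma finite_hausdorff_dist_refl: "finite_hausdorff_dist A A"
  unfolding finite_hausdorff_dist_iff_near near_def by (intro exI[of _ 0]) force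

lemma finite_hausdorff_dist_sym: "finite_hausdorff_dist A B \<Longrightarrow> finite_hausdorff_dist B A"
  unfolding finite_hausdorff_dist_def by blast

lemma finite_hausdorff_dist_trans:
  assumes "finite_hausdorff_dist A B" "finite_hausdorff_dist B C"
  shows "finite_hausdorff_dist A C"
proof -
  obtain D E where "near D A B" "near D B A" "near E B C" "near E C B"
    using assms unfolding finite_hausdorff_dist_iff_near by blast
  then have "near (D + E) A C" "near (D + E) C A" using near_trans[of D A B E C] near_trans[of E C B D A] by (auto simp: add.commute)
  then show ?thesis unfolding finite_hausdorff_dist_iff_near by blast
qed

lemma finite_hausdorff_dist_pointwise:
  assumes "\<And>t. t \<in> I \<Longrightarrow> dist (\<alpha> t) (\<beta> t) \<le> D"
  shows "finite_hausdorff_dist (\<alpha> ` I) (\<beta> ` I)"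
  unfolding finite_hausdorff_dist_iff_near near_def using assms by (intro exI[of _ D]) (auto simp: dist_commute)

lemma ray_end_eqI:
  "finite_hausdorff_dist (\<alpha> ` {a..}) (\<beta> ` {b..}) \<Longrightarrow> ray_end \<oo> a \<alpha> = ray_end \<oo> b \<beta>"
  unfolding ray_end_def using finite_hausdorff_dist_trans finite_hausdorff_dist_sym by blast

lemma ray_end_self: "\<beta> \<in> morse_rays_from \<oo> \<Longrightarrow> \<beta> \<in> ray_end \<oo> 0 \<beta>"
  unfolding ray_end_def using finite_hausdorff_dist_refl by blast

text \<open>The class of a ray is empty if no Morse ray from the basepoint is at finite distance
  from it, so equality of classes is informative only when a member is known; here
  \<open>\<beta>\<close> is one.\<close>

lemma ray_end_eqD:
  "\<beta> \<in> morse_rays_from \<oo> \<Longrightarrow> ray_end \<oo> 0 \<beta> = ray_end \<oo> a \<alpha> \<Longrightarrow> finite_hausdorff_dist (\<beta> ` {0..}) (\<alpha> ` {a..})"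
  using ray_end_self unfolding ray_end_def by blast

lemma ray_end_repr:
  assumes "ray_end \<oo> a \<alpha> \<in> morse_boundary \<oo>"
  obtains \<beta> where "\<beta> \<in> morse_rays_from \<oo>" "ray_end \<oo> 0 \<beta> = ray_end \<oo> a \<alpha>"
  using assms unfolding morse_boundary_def by auto

lemma morse_rays_from_iff:
  "\<beta> \<in> morse_rays_from \<oo> \<longleftrightarrow> geodesic {0..} \<beta> \<and> \<beta> 0 = \<oo> \<and> (\<exists>M. morse_pairs M (\<beta> ` {0..}))"
  unfolding morse_rays_from_def morse_ray_iff_morse_pairs by auto

lemma gauge_rays_morse_pairs:
  "morse_gauge N \<Longrightarrow> \<beta> \<in> gauge_rays_from \<oo> N \<Longrightarrow> morse_pairs (pair_gauge 1 0 N) (\<beta> ` {0..})"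
  using is_morse_imp_morse_pairs[OF _ geodesic_is_quasi_geodesic] unfolding gauge_rays_from_def by blast

lemma gauge_rays_subset: "morse_gauge N \<Longrightarrow> gauge_rays_from \<oo> N \<subseteq> morse_rays_from \<oo>"
  unfolding gauge_rays_from_def morse_rays_from_def morse_ray_def by auto

lemma geodesic_limit:
  fixes f :: "nat \<Rightarrow> real \<Rightarrow> 'x::metric_space"
  assumes "(\<lambda>k. f k s) \<longlonglongrightarrow> g s" "(\<lambda>k. f k t) \<longlonglongrightarrow> g t"
    "\<forall>\<^sub>F k in sequentially. dist (f k s) (f k t) = D"
  shows "dist (g s) (g t) = D"
proof -
  have "(\<lambda>k. dist (f k s) (f k t)) \<longlonglongrightarrow> dist (g s) (g t)" using assms by (intro tendsto_dist)
  moreover have "(\<lambda>k. dist (f k s) (f k t)) \<longlonglongrightarrow> D" using assms(3) by (rule tendsto_eventually)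
  ultimately show ?thesis by (rule LIMSEQ_unique)
qed

text \<open>No limit of paths is taken: for a given pair of points, one index at which both are
  within 1 of their limits suffices.\<close>

lemma morse_pairs_limit:
  fixes f :: "nat \<Rightarrow> real \<Rightarrow> 'x::metric_space"
  assumes "\<And>t. t \<in> I \<Longrightarrow> (\<lambda>k. f k t) \<longlonglongrightarrow> g t"
    "\<And>s t. s \<in> I \<Longrightarrow> t \<in> I \<Longrightarrow> \<forall>\<^sub>F k in sequentially. morse_pair M (f k s) (f k t)"
  shows "morse_pairs (perturbed 1 M) (g ` I)"
proof -
  have "morse_pair (perturbed 1 M) (g s) (g t)" if "s \<in> I" "t \<in> I" for s t
  proof -
    have "\<forall>\<^sub>F k in sequentially. dist (f k s) (g s) < 1 \<and> dist (f k t) (g t) < 1 \<and> morse_pair M (f k s) (f k t)"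
      using that by (intro eventually_conj assms(2) tendstoD[OF assms(1)]) auto
    then obtain k where "dist (f k s) (g s) < 1" "dist (f k t) (g t) < 1" "morse_pair M (f k s) (f k t)"
      by (metis (mono_tags, lifting) eventually_sequentially order_refl)
    then show ?thesis using morse_pair_perturb[of M "f k s" "f k t" "g s" 1 "g t"] by auto
  qed
  then show ?thesis unfolding morse_pairs_def by auto
qed

lemma uniform_limit_lipschitz:
  fixes f :: "nat \<Rightarrow> real \<Rightarrow> 'x::metric_space"
  assumes lim: "\<And>t. t \<in> {0..T} \<Longrightarrow> (\<lambda>k. f k t) \<longlonglongrightarrow> g t"
    and lip: "\<And>k s t. dist (f k s) (f k t) \<le> \<bar>s - t\<bar>" and T: "T \<ge> 0"
  shows "uniform_limit {0..T} f g sequentially"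
proof (rule uniform_limitI)
  fix e :: real assume e: "e > 0"
  have glip: "dist (g s) (g t) \<le> \<bar>s - t\<bar>" if "s \<in> {0..T}" "t \<in> {0..T}" for s t
    by (rule tendsto_upperbound[OF tendsto_dist[OF lim lim]]) (use that lip in auto)
  \<comment> \<open>A net of mesh \<open>e / 4\<close>: the Lipschitz bounds for \<open>f\<close>
    and \<open>g\<close> and closeness on the net contribute \<open>e / 4\<close> each.\<close>
  define G where "G = (\<lambda>i::nat. min T (i * (e / 4))) ` {..nat \<lceil>4 * T / e\<rceil>}"
  have fin: "finite G" "G \<subseteq> {0..T}" using T e unfolding G_def by auto
  have net: "\<exists>q\<in>G. \<bar>t - q\<bar> \<le> e / 4" if t: "t \<in> {0..T}" for t
  proof -
    define i where "i = nat \<lfloor>4 * t / e\<rfloor>"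
    have nn: "4 * t / e \<ge> 0" using t e by auto
    have i1: "real i \<le> 4 * t / e" "4 * t / e < real i + 1" unfolding i_def using nn by linarith+
    have i2: "i * (e / 4) \<le> t" "t \<le> i * (e / 4) + e / 4" using i1 e by (auto simp: field_simps)
    have "4 * t / e \<le> 4 * T / e" using t e by (intro divide_right_mono) auto
    then have "i \<in> {..nat \<lceil>4 * T / e\<rceil>}" using i1 unfolding i_def by (simp add: nat_mono le_trans floor_le_ceiling) linarith
    then have "min T (i * (e / 4)) \<in> G" unfolding G_def by (rule imageI)
    then show ?thesis using i2 t by (intro bexI[of _ "min T (i * (e / 4))"]) auto
  qed
  have "\<forall>\<^sub>F k in sequentially. \<forall>q\<in>G. dist (f k q) (g q) < e / 4"
    using fin e by (intro eventually_ball_finite ballI tendstoD[OF lim]) auto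
  then show "\<forall>\<^sub>F k in sequentially. \<forall>t\<in>{0..T}. dist (f k t) (g t) < e"
  proof (rule eventually_mono, intro ballI)
    fix k t assume k: "\<forall>q\<in>G. dist (f k q) (g q) < e / 4" and t: "t \<in> {0..T}"
    obtain q where q: "q \<in> G" "\<bar>t - q\<bar> \<le> e / 4" using net[OF t] by blast
    have "dist (f k t) (g t) \<le> dist (f k t) (f k q) + dist (f k q) (g q) + dist (g q) (g t)"
      by metric
    also have "\<dots> < e"
    proof -
      have "dist (g q) (g t) \<le> \<bar>q - t\<bar>" using glip q(1) t fin(2) by blast
      moreover have "dist (f k q) (g q) < e / 4" using k q(1) by blast
      ultimately show ?thesis using lip[of k t q] q(2) e by linarith
    qed
    finally show "dist (f k t) (g t) < e" .
  qed
qed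

text \<open>Paths are arbitrary outside their interval. Extending a segment by constants makes it
  1-Lipschitz on all of \<open>real\<close>, as the extraction of limits requires.\<close>

definition clamp_seg :: "real \<Rightarrow> real \<Rightarrow> (real \<Rightarrow> 'x) \<Rightarrow> real \<Rightarrow> 'x" where
  "clamp_seg a b \<gamma> t = \<gamma> (max a (min b t))"

lemma clamp_seg_eq: "t \<in> {a..b} \<Longrightarrow> clamp_seg a b \<gamma> t = \<gamma> t"
  by (auto simp: clamp_seg_def)

lemma clamp_seg_lipschitz:
  assumes "geodesic {a..b} \<gamma>"
  shows "dist (clamp_seg a b \<gamma> s) (clamp_seg a b \<gamma> t) \<le> \<bar>s - t\<bar>"
proof -
  have ab: "a \<le> b" using assms unfolding geodesic_def by auto
  have "dist (clamp_seg a b \<gamma> s) (clamp_seg a b \<gamma> t) = \<bar>max a (min b s) - max a (min b t)\<bar>"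
    unfolding clamp_seg_def by (rule geodesicD[OF assms]) (use ab in auto)
  also have "\<dots> \<le> \<bar>s - t\<bar>" by auto
  finally show ?thesis .
qed

lemma limit_setD:
  assumes "x \<in> limit_set \<oo> A"
  obtains M a \<gamma> \<alpha> where "\<And>k::nat. a k \<in> A" "\<And>k. geodesic_segment \<oo> (a k) (\<gamma> k)"
    "\<And>k. morse_pairs M (\<gamma> k ` {0..dist \<oo> (a k)})" "filterlim (\<lambda>k. dist \<oo> (a k)) at_top sequentially"
    "\<And>T. T \<ge> 0 \<Longrightarrow> uniform_limit {0..T} \<gamma> \<alpha> sequentially"
    "\<alpha> \<in> morse_rays_from \<oo>" "ray_end \<oo> 0 \<alpha> = x"
proof -
  obtain N a \<gamma> \<alpha> where N: "morse_gauge N" and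
     1: "\<forall>k::nat. a k \<in> A \<inter> stratum \<oo> N \<and> geodesic_segment \<oo> (a k) (\<gamma> k) \<and>
               is_morse N (\<gamma> k ` {0..dist \<oo> (a k)})" and
     2: "\<forall>T\<ge>0. (\<forall>\<^sub>F k in sequentially. T \<le> dist \<oo> (a k)) \<and> uniform_limit {0..T} \<gamma> \<alpha> sequentially" and
     3: "\<alpha> \<in> morse_rays_from \<oo>" "ray_end \<oo> 0 \<alpha> = x" using assms unfolding limit_set_def by auto
  have "filterlim (\<lambda>k. dist \<oo> (a k)) at_top sequentially" unfolding filterlim_at_top_ge[where c = 0] using 2 by auto
  moreover have "morse_pairs (pair_gauge 1 0 N) (\<gamma> k ` {0..dist \<oo> (a k)})" for k
    using 1 is_morse_imp_morse_pairs[OF N geodesic_is_quasi_geodesic[OF geodesic_segmentD(1)]] by blast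
  ultimately show thesis using that[of a \<gamma> "pair_gauge 1 0 N" \<alpha>] 1 2 3 by blast
qed

lemma morse_pairs_pointwise:
  assumes "morse_pairs M (\<beta> ` I)" "\<And>t. t \<in> I \<Longrightarrow> dist (\<alpha> t) (\<beta> t) \<le> r"
  shows "morse_pairs (perturbed r M) (\<alpha> ` I)"
  by (rule morse_pairs_near[OF assms(1)]) (use assms(2) in \<open>auto simp: near_def\<close>)

context proper_geodesic_space
begin

lemma same_end_close:
  assumes "\<alpha> \<in> morse_rays_from \<oo>" "geodesic {0..} \<beta>" "\<beta> 0 = \<oo>" "morse_pairs M (\<beta> ` {0..})" "ray_end \<oo> 0 \<alpha> = ray_end \<oo> 0 \<beta>" "t \<ge> 0"
  shows "dist (\<alpha> t) (\<beta> t) \<le> ray_const M"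
proof -
  have "finite_hausdorff_dist (\<alpha> ` {0..}) (\<beta> ` {0..})" using ray_end_eqD assms by blast
  then obtain D where "near D (\<beta> ` {0..}) (\<alpha> ` {0..})" unfolding finite_hausdorff_dist_iff_near by blast
  then show ?thesis using rays_from_close[of \<beta> M \<alpha>] assms unfolding morse_rays_from_iff by auto
qed

text \<open>The resulting gauge is computed from \<open>M\<close> alone, so a gauge of one
  representative of a boundary point controls all its representatives.\<close>

lemma same_end_morse_pairs:
  assumes "\<alpha> \<in> morse_rays_from \<oo>" "geodesic {0..} \<beta>" "\<beta> 0 = \<oo>" "morse_pairs M (\<beta> ` {0..})" "ray_end \<oo> 0 \<alpha> = ray_end \<oo> 0 \<beta>"
  shows "morse_pairs (perturbed (ray_const M) M) (\<alpha> ` {0..})"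
  by (rule morse_pairs_pointwise[OF assms(4)]) (use same_end_close[OF assms] in auto)

text \<open>On the rationals the functions live in a countable product of closed balls, which is
  compact by Tychonoff and sequentially compact by first countability. The Lipschitz bound turns
  convergence at rationals into the Cauchy property everywhere.\<close>

lemma arzela_ascoli_lipschitz:
  fixes f :: "nat \<Rightarrow> real \<Rightarrow> 'x"
  assumes lip: "\<And>k s t. dist (f k s) (f k t) \<le> \<bar>s - t\<bar>" and bd: "\<And>k. dist z (f k 0) \<le> r"
  obtains \<rho> g where "strict_mono \<rho>" "\<And>t. (\<lambda>k. f (\<rho> k) t) \<longlonglongrightarrow> g t"
proof -
  define F where "F k q = f k (of_rat q)" for k and q :: rat
  have inb: "f k t \<in> cball z (r + \<bar>t\<bar>)" for k t
    using bd[of k] lip[of k 0 t] dist_triangle[of z "f k t" "f k 0"] by (auto simp: abs_minus_commute)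

  define P' where "P' = PiE (UNIV :: rat set) (\<lambda>q. cball z (r + \<bar>of_rat q\<bar>))"
  have "compactin (product_topology (\<lambda>_. euclidean) UNIV) P'"
    unfolding P'_def compactin_PiE using proper_space by simp
  then have "compact P'" by (simp add: euclidean_product_topology)
  then have "seq_compact P'" by (rule compact_imp_seq_compact)
  moreover have "\<forall>k. F k \<in> P'" unfolding P'_def F_def by (intro allI PiE_I inb) auto
  ultimately obtain l \<rho> where l: "strict_mono \<rho>" "(F \<circ> \<rho>) \<longlonglongrightarrow> l" using seq_compactE by metis
  have lq: "(\<lambda>k. f (\<rho> k) (of_rat q)) \<longlonglongrightarrow> l q" for q
  proof -
    have "continuous_on UNIV (\<lambda>x::rat \<Rightarrow> 'x. x q)" by (rule continuous_on_product_coordinates)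
    then have "isCont (\<lambda>x::rat \<Rightarrow> 'x. x q) l" using continuous_on_eq_continuous_at[OF open_UNIV] UNIV_I by blast
    then show ?thesis using isCont_tendsto_compose[OF _ l(2)] unfolding F_def by (auto simp: o_def)
  qed
  have "\<exists>y. (\<lambda>k. f (\<rho> k) t) \<longlonglongrightarrow> y" for t
  proof -
    have "Cauchy (\<lambda>k. f (\<rho> k) t)"
    proof (rule metric_CauchyI)
      fix e :: real assume e: "e > 0"
      obtain q where q: "t < of_rat q" "of_rat q < t + e / 3" using of_rat_dense[of t "t + e / 3"] e by auto
      have "Cauchy (\<lambda>k. f (\<rho> k) (of_rat q))" using lq convergent_Cauchy convergent_def by blast
      then obtain k0 where k0: "\<And>m n. m \<ge> k0 \<Longrightarrow> n \<ge> k0 \<Longrightarrow> dist (f (\<rho> m) (of_rat q)) (f (\<rho> n) (of_rat q)) < e / 3"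
        using metric_CauchyD[of _ "e/3"] e by (metis divide_pos_pos zero_less_numeral)
      have "dist (f (\<rho> m) t) (f (\<rho> n) t) < e" if "m \<ge> k0" "n \<ge> k0" for m n
        using k0[OF that] lip[of "\<rho> m" t "of_rat q"] lip[of "\<rho> n" "of_rat q" t] q by metric
      then show "\<exists>k0. \<forall>m\<ge>k0. \<forall>n\<ge>k0. dist (f (\<rho> m) t) (f (\<rho> n) t) < e" by blast
    qed
    moreover have "complete (cball z (r + \<bar>t\<bar>))" using proper_space compact_imp_complete by blast
    ultimately show ?thesis using inb completeE[of "cball z (r + \<bar>t\<bar>)" "\<lambda>k. f (\<rho> k) t"] by metis
  qed
  then obtain g where "\<And>t. (\<lambda>k. f (\<rho> k) t) \<longlonglongrightarrow> g t" by metis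
  then show thesis using that l(1) by blast
qed

text \<open>The witnesses for membership in the limit set are the clamped segments \<open>c\<close>:
  they agree with \<open>\<gamma>\<close> where it matters, and their global Lipschitz bound
  upgrades pointwise to uniform convergence.\<close>

lemma segments_limit:
  assumes a: "\<And>k. a k \<in> A" and seg: "\<And>k. geodesic_segment \<oo> (a k) (\<gamma> k)"
    and h: "\<And>k. morse_pairs M (\<gamma> k ` {0..dist \<oo> (a k)})" and inf: "filterlim (\<lambda>k. dist \<oo> (a k)) at_top sequentially"
  obtains \<rho> \<beta> where "strict_mono \<rho>" "geodesic {0..} \<beta>" "\<beta> 0 = \<oo>" "morse_pairs (perturbed 1 M) (\<beta> ` {0..})"
    "\<And>t. t \<ge> 0 \<Longrightarrow> (\<lambda>k. \<gamma> (\<rho> k) t) \<longlonglongrightarrow> \<beta> t" "ray_end \<oo> 0 \<beta> \<in> limit_set \<oo> A"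
proof -
  define d where "d k = dist \<oo> (a k)" for k
  define c where "c k = clamp_seg 0 (d k) (\<gamma> k)" for k
  note sg = geodesic_segmentD[OF seg]
  have d0: "d k \<ge> 0" for k unfolding d_def by simp
  have ceq: "c k t = \<gamma> k t" if "t \<in> {0..d k}" for k t using clamp_seg_eq that unfolding c_def by blast
  have cseg: "geodesic_segment \<oo> (a k) (c k)" for k
    using seg[of k] ceq d0[of k] unfolding geodesic_segment_def geodesic_def d_def[symmetric] by auto
  have cim: "c k ` {0..d k} = \<gamma> k ` {0..d k}" for k using ceq by (auto intro: image_cong)
  have lip: "dist (c k s) (c k t) \<le> \<bar>s - t\<bar>" for k s t
    unfolding c_def d_def by (rule clamp_seg_lipschitz[OF sg(1)])
  have c0: "c k 0 = \<oo>" for k using ceq[of 0 k] d0[of k] sg(2) by auto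
  obtain \<rho> \<beta> where r: "strict_mono \<rho>" "\<And>t. (\<lambda>k. c (\<rho> k) t) \<longlonglongrightarrow> \<beta> t"
    using arzela_ascoli_lipschitz[of c \<oo> 0, OF lip] c0 by auto
  have inf': "filterlim (\<lambda>k. d (\<rho> k)) at_top sequentially"
    using filterlim_compose[OF inf filterlim_subseq[OF r(1)]] unfolding d_def .
  have ev: "\<forall>\<^sub>F k in sequentially. T \<le> d (\<rho> k)" for T using inf' unfolding filterlim_at_top by blast
  have \<beta>0: "\<beta> 0 = \<oo>" using r(2)[of 0] c0 by (simp add: LIMSEQ_const_iff)
  have \<beta>: "geodesic {0..} \<beta>"
  proof (rule geodesic_iciI)
    fix s t :: real assume st: "0 \<le> s" "s \<le> t"
    have "\<forall>\<^sub>F k in sequentially. dist (c (\<rho> k) s) (c (\<rho> k) t) = t - s"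
      using ev[of t] by (rule eventually_mono) (use st ceq sg(1) in \<open>auto simp: geodesic_def d_def\<close>)
    then show "dist (\<beta> s) (\<beta> t) = t - s" by (rule geodesic_limit[OF r(2) r(2)])
  qed
  have \<beta>h: "morse_pairs (perturbed 1 M) (\<beta> ` {0..})"
  proof (rule morse_pairs_limit[OF r(2)])
    fix s t :: real assume st: "s \<in> {0..}" "t \<in> {0..}"
    show "\<forall>\<^sub>F k in sequentially. morse_pair M (c (\<rho> k) s) (c (\<rho> k) t)"
      using ev[of "max s t"]
    proof (rule eventually_mono)
      fix k assume "max s t \<le> d (\<rho> k)"
      then have "c (\<rho> k) s \<in> \<gamma> (\<rho> k) ` {0..d (\<rho> k)}" "c (\<rho> k) t \<in> \<gamma> (\<rho> k) ` {0..d (\<rho> k)}" using st ceq by auto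
      then show "morse_pair M (c (\<rho> k) s) (c (\<rho> k) t)" using morse_pairsD[OF h] unfolding d_def by blast
    qed
  qed
  have lim: "(\<lambda>k. \<gamma> (\<rho> k) t) \<longlonglongrightarrow> \<beta> t" if "t \<ge> 0" for t
    by (rule Lim_transform_eventually[OF r(2)[of t]]) (use ev[of t] that ceq in \<open>auto elim: eventually_mono\<close>)
  have m: "\<beta> \<in> morse_rays_from \<oo>" using \<beta> \<beta>0 \<beta>h morse_rays_from_iff by blast
  define N where "N = pos_gauge M"
  have N: "morse_gauge N" unfolding N_def by (rule morse_gauge_pos_gauge)
  have cm: "is_morse N (c k ` {0..dist \<oo> (a k)})" for k
    using morse_pairs_imp_is_morse[OF geodesic_segmentD(1)[OF cseg[of k]]] morse_pairs_pos_gauge[OF h[of k]] cim[of k]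
    unfolding N_def d_def by simp
  have "ray_end \<oo> 0 \<beta> \<in> limit_set \<oo> A"
    unfolding limit_set_def mem_Collect_eq
  proof (intro conjI exI[of _ N] exI[of _ "\<lambda>k. a (\<rho> k)"] exI[of _ "\<lambda>k. c (\<rho> k)"] exI[of _ \<beta>] allI impI)
    show "ray_end \<oo> 0 \<beta> \<in> morse_boundary \<oo>" using m unfolding morse_boundary_def by blast
    show "a (\<rho> k) \<in> A \<inter> stratum \<oo> N" for k using a cm cseg unfolding stratum_def by blast
    show "\<forall>\<^sub>F k in sequentially. T \<le> dist \<oo> (a (\<rho> k))" for T using ev unfolding d_def .
    show "uniform_limit {0..T} (\<lambda>k. c (\<rho> k)) \<beta> sequentially" if "T \<ge> 0" for T
      by (rule uniform_limit_lipschitz) (use r(2) lip that in auto)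
  qed (use N cseg cm m in auto)
  then show thesis using that[OF r(1) \<beta> \<beta>0 \<beta>h lim] by blast
qed

text \<open>Membership in the limit set asks for exact limits of segments. This version tolerates an
  error \<open>r\<close>, so that a limit of rays with error 1 is again such a ray, with error
  2.\<close>

definition coarse_limit :: "'x set \<Rightarrow> real \<Rightarrow> (real \<Rightarrow> 'x) \<Rightarrow> bool" where
  "coarse_limit A r \<beta> \<longleftrightarrow> geodesic {0..} \<beta> \<and> \<beta> 0 = \<oo> \<and> (\<forall>T\<ge>0. \<exists>a\<in>A. \<exists>\<gamma>. geodesic_segment \<oo> a \<gamma> \<and>
     T \<le> dist \<oo> a \<and> (\<forall>t\<in>{0..T}. dist (\<gamma> t) (\<beta> t) \<le> r))"

text \<open>The approximating segments have a subsequence with an exact limit, and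
  \<open>\<beta>\<close> stays within \<open>r\<close> of that limit.\<close>

lemma coarse_limit_imp:
  assumes h: "\<And>a \<gamma>. a \<in> A \<Longrightarrow> geodesic_segment \<oo> a \<gamma> \<Longrightarrow> morse_pairs M (\<gamma> ` {0..dist \<oo> a})"
    and c: "coarse_limit A r \<beta>"
  shows "ray_end \<oo> 0 \<beta> \<in> limit_set \<oo> A" "morse_pairs (perturbed r (perturbed 1 M)) (\<beta> ` {0..})" "\<beta> \<in> morse_rays_from \<oo>"
proof -
  have \<beta>: "geodesic {0..} \<beta>" "\<beta> 0 = \<oo>" using c unfolding coarse_limit_def by auto
  have "\<forall>k::nat. \<exists>a \<gamma>. a \<in> A \<and> geodesic_segment \<oo> a \<gamma> \<and> real k \<le> dist \<oo> a \<and> (\<forall>t\<in>{0..real k}. dist (\<gamma> t) (\<beta> t) \<le> r)"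
  proof
    fix k :: nat
    have "real k \<ge> 0" by simp
    then show "\<exists>a \<gamma>. a \<in> A \<and> geodesic_segment \<oo> a \<gamma> \<and> real k \<le> dist \<oo> a \<and> (\<forall>t\<in>{0..real k}. dist (\<gamma> t) (\<beta> t) \<le> r)"
      using c unfolding coarse_limit_def by blast
  qed
  then obtain a \<gamma> where ag: "\<And>k::nat. a k \<in> A" "\<And>k. geodesic_segment \<oo> (a k) (\<gamma> k)" "\<And>k. real k \<le> dist \<oo> (a k)"
    "\<And>k t. t \<in> {0..real k} \<Longrightarrow> dist (\<gamma> k t) (\<beta> t) \<le> r" by metis
  have "filterlim (\<lambda>k. dist \<oo> (a k)) at_top sequentially"
    by (rule filterlim_at_top_mono[OF filterlim_real_sequentially]) (use ag(3) in auto)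
  then obtain \<rho> \<beta>' where b: "strict_mono \<rho>" "geodesic {0..} \<beta>'" "\<beta>' 0 = \<oo>" "morse_pairs (perturbed 1 M) (\<beta>' ` {0..})"
    "\<And>t. t \<ge> 0 \<Longrightarrow> (\<lambda>k. \<gamma> (\<rho> k) t) \<longlonglongrightarrow> \<beta>' t" "ray_end \<oo> 0 \<beta>' \<in> limit_set \<oo> A"
    by (rule segments_limit[of a A \<gamma> M, OF ag(1,2) h[OF ag(1,2)]]) blast
  have close: "dist (\<beta> t) (\<beta>' t) \<le> r" if t: "t \<ge> 0" for t
  proof (rule tendsto_upperbound[OF tendsto_dist[OF tendsto_const b(5)[OF t]]])
    have "\<forall>\<^sub>F k in sequentially. t \<le> real k" using eventually_ge_at_top[of "nat \<lceil>t\<rceil>"] by (rule eventually_mono) linarith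
    then show "\<forall>\<^sub>F k in sequentially. dist (\<beta> t) (\<gamma> (\<rho> k) t) \<le> r"
    proof (rule eventually_mono)
      fix k assume "t \<le> real k"
      then have "t \<le> real (\<rho> k)" using seq_suble[OF b(1), of k] by linarith
      then show "dist (\<beta> t) (\<gamma> (\<rho> k) t) \<le> r" using ag(4)[of t "\<rho> k"] t by (simp add: dist_commute)
    qed
  qed simp
  show "morse_pairs (perturbed r (perturbed 1 M)) (\<beta> ` {0..})"
    by (rule morse_pairs_pointwise[OF b(4)]) (use close in auto)
  then show "\<beta> \<in> morse_rays_from \<oo>" using \<beta> morse_rays_from_iff by blast
  have "ray_end \<oo> 0 \<beta> = ray_end \<oo> 0 \<beta>'" by (intro ray_end_eqI finite_hausdorff_dist_pointwise[of _ _ _ r]) (use close in auto)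
  then show "ray_end \<oo> 0 \<beta> \<in> limit_set \<oo> A" using b(6) by simp
qed

lemma limit_set_coarse:
  assumes "x \<in> limit_set \<oo> A"
  obtains \<beta> where "\<beta> \<in> morse_rays_from \<oo>" "ray_end \<oo> 0 \<beta> = x" "coarse_limit A 1 \<beta>"
proof -
  obtain M a \<gamma> \<alpha> where l: "\<And>k::nat. a k \<in> A" "\<And>k. geodesic_segment \<oo> (a k) (\<gamma> k)"
    "filterlim (\<lambda>k. dist \<oo> (a k)) at_top sequentially"
    "\<And>T. T \<ge> 0 \<Longrightarrow> uniform_limit {0..T} \<gamma> \<alpha> sequentially"
    "\<alpha> \<in> morse_rays_from \<oo>" "ray_end \<oo> 0 \<alpha> = x" using limit_setD[OF assms] by metis
  have "coarse_limit A 1 \<alpha>" unfolding coarse_limit_def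
  proof (intro conjI allI impI)
    show "geodesic {0..} \<alpha>" "\<alpha> 0 = \<oo>" using l(5) unfolding morse_rays_from_iff by auto
    fix T :: real assume T: "T \<ge> 0"
    have "\<forall>\<^sub>F k in sequentially. T \<le> dist \<oo> (a k) \<and> (\<forall>t\<in>{0..T}. dist (\<gamma> k t) (\<alpha> t) < 1)"
      using l(3) uniform_limitD[OF l(4)[OF T], of 1] unfolding filterlim_at_top by (simp add: eventually_conj)
    then obtain k where "T \<le> dist \<oo> (a k)" "\<forall>t\<in>{0..T}. dist (\<gamma> k t) (\<alpha> t) < 1"
      unfolding eventually_sequentially by blast
    then show "\<exists>a\<in>A. \<exists>\<gamma>. geodesic_segment \<oo> a \<gamma> \<and> T \<le> dist \<oo> a \<and> (\<forall>t\<in>{0..T}. dist (\<gamma> t) (\<alpha> t) \<le> 1)"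
      using l(1,2) by (meson less_imp_le)
  qed
  then show thesis using that l by blast
qed

end

section \<open>Compactness in the Morse boundary\<close>

lemma boundary_stratum_subset: "morse_gauge N \<Longrightarrow> boundary_stratum \<oo> N \<subseteq> morse_boundary \<oo>"
  unfolding boundary_stratum_def morse_boundary_def using gauge_rays_subset by blast

lemma openin_boundary_stratum: "openin (stratum_topology \<oo> N) (boundary_stratum \<oo> N)"
  unfolding openin_stratum_topology
proof (intro conjI ballI impI)
  fix \<alpha> assume "\<alpha> \<in> gauge_rays_from \<oo> N"
  have "boundary_nbhd \<oo> N \<alpha> (morse_delta N) 0 \<subseteq> boundary_stratum \<oo> N"
    unfolding boundary_nbhd_def boundary_stratum_def by blast
  then show "\<exists>n\<ge>0. boundary_nbhd \<oo> N \<alpha> (morse_delta N) n \<subseteq> boundary_stratum \<oo> N" by blast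
qed simp

lemma topspace_morse_boundary_topology: "topspace (morse_boundary_topology \<oo>) = morse_boundary \<oo>"
proof -
  have "openin (morse_boundary_topology \<oo>) (morse_boundary \<oo>)"
    unfolding openin_morse_boundary_topology
    using openin_boundary_stratum[of \<oo>] boundary_stratum_subset[of _ \<oo>] by (simp add: inf.absorb2)
  moreover have "\<And>U. openin (morse_boundary_topology \<oo>) U \<Longrightarrow> U \<subseteq> morse_boundary \<oo>"
    unfolding openin_morse_boundary_topology by blast
  ultimately show ?thesis unfolding topspace_def by blast
qed

context proper_geodesic_space
begin

text \<open>Otherwise N-Morse rays ending in x would stay within r of \<alpha> on longer and longer intervals, while
  all of them are uniformly close to one another.\<close>

lemma boundary_nbhd_avoids:
  assumes N: "morse_gauge N" and a: "\<alpha> \<in> gauge_rays_from \<oo> N" and ne: "ray_end \<oo> 0 \<alpha> \<noteq> x"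
  shows "\<exists>n\<ge>0. x \<notin> boundary_nbhd \<oo> N \<alpha> r n"
proof (rule ccontr)
  assume "\<not> ?thesis"
  then have "\<forall>n\<ge>0. \<exists>\<beta>\<in>gauge_rays_from \<oo> N. x = ray_end \<oo> 0 \<beta> \<and> (\<forall>t\<in>{0..n}. dist (\<alpha> t) (\<beta> t) \<le> r)"
    unfolding boundary_nbhd_def by blast
  then obtain b where b: "\<And>n. n \<ge> 0 \<Longrightarrow> b n \<in> gauge_rays_from \<oo> N" "\<And>n. n \<ge> 0 \<Longrightarrow> x = ray_end \<oo> 0 (b n)"
    "\<And>n t. n \<ge> 0 \<Longrightarrow> t \<in> {0..n} \<Longrightarrow> dist (\<alpha> t) (b n t) \<le> r" by metis
  have "dist (\<alpha> t) (b 0 t) \<le> r + ray_const (pair_gauge 1 0 N)" if t: "t \<in> {0..}" for t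
  proof -
    have "dist (b 0 t) (b t t) \<le> ray_const (pair_gauge 1 0 N)"
      using same_end_close[of "b 0" "b t", OF _ _ _ gauge_rays_morse_pairs[OF N b(1)]] gauge_rays_subset[OF N] b(1)[of t] b(1)[of 0] t b(2)[of t] b(2)[of 0]
      unfolding gauge_rays_from_def by auto
    then show ?thesis using b(3)[of t t] t dist_triangle[of "\<alpha> t" "b 0 t" "b t t"] dist_commute[of "b 0 t" "b t t"] by auto
  qed
  then have "ray_end \<oo> 0 \<alpha> = ray_end \<oo> 0 (b 0)" by (intro ray_end_eqI finite_hausdorff_dist_pointwise)
  then show False using ne b(2)[of 0] by simp
qed

text \<open>Openness in the direct limit is tested in each stratum, where only finitely many points
  of \<open>F\<close> have to be avoided. Each is avoided by some neighbourhood of the given ray,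
  and the largest of the finitely many radii avoids them all.\<close>

lemma openin_minus_locally_finite:
  assumes fin: "\<And>N. morse_gauge N \<Longrightarrow> finite (F \<inter> boundary_stratum \<oo> N)"
  shows "openin (morse_boundary_topology \<oo>) (morse_boundary \<oo> - F)"
  unfolding openin_morse_boundary_topology openin_stratum_topology
proof (intro conjI allI impI ballI)
  fix N \<alpha> assume N: "morse_gauge N" and a: "\<alpha> \<in> gauge_rays_from \<oo> N"
    and e: "ray_end \<oo> 0 \<alpha> \<in> (morse_boundary \<oo> - F) \<inter> boundary_stratum \<oo> N"
  let ?r = "morse_delta N"
  have "\<forall>x\<in>F. \<exists>n\<ge>0. x \<notin> boundary_nbhd \<oo> N \<alpha> ?r n"
  proof
    fix x assume "x \<in> F"
    then have "ray_end \<oo> 0 \<alpha> \<noteq> x" using e by auto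
    then show "\<exists>n\<ge>0. x \<notin> boundary_nbhd \<oo> N \<alpha> ?r n" by (rule boundary_nbhd_avoids[OF N a])
  qed
  then obtain n where n: "\<And>x. x \<in> F \<Longrightarrow> n x \<ge> 0 \<and> x \<notin> boundary_nbhd \<oo> N \<alpha> ?r (n x)" by metis
  define m where "m = Max (insert 0 (n ` (F \<inter> boundary_stratum \<oo> N)))"
  have m: "m \<ge> 0" "\<And>x. x \<in> F \<inter> boundary_stratum \<oo> N \<Longrightarrow> n x \<le> m" unfolding m_def using fin[OF N] by auto
  have sub: "boundary_nbhd \<oo> N \<alpha> ?r m \<subseteq> boundary_stratum \<oo> N" unfolding boundary_nbhd_def boundary_stratum_def by blast
  moreover have "x \<notin> boundary_nbhd \<oo> N \<alpha> ?r m" if "x \<in> F" for x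
    using n[OF that] boundary_nbhd_antimono[OF m(2)[of x], of \<oo> N \<alpha> ?r] sub that by blast
  moreover have "boundary_stratum \<oo> N \<subseteq> morse_boundary \<oo>" using boundary_stratum_subset[OF N] .
  ultimately have "boundary_nbhd \<oo> N \<alpha> ?r m \<subseteq> (morse_boundary \<oo> - F) \<inter> boundary_stratum \<oo> N" by blast
  then show "\<exists>n\<ge>0. boundary_nbhd \<oo> N \<alpha> ?r n \<subseteq> (morse_boundary \<oo> - F) \<inter> boundary_stratum \<oo> N" using m(1) by blast
qed auto

text \<open>\<open>U d\<close> contains \<open>d\<close> and no other point of \<open>D\<close>, and
  it is open because removing \<open>d\<close> keeps the finiteness condition. A finite subcover
  therefore leaves room for only finitely many points of \<open>D\<close>.\<close>

lemma locally_finite_subset_of_compact: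
  assumes L: "compactin (morse_boundary_topology \<oo>) L" and D: "D \<subseteq> L"
    and fin: "\<And>N. morse_gauge N \<Longrightarrow> finite (D \<inter> boundary_stratum \<oo> N)"
  shows "finite D"
proof (cases "D = {}")
  case False
  define U where "U d = morse_boundary \<oo> - (D - {d})" for d
  have LB: "L \<subseteq> morse_boundary \<oo>" using L unfolding compactin_def topspace_morse_boundary_topology by blast
  have "openin (morse_boundary_topology \<oo>) (U d)" for d
    unfolding U_def by (rule openin_minus_locally_finite) (rule finite_subset[OF _ fin], auto)
  moreover have "L \<subseteq> \<Union>(U ` D)" using False LB unfolding U_def by auto
  ultimately have "\<exists>\<F>. finite \<F> \<and> \<F> \<subseteq> U ` D \<and> L \<subseteq> \<Union>\<F>"
    using L unfolding compactin_def by (metis (no_types, lifting) imageE)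
  then obtain \<F> where F: "finite \<F>" "\<F> \<subseteq> U ` D" "L \<subseteq> \<Union>\<F>" by blast
  then obtain D' where D': "D' \<subseteq> D" "finite D'" "\<F> = U ` D'" by (meson finite_subset_image)
  have "D \<subseteq> D'"
  proof
    fix x assume x: "x \<in> D"
    then obtain d where "d \<in> D'" "x \<in> U d" using D F D' by blast
    then show "x \<in> D'" using x unfolding U_def by auto
  qed
  then show ?thesis using D' finite_subset by blast
qed simp

text \<open>The bound is found separately for each \<open>(K, C)\<close>. Were there none, some
  sequence in \<open>L\<close> would violate the bounds 0, 1, 2 and so on. A stratum imposes one
  bound on all its points, hence contains only finitely many of the sequence, so the sequence has
  finite range; but finitely many points do admit a common bound.\<close>

lemma compact_imp_uniform_gauge:
  assumes L: "compactin (morse_boundary_topology \<oo>) L"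
  obtains M where "\<And>x. x \<in> L \<Longrightarrow> \<exists>\<beta>\<in>morse_rays_from \<oo>. ray_end \<oo> 0 \<beta> = x \<and> morse_pairs M (\<beta> ` {0..})"
proof -
  have LB: "L \<subseteq> morse_boundary \<oo>" using L unfolding compactin_def topspace_morse_boundary_topology by blast
  then have "\<forall>x\<in>L. \<exists>\<beta>. \<beta> \<in> morse_rays_from \<oo> \<and> ray_end \<oo> 0 \<beta> = x" unfolding morse_boundary_def by blast
  then obtain b where b: "\<And>x. x \<in> L \<Longrightarrow> b x \<in> morse_rays_from \<oo>" "\<And>x. x \<in> L \<Longrightarrow> ray_end \<oo> 0 (b x) = x" by metis
  define P where "P K C B x \<longleftrightarrow> (\<exists>M. morse_pairs M (b x ` {0..}) \<and> M K C \<le> B)" for K C B x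
  have Pstrat: "P K C (perturbed (ray_const (pair_gauge 1 0 N)) (pair_gauge 1 0 N) K C) x"
    if N: "morse_gauge N" and x: "x \<in> L" "x \<in> boundary_stratum \<oo> N" for K C N x
  proof -
    obtain \<beta> where \<beta>: "\<beta> \<in> gauge_rays_from \<oo> N" "ray_end \<oo> 0 \<beta> = x" using x unfolding boundary_stratum_def by auto
    have "morse_pairs (perturbed (ray_const (pair_gauge 1 0 N)) (pair_gauge 1 0 N)) (b x ` {0..})"
      by (rule same_end_morse_pairs[OF b(1)[OF x(1)] _ _ gauge_rays_morse_pairs[OF N \<beta>(1)]])
         (use \<beta> b(2)[OF x(1)] in \<open>auto simp: gauge_rays_from_def\<close>)
    then show ?thesis unfolding P_def by blast
  qed
  have "\<exists>B. \<forall>x\<in>L. P K C B x" for K C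
  proof (rule ccontr)
    assume "\<not> ?thesis"
    then have "\<forall>n::nat. \<exists>x\<in>L. \<not> P K C (real n) x" by blast
    then obtain x where x: "\<And>n::nat. x n \<in> L" "\<And>n. \<not> P K C (real n) (x n)" by metis
    have mono: "P K C B y \<Longrightarrow> B \<le> B' \<Longrightarrow> P K C B' y" for B B' y unfolding P_def by force
    have "finite (range x \<inter> boundary_stratum \<oo> N)" if N: "morse_gauge N" for N
    proof -
      let ?v = "perturbed (ray_const (pair_gauge 1 0 N)) (pair_gauge 1 0 N) K C"
      have "n < nat \<lceil>?v\<rceil> + 1" if "x n \<in> boundary_stratum \<oo> N" for n
      proof (rule ccontr)
        assume "\<not> ?thesis"
        then have "?v \<le> real n" by linarith
        then show False using mono[OF Pstrat[OF N x(1)[of n] that]] x(2)[of n] by blast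
      qed
      then have "range x \<inter> boundary_stratum \<oo> N \<subseteq> x ` {..<nat \<lceil>?v\<rceil> + 1}" by auto
      then show ?thesis using finite_subset by blast
    qed
    then have fin: "finite (range x)" using locally_finite_subset_of_compact[OF L, of "range x"] x(1) by blast
    have "\<exists>B. P K C B y" if "y \<in> L" for y
      using b(1)[OF that] unfolding P_def morse_rays_from_iff by blast
    then obtain v where v: "\<And>y. y \<in> L \<Longrightarrow> P K C (v y) y" by metis
    have "bdd_above (v ` range x)" using fin by simp
    then obtain B where B: "\<And>n. v (x n) \<le> B" unfolding bdd_above_def by auto
    obtain n :: nat where "B \<le> real n" using real_arch_simple by blast
    then show False using mono[OF v[OF x(1)[of n]], of "real n"] B[of n] x(2)[of n] by linarith
  qed
  then obtain M where M: "\<And>K C x. x \<in> L \<Longrightarrow> P K C (M K C) x" by metis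
  \<comment> \<open>\<open>P\<close> supplies a gauge that may change with \<open>(K, C)\<close>.
    This suffices, because the condition on a pair of \<open>(K, C)\<close>-paths involves only the
    value there.\<close>
  have "morse_pairs M (b x ` {0..})" if x: "x \<in> L" for x
    unfolding morse_pairs_def
  proof (intro ballI morse_pairI)
    fix p q K C a b' \<phi> c d \<psi> t
    assume pq: "p \<in> b x ` {0..}" "q \<in> b x ` {0..}" and path: "qg_path K C a b' \<phi> p q" "qg_path K C c d \<psi> p q" "t \<in> {a..b'}"
    obtain M' where M': "morse_pairs M' (b x ` {0..})" "M' K C \<le> M K C" using M[OF x, of K C] unfolding P_def by blast
    show "\<exists>s\<in>{c..d}. dist (\<phi> t) (\<psi> s) \<le> M K C" using morse_pairD[OF morse_pairsD[OF M'(1) pq] path] M'(2) by force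
  qed
  then show thesis using that b by blast
qed

section \<open>Limits of rays from the basepoint and a compactness criterion\<close>

lemma rays_limit:
  assumes "\<And>k::nat. geodesic {0..} (f k) \<and> f k 0 = \<oo>"
  obtains \<rho> \<beta> where "strict_mono \<rho>" "geodesic {0..} \<beta>" "\<beta> 0 = \<oo>" "\<And>t. t \<ge> 0 \<Longrightarrow> (\<lambda>k. f (\<rho> k) t) \<longlonglongrightarrow> \<beta> t"
    "\<And>T. T \<ge> 0 \<Longrightarrow> uniform_limit {0..T} (\<lambda>k. f (\<rho> k)) \<beta> sequentially"
proof -
  define c where "c k t = f k (max 0 t)" for k t
  have lip: "dist (c k s) (c k t) \<le> \<bar>s - t\<bar>" for k s t
    using geodesicD[OF conjunct1[OF assms[of k]], of "max 0 s" "max 0 t"] unfolding c_def by auto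
  have ceq: "t \<ge> 0 \<Longrightarrow> c k t = f k t" for k t unfolding c_def by (simp add: max_def)
  obtain \<rho> \<beta> where r: "strict_mono \<rho>" "\<And>t. (\<lambda>k. c (\<rho> k) t) \<longlonglongrightarrow> \<beta> t"
    using arzela_ascoli_lipschitz[of c \<oo> 0, OF lip] assms ceq[of 0] by auto
  have 1: "geodesic {0..} \<beta>"
  proof (rule geodesic_iciI)
    fix s t :: real assume st: "0 \<le> s" "s \<le> t"
    have "dist (c (\<rho> k) s) (c (\<rho> k) t) = t - s" for k
      using geodesicD[OF conjunct1[OF assms[of "\<rho> k"]], of s t] st ceq by auto
    then show "dist (\<beta> s) (\<beta> t) = t - s" by (intro geodesic_limit[OF r(2) r(2)]) auto
  qed
  have 2: "\<beta> 0 = \<oo>" using r(2)[of 0] assms ceq[of 0] by (simp add: LIMSEQ_const_iff)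
  have 3: "(\<lambda>k. f (\<rho> k) t) \<longlonglongrightarrow> \<beta> t" if "t \<ge> 0" for t using r(2)[of t] ceq[OF that] by simp
  have 4: "uniform_limit {0..T} (\<lambda>k. f (\<rho> k)) \<beta> sequentially" if T: "T \<ge> 0" for T
  proof -
    have "uniform_limit {0..T} (\<lambda>k. c (\<rho> k)) \<beta> sequentially" by (rule uniform_limit_lipschitz) (use r(2) lip T in auto)
    then show ?thesis by (rule uniform_limit_cong'[THEN iffD1, rotated 2]) (auto simp: ceq)
  qed
  show thesis using that[OF r(1) 1 2 3 4] by blast
qed

text \<open>Otherwise a greedy choice yields a sequence of rays no two of which are 1-close on
  \<open>{0..T}\<close>, contradicting the existence of a uniformly convergent subsequence.\<close>

lemma ray_family_totally_bounded:
  assumes R: "\<And>\<alpha>. \<alpha> \<in> R \<Longrightarrow> geodesic {0..} \<alpha> \<and> \<alpha> 0 = \<oo>" and T: "T \<ge> 0"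
  shows "\<exists>F. finite F \<and> F \<subseteq> R \<and> (\<forall>\<beta>\<in>R. \<exists>\<alpha>\<in>F. \<forall>t\<in>{0..T}. dist (\<alpha> t) (\<beta> t) \<le> 1)"
proof (rule ccontr)
  assume no: "\<not> ?thesis"
  define Q where "Q \<alpha> \<beta> \<longleftrightarrow> (\<forall>t\<in>{0..T}. dist (\<alpha> t) (\<beta> t) \<le> 1)" for \<alpha> \<beta> :: "real \<Rightarrow> 'x"
  have no': "\<exists>\<beta>\<in>R. \<forall>\<alpha>\<in>F. \<not> Q \<alpha> \<beta>" if "finite F" "F \<subseteq> R" for F
    using no that unfolding Q_def[symmetric] by meson
  define P where "P f n a \<longleftrightarrow> a \<in> R \<and> (\<forall>m<n. \<not> Q (f m) a)" for f :: "nat \<Rightarrow> real \<Rightarrow> 'x" and n :: nat and a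
  have "\<exists>f. \<forall>n. P f n (f n)"
  proof (rule dependent_wellorder_choice)
    fix f n assume "\<And>m. m < n \<Longrightarrow> P f m (f m)"
    then have "finite (f ` {..<n})" "f ` {..<n} \<subseteq> R" unfolding P_def by auto
    from no'[OF this] obtain a where "a \<in> R" "\<forall>\<alpha>\<in>f ` {..<n}. \<not> Q \<alpha> a" by blast
    then show "\<exists>a. P f n a" unfolding P_def by auto
  qed (auto simp: P_def)
  then obtain f where f: "\<And>n. P f n (f n)" by blast
  have fr: "geodesic {0..} (f k) \<and> f k 0 = \<oo>" for k using R f unfolding P_def by blast
  obtain \<rho> \<beta> where r: "strict_mono \<rho>" "\<And>T. T \<ge> 0 \<Longrightarrow> uniform_limit {0..T} (\<lambda>k. f (\<rho> k)) \<beta> sequentially"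
    by (rule rays_limit[of f, OF fr]) blast
  obtain n where n: "\<And>k. k \<ge> n \<Longrightarrow> \<forall>t\<in>{0..T}. dist (f (\<rho> k) t) (\<beta> t) < 1/2"
    using uniform_limitD[OF r(2)[OF T], of "1/2"] unfolding eventually_sequentially by auto
  have "dist (f (\<rho> n) t) (f (\<rho> (Suc n)) t) \<le> 1" if "t \<in> {0..T}" for t
  proof -
    have "dist (f (\<rho> n) t) (\<beta> t) < 1/2" "dist (f (\<rho> (Suc n)) t) (\<beta> t) < 1/2" using n[of n] n[of "Suc n"] that by auto
    then show ?thesis using dist_triangle_half_l[of "f (\<rho> n) t" "\<beta> t" 1] by (metis dist_commute less_imp_le)
  qed
  moreover have "\<rho> n < \<rho> (Suc n)" using r(1) by (simp add: strict_mono_Suc_iff)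
  ultimately show False using f[of "\<rho> (Suc n)"] unfolding P_def Q_def by blast
qed

text \<open>Lebesgue number argument: for some k, all rays of R that are 1-close to a given one on [0,k] end
  in a common member of the cover, and finitely many rays of R are 1-dense up to k.\<close>

lemma compactin_ends:
  assumes N: "morse_gauge N" "morse_delta N \<ge> 2" and R: "R \<subseteq> gauge_rays_from \<oo> N" "ray_end \<oo> 0 ` R = L"
    and lim: "\<And>f \<beta>. (\<And>k::nat. f k \<in> R) \<Longrightarrow> geodesic {0..} \<beta> \<Longrightarrow> \<beta> 0 = \<oo> \<Longrightarrow> (\<And>t. t \<ge> 0 \<Longrightarrow> (\<lambda>k. f k t) \<longlonglongrightarrow> \<beta> t) \<Longrightarrow>
      (\<And>T. T \<ge> 0 \<Longrightarrow> uniform_limit {0..T} f \<beta> sequentially) \<Longrightarrow> \<beta> \<in> gauge_rays_from \<oo> N \<and> ray_end \<oo> 0 \<beta> \<in> L"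
  shows "compactin (morse_boundary_topology \<oo>) L"
  unfolding compactin_def topspace_morse_boundary_topology
proof (intro conjI allI impI)
  have Rm: "R \<subseteq> morse_rays_from \<oo>" using R gauge_rays_subset[OF N(1)] by blast
  then show "L \<subseteq> morse_boundary \<oo>" using R(2) unfolding morse_boundary_def by blast
  fix \<U> assume U: "Ball \<U> (openin (morse_boundary_topology \<oo>)) \<and> L \<subseteq> \<Union> \<U>"
  have Rr: "geodesic {0..} \<alpha> \<and> \<alpha> 0 = \<oo>" if "\<alpha> \<in> R" for \<alpha> using that R(1) unfolding gauge_rays_from_def by auto
  define Q where "Q k \<alpha> U \<longleftrightarrow> (\<forall>\<beta>\<in>R. (\<forall>t\<in>{0..real k}. dist (\<alpha> t) (\<beta> t) \<le> 1) \<longrightarrow> ray_end \<oo> 0 \<beta> \<in> U)" for k \<alpha> U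
  have "\<exists>k::nat. \<forall>\<alpha>\<in>R. \<exists>U\<in>\<U>. Q k \<alpha> U"
  proof (rule ccontr)
    assume "\<not> ?thesis"
    then have "\<forall>k::nat. \<exists>\<alpha>. \<alpha> \<in> R \<and> (\<forall>U\<in>\<U>. \<not> Q k \<alpha> U)" by simp blast
    then obtain f where f: "\<And>k::nat. f k \<in> R" "\<And>k U. U \<in> \<U> \<Longrightarrow> \<not> Q k (f k) U" by metis
    have fr: "geodesic {0..} (f k) \<and> f k 0 = \<oo>" for k using Rr f by blast
    obtain \<rho> \<alpha> where r: "strict_mono \<rho>" "geodesic {0..} \<alpha>" "\<alpha> 0 = \<oo>" "\<And>t. t \<ge> 0 \<Longrightarrow> (\<lambda>k. f (\<rho> k) t) \<longlonglongrightarrow> \<alpha> t"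
      "\<And>T. T \<ge> 0 \<Longrightarrow> uniform_limit {0..T} (\<lambda>k. f (\<rho> k)) \<alpha> sequentially"
      by (rule rays_limit[of f, OF fr]) blast
    have a: "\<alpha> \<in> gauge_rays_from \<oo> N" "ray_end \<oo> 0 \<alpha> \<in> L" using lim[of "\<lambda>k. f (\<rho> k)" \<alpha>] f(1) r by auto
    then obtain U where U': "U \<in> \<U>" "ray_end \<oo> 0 \<alpha> \<in> U" using U by blast
    then have "openin (stratum_topology \<oo> N) (U \<inter> boundary_stratum \<oo> N)"
      using U N(1) unfolding openin_morse_boundary_topology by blast
    moreover have "ray_end \<oo> 0 \<alpha> \<in> U \<inter> boundary_stratum \<oo> N" using U' a unfolding boundary_stratum_def by blast
    ultimately obtain n where n: "n \<ge> 0" "boundary_nbhd \<oo> N \<alpha> (morse_delta N) n \<subseteq> U"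
      using a(1) unfolding openin_stratum_topology by blast
    have "\<forall>\<^sub>F k in sequentially. n \<le> real k" using eventually_ge_at_top[of "nat \<lceil>n\<rceil>"] by (rule eventually_mono) linarith
    then have "\<forall>\<^sub>F k in sequentially. n \<le> real k \<and> (\<forall>t\<in>{0..n}. dist (f (\<rho> k) t) (\<alpha> t) < 1)"
      using uniform_limitD[OF r(5)[OF n(1)], of 1] by (simp add: eventually_conj)
    then obtain k where k: "n \<le> real k" "\<forall>t\<in>{0..n}. dist (f (\<rho> k) t) (\<alpha> t) < 1" unfolding eventually_sequentially by blast
    have nk: "n \<le> real (\<rho> k)" using k(1) seq_suble[OF r(1), of k] by linarith
    obtain \<beta> where \<beta>: "\<beta> \<in> R" "\<forall>t\<in>{0..real (\<rho> k)}. dist (f (\<rho> k) t) (\<beta> t) \<le> 1" "ray_end \<oo> 0 \<beta> \<notin> U" using f(2)[OF U'(1)] unfolding Q_def by blast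
    \<comment> \<open>Two errors of 1 add up here, from \<open>\<alpha>\<close> to the sequence and
      from the sequence to \<open>\<beta>\<close>; this is the origin of the assumption
      \<open>morse_delta N \<ge> 2\<close>.\<close>
    have "dist (\<alpha> t) (\<beta> t) \<le> morse_delta N" if t: "t \<in> {0..n}" for t
    proof -
      have "dist (f (\<rho> k) t) (\<alpha> t) < 1" "dist (f (\<rho> k) t) (\<beta> t) \<le> 1" using k(2) \<beta>(2) nk t by auto
      then show ?thesis using N(2) by metric
    qed
    then have "ray_end \<oo> 0 \<beta> \<in> boundary_nbhd \<oo> N \<alpha> (morse_delta N) n" using \<beta>(1) R(1) unfolding boundary_nbhd_def by blast
    then show False using n(2) \<beta>(3) by blast
  qed
  then obtain k :: nat where "\<forall>\<alpha>\<in>R. \<exists>U. U \<in> \<U> \<and> Q k \<alpha> U" by blast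
  then obtain u where u: "\<And>\<alpha>. \<alpha> \<in> R \<Longrightarrow> u \<alpha> \<in> \<U>" "\<And>\<alpha>. \<alpha> \<in> R \<Longrightarrow> Q k \<alpha> (u \<alpha>)" by metis
  obtain F where F: "finite F" "F \<subseteq> R" "\<forall>\<beta>\<in>R. \<exists>\<alpha>\<in>F. \<forall>t\<in>{0..real k}. dist (\<alpha> t) (\<beta> t) \<le> 1"
    using ray_family_totally_bounded[of R "real k", OF Rr] by auto
  have "L \<subseteq> \<Union>(u ` F)"
  proof
    fix x assume "x \<in> L"
    then obtain \<beta> where \<beta>: "\<beta> \<in> R" "x = ray_end \<oo> 0 \<beta>" using R(2) by blast
    then obtain \<alpha> where "\<alpha> \<in> F" "\<forall>t\<in>{0..real k}. dist (\<alpha> t) (\<beta> t) \<le> 1" using F(3) by blast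
    then show "x \<in> \<Union>(u ` F)" using u(2)[of \<alpha>] F(2) \<beta> unfolding Q_def by blast
  qed
  then show "\<exists>\<F>. finite \<F> \<and> \<F> \<subseteq> \<U> \<and> L \<subseteq> \<Union> \<F>" using F u(1) by (intro exI[of _ "u ` F"]) auto
qed

end

section \<open>Orbits\<close>

lemma geodesic_segment_reverse:
  assumes "geodesic_segment x y \<gamma>"
  shows "geodesic_segment y x (\<lambda>t. \<gamma> (dist x y - t))" "(\<lambda>t. \<gamma> (dist x y - t)) ` {0..dist y x} = \<gamma> ` {0..dist x y}"
proof -
  note g = geodesic_segmentD[OF assms]
  show "geodesic_segment y x (\<lambda>t. \<gamma> (dist x y - t))"
    unfolding geodesic_segment_def using g(2,3) geodesicD[OF g(1)]
    by (auto simp: dist_commute[of y x] intro!: geodesic_iccI)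
  have "(\<lambda>t. dist x y - t) ` {0..dist x y} = {0..dist x y}" by (auto intro!: image_eqI[of _ _ "dist x y - _"])
  then show "(\<lambda>t. \<gamma> (dist x y - t)) ` {0..dist y x} = \<gamma> ` {0..dist x y}"
    unfolding dist_commute[of y x] by (metis image_image)
qed

lemma geodesic_segment_isometry:
  assumes "\<And>u v. dist (f u) (f v) = dist u v" "geodesic_segment x y \<gamma>"
  shows "geodesic_segment (f x) (f y) (\<lambda>t. f (\<gamma> t))"
  using assms unfolding geodesic_segment_def geodesic_def by simp

lemma geodesic_isometry:
  assumes "\<And>u v. dist (f u) (f v) = dist u v" "geodesic I \<gamma>"
  shows "geodesic I (\<lambda>t. f (\<gamma> t))"
  using assms unfolding geodesic_def by simp

lemma morse_pairs_isometry:
  assumes "\<And>u v. dist (g u) (g v) = dist u v" "\<And>u. g (f u) = u" "morse_pairs M (\<gamma> ` I)"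
  shows "morse_pairs M ((\<lambda>t. f (\<gamma> t)) ` I)"
  unfolding morse_pairs_def
proof (intro ballI)
  fix x y assume "x \<in> (\<lambda>t. f (\<gamma> t)) ` I" "y \<in> (\<lambda>t. f (\<gamma> t)) ` I"
  then have "morse_pair M (g x) (g y)" using assms(2) morse_pairsD[OF assms(3)] by auto
  then show "morse_pair M x y" using morse_pair_isometry[of g, OF assms(1)] by blast
qed

lemma segment_near:
  assumes g: "geodesic I \<gamma>" "morse_pairs M (\<gamma> ` I)" and x: "x \<in> \<gamma> ` I" "y \<in> \<gamma> ` I"
    and c: "geodesic J c" "s \<in> J" "t \<in> J" "s \<le> t" and r: "dist (c s) x \<le> r" "dist (c t) y \<le> r"
  shows "near (M 1 (2 * r + 2)) (c ` {s..t}) (\<gamma> ` I)"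
proof -
  have "qg_path 1 (0 + 2 * r + 2) (s - 1) (t + 1) (extend_path s t c x y) x y"
    by (rule qg_path_extend[OF geodesic_qg_path[OF c(1) c(4) geodesic_is_interval[OF c(1-3)]]])
       (use r in \<open>simp_all add: dist_commute\<close>)
  then have "near (M 1 (0 + 2 * r + 2)) (extend_path s t c x y ` {s - 1..t + 1}) (\<gamma> ` I)"
    by (rule morse_pairs_path_near[OF g _ x])
  then have "near (M 1 (0 + 2 * r + 2)) (c ` {s..t}) (\<gamma> ` I)" by (rule near_subset[OF _ extend_path_image(1)[OF c(4)]])
  then show ?thesis by simp
qed

text \<open>Parameters measure distance from starting points at most \<open>r\<close> apart, so a
  point within \<open>D\<close> of \<open>c t\<close> has parameter within \<open>D + r\<close> of
  \<open>t\<close>.\<close>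

lemma fellow_travel:
  fixes c \<gamma> :: "real \<Rightarrow> 'x::metric_space"
  assumes c: "geodesic J c" and g: "geodesic I \<gamma>" and D: "near D {c t} (\<gamma> ` I)"
    and t: "t \<in> J" "0 \<in> J" "t \<in> I" "0 \<in> I" "t \<ge> 0" "I \<subseteq> {0..}" and r: "dist (c 0) (\<gamma> 0) \<le> r"
  shows "dist (c t) (\<gamma> t) \<le> 2 * D + r"
proof -
  obtain s where s: "s \<in> I" "dist (c t) (\<gamma> s) \<le> D" using D unfolding near_def by auto
  have 1: "dist (c t) (c 0) = t" "dist (\<gamma> s) (\<gamma> 0) = s" "dist (\<gamma> s) (\<gamma> t) = \<bar>s - t\<bar>"
    using geodesicD[OF c t(1,2)] geodesicD[OF g s(1) t(4)] geodesicD[OF g s(1) t(3)] t s by auto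
  have "\<bar>s - t\<bar> \<le> D + r"
    using 1(1,2) r s(2) by metric
  then show ?thesis using 1(3) s(2) by metric
qed

definition ideal_gauge :: "gauge_fun \<Rightarrow> gauge_fun" where
  "ideal_gauge M = third_side_gauge (\<lambda>K C. max (M K C) (perturbed (M 1 (2 * M 9 4 + 2)) M K C))"

context proper_geodesic_space
begin

text \<open>The ideal vertex is replaced by a far point \<open>m\<close> of \<open>\<beta>\<close>
  within \<open>M 9 4\<close> of \<open>\<sigma>\<close>. The segment from \<open>\<sigma> 0\<close>
  to \<open>m\<close> inherits a gauge from \<open>\<sigma>\<close>. How far out \<open>m\<close>
  lies depends on the Hausdorff distance of the rays, the resulting gauge does not.\<close>

lemma morse_pairs_ideal_triangle:
  fixes \<beta> \<sigma> \<gamma> :: "real \<Rightarrow> 'x"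
  assumes b: "geodesic {0..} \<beta>" "morse_pairs M (\<beta> ` {0..})" and s: "geodesic {0..} \<sigma>" "morse_pairs M (\<sigma> ` {0..})"
    and fh: "finite_hausdorff_dist (\<beta> ` {0..}) (\<sigma> ` {0..})" and g: "geodesic_segment (\<beta> 0) (\<sigma> 0) \<gamma>"
  shows "morse_pairs (ideal_gauge M) (\<gamma> ` {0..dist (\<beta> 0) (\<sigma> 0)})"
proof -
  let ?R = "M 9 4"
  let ?M = "\<lambda>K C. max (M K C) (perturbed (M 1 (2 * M 9 4 + 2)) M K C)"
  obtain D where "near D (\<sigma> ` {0..}) (\<beta> ` {0..})" using fh unfolding finite_hausdorff_dist_iff_near by blast
  then obtain T where T: "T \<ge> 0" "\<exists>s'\<ge>0. dist (\<beta> T) (\<sigma> s') \<le> ?R" using rays_close[OF s b(1)] by blast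
  then obtain s' where s': "s' \<ge> 0" "dist (\<beta> T) (\<sigma> s') \<le> ?R" by blast
  have R0: "?R \<ge> 0" using s'(2) zero_le_dist order_trans by blast
  define m where "m = \<beta> T"
  have dm: "dist (\<beta> 0) m = T" using geodesicD[OF b(1), of 0 T] T(1) unfolding m_def by auto
  have g1: "geodesic_segment (\<beta> 0) m \<beta>"
    unfolding m_def by (rule geodesic_segmentI[OF geodesic_sub[OF b(1)]]) (use T(1) in \<open>auto simp: is_interval_cc\<close>)
  have h1: "morse_pairs ?M (\<beta> ` {0..dist (\<beta> 0) m})"
    by (rule morse_pairs_mono[OF morse_pairs_subset[OF b(2)]]) auto
  obtain c where c: "geodesic_segment (\<sigma> 0) m c" using geodesic_space by blast
  note c' = geodesic_segmentD[OF c]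
  have "near (M 1 (2 * ?R + 2)) (c ` {0..dist (\<sigma> 0) m}) (\<sigma> ` {0..})"
    by (rule segment_near[OF s, of "\<sigma> 0" "\<sigma> s'" _ c, OF _ _ c'(1)]) (use c' s' R0 in \<open>auto simp: m_def\<close>)
  then have h2: "morse_pairs ?M (c ` {0..dist (\<sigma> 0) m})"
    by (intro morse_pairs_mono[OF morse_pairs_near[OF s(2)]]) auto
  show ?thesis unfolding ideal_gauge_def by (rule morse_pairs_third_side[OF h1 h2 g g1 c])
qed

end

locale proper_orbit = proper_geodesic_space \<oo> for \<oo> :: "'x::metric_space" +
  fixes H :: "('g, 'r) monoid_scheme" (structure) and \<phi> :: "'g \<Rightarrow> 'x \<Rightarrow> 'x"
  assumes group: "group H" and isometries: "isometric_action H \<phi>" and proper: "proper_action H \<phi>"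
begin

definition X where "X = orbit H \<phi> \<oo>"
definition \<Lambda> where "\<Lambda> = limit_set \<oo> X"

lemma action: "group_action H UNIV \<phi>" using isometries unfolding isometric_action_def by blast

lemma act_dist [simp]: "h \<in> carrier H \<Longrightarrow> dist (\<phi> h x) (\<phi> h y) = dist x y"
  using isometries unfolding isometric_action_def by blast

lemma act_mult: "g \<in> carrier H \<Longrightarrow> h \<in> carrier H \<Longrightarrow> \<phi> (g \<otimes> h) x = \<phi> g (\<phi> h x)"
  using group_action.composition_rule[OF action, of x g h] by simp

lemma act_one: "\<phi> \<one> x = x"
  using group_action.id_eq_one[OF action] by (metis UNIV_I restrict_apply)

lemma inv_carrier [simp]: "h \<in> carrier H \<Longrightarrow> inv h \<in> carrier H"
  using group group.inv_closed by metis

lemma act_inv: "h \<in> carrier H \<Longrightarrow> \<phi> (inv h) (\<phi> h x) = x" "h \<in> carrier H \<Longrightarrow> \<phi> h (\<phi> (inv h) x) = x"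
  using act_mult[of "inv h" h x] act_mult[of h "inv h" x] act_one group.l_inv[OF group, of h] group.r_inv[OF group, of h] by auto

lemma X_iff: "x \<in> X \<longleftrightarrow> (\<exists>h\<in>carrier H. x = \<phi> h \<oo>)"
  unfolding X_def orbit_def by blast

lemma base_in_X: "\<oo> \<in> X"
  unfolding X_iff using act_one group.is_monoid[OF group] monoid.one_closed by metis

lemma act_X: "h \<in> carrier H \<Longrightarrow> x \<in> X \<Longrightarrow> \<phi> h x \<in> X"
  unfolding X_iff using act_mult monoid.m_closed[OF group.is_monoid[OF group]] by metis

lemma morse_pairs_act: "h \<in> carrier H \<Longrightarrow> morse_pairs M (\<gamma> ` I) \<Longrightarrow> morse_pairs M ((\<lambda>t. \<phi> h (\<gamma> t)) ` I)"
  by (rule morse_pairs_isometry[of "\<phi> (inv h)"]) (simp_all add: act_inv)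

definition uniform_gauge :: "gauge_fun \<Rightarrow> bool" where
  "uniform_gauge M \<longleftrightarrow> (\<forall>p\<in>X. \<forall>q\<in>X. \<forall>\<gamma>. geodesic_segment p q \<gamma> \<longrightarrow> morse_pairs M (\<gamma> ` {0..dist p q}))"

text \<open>Translated segments start at \<open>\<phi> h \<oo>\<close> instead of the basepoint.
  Segments from \<open>\<oo>\<close> to the translated orbit points fellow travel them, and a limit
  of these stays at bounded distance from the translated ray. The conclusion is stated for all
  representatives because \<open>limit_set\<close> only provides some.\<close>

lemma limit_set_translate:
  assumes x: "x \<in> \<Lambda>" and h: "h \<in> carrier H"
  obtains x' where "x' \<in> \<Lambda>" "\<And>\<alpha> \<beta>. \<alpha> \<in> morse_rays_from \<oo> \<Longrightarrow> ray_end \<oo> 0 \<alpha> = x \<Longrightarrow> \<beta> \<in> morse_rays_from \<oo> \<Longrightarrow>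
    ray_end \<oo> 0 \<beta> = x' \<Longrightarrow> finite_hausdorff_dist (\<beta> ` {0..}) ((\<lambda>t. \<phi> h (\<alpha> t)) ` {0..})"
proof -
  obtain M a \<gamma> \<alpha> where l: "\<And>k::nat. a k \<in> X" "\<And>k. geodesic_segment \<oo> (a k) (\<gamma> k)"
    "\<And>k. morse_pairs M (\<gamma> k ` {0..dist \<oo> (a k)})" "filterlim (\<lambda>k. dist \<oo> (a k)) at_top sequentially"
    "\<And>T. T \<ge> 0 \<Longrightarrow> uniform_limit {0..T} \<gamma> \<alpha> sequentially"
    "\<alpha> \<in> morse_rays_from \<oo>" "ray_end \<oo> 0 \<alpha> = x" by (rule limit_setD[OF x[unfolded \<Lambda>_def]]) blast
  have ex: "\<forall>k. \<exists>c. geodesic_segment \<oo> (\<phi> h (a k)) c" using geodesic_space by blast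
  then obtain c where c: "\<And>k. geodesic_segment \<oo> (\<phi> h (a k)) (c k)" by metis
  define r where "r = dist \<oo> (\<phi> h \<oo>)"
  define D where "D = M 1 (2 * r + 2)"
  note c' = geodesic_segmentD[OF c] and l' = geodesic_segmentD[OF l(2)]
  have r0: "r \<ge> 0" unfolding r_def by simp
  have near: "near D (c k ` {0..dist \<oo> (\<phi> h (a k))}) ((\<lambda>t. \<phi> h (\<gamma> k t)) ` {0..dist \<oo> (a k)})" for k
    unfolding D_def
  proof (rule segment_near[OF geodesic_isometry[OF act_dist[OF h] l'(1)] morse_pairs_act[OF h l(3)] _ _ c'(1)])
    show "\<phi> h \<oo> \<in> (\<lambda>t. \<phi> h (\<gamma> k t)) ` {0..dist \<oo> (a k)}" "\<phi> h (a k) \<in> (\<lambda>t. \<phi> h (\<gamma> k t)) ` {0..dist \<oo> (a k)}"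
      using geodesic_segment_endpoints[OF geodesic_segment_isometry[OF act_dist[OF h] l(2)[of k]]] act_dist[OF h] by simp_all
    show "dist (c k 0) (\<phi> h \<oo>) \<le> r" "dist (c k (dist \<oo> (\<phi> h (a k)))) (\<phi> h (a k)) \<le> r"
      using c'(2,3)[of k] r0 unfolding r_def by simp_all
  qed simp_all
  have dd: "dist \<oo> (\<phi> h (a k)) \<ge> dist \<oo> (a k) - r" for k
    using act_dist[OF h, of \<oo> "a k"] unfolding r_def by metric
  have inf: "filterlim (\<lambda>k. dist \<oo> (\<phi> h (a k))) at_top sequentially"
    unfolding filterlim_at_top
  proof
    fix Z
    have "\<forall>\<^sub>F k in sequentially. Z + r \<le> dist \<oo> (a k)" using l(4) unfolding filterlim_at_top by blast
    then show "\<forall>\<^sub>F k in sequentially. Z \<le> dist \<oo> (\<phi> h (a k))"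
    proof (rule eventually_mono)
      fix k assume "Z + r \<le> dist \<oo> (a k)"
      then show "Z \<le> dist \<oo> (\<phi> h (a k))" using dd[of k] by linarith
    qed
  qed
  have hc: "morse_pairs (perturbed D M) (c k ` {0..dist \<oo> (\<phi> h (a k))})" for k
    by (rule morse_pairs_near[OF morse_pairs_act[OF h l(3)] near])
  obtain \<rho> \<beta> where b: "strict_mono \<rho>" "geodesic {0..} \<beta>" "\<beta> 0 = \<oo>" "morse_pairs (perturbed 1 (perturbed D M)) (\<beta> ` {0..})"
    "\<And>t. t \<ge> 0 \<Longrightarrow> (\<lambda>k. c (\<rho> k) t) \<longlonglongrightarrow> \<beta> t" "ray_end \<oo> 0 \<beta> \<in> limit_set \<oo> X"
    by (rule segments_limit[of "\<lambda>k. \<phi> h (a k)" X c "perturbed D M", OF act_X[OF h l(1)] c hc inf]) blast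
  have close: "dist (\<beta> t) (\<phi> h (\<alpha> t)) \<le> 2 * D + r" if t: "t \<in> {0..}" for t
  proof (rule tendsto_upperbound)
    have "(\<lambda>k. \<gamma> k t) \<longlonglongrightarrow> \<alpha> t" by (rule tendsto_uniform_limitI[OF l(5)[of t]]) (use t in auto)
    then have "(\<lambda>k. \<gamma> (\<rho> k) t) \<longlonglongrightarrow> \<alpha> t" using LIMSEQ_subseq_LIMSEQ[OF _ b(1)] unfolding o_def by blast
    then have "(\<lambda>k. \<phi> h (\<gamma> (\<rho> k) t)) \<longlonglongrightarrow> \<phi> h (\<alpha> t)" unfolding tendsto_iff by (simp add: h)
    then show "(\<lambda>k. dist (c (\<rho> k) t) (\<phi> h (\<gamma> (\<rho> k) t))) \<longlonglongrightarrow> dist (\<beta> t) (\<phi> h (\<alpha> t))"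
      using tendsto_dist[OF b(5)[of t]] t by auto
    have "\<forall>\<^sub>F k in sequentially. t + r \<le> dist \<oo> (a k)" using l(4) unfolding filterlim_at_top by blast
    then have "\<forall>\<^sub>F k in sequentially. t + r \<le> dist \<oo> (a (\<rho> k))" by (rule eventually_subseq[OF b(1)])
    then show "\<forall>\<^sub>F k in sequentially. dist (c (\<rho> k) t) (\<phi> h (\<gamma> (\<rho> k) t)) \<le> 2 * D + r"
    proof (rule eventually_mono)
      fix k assume k: "t + r \<le> dist \<oo> (a (\<rho> k))"
      have tc: "t \<in> {0..dist \<oo> (\<phi> h (a (\<rho> k)))}" using k dd[of "\<rho> k"] t by auto
      have ta: "t \<in> {0..dist \<oo> (a (\<rho> k))}" using k r0 t by auto
      show "dist (c (\<rho> k) t) (\<phi> h (\<gamma> (\<rho> k) t)) \<le> 2 * D + r"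
        by (rule fellow_travel[OF c'(1) geodesic_isometry[OF act_dist[OF h] l'(1)] near_subset[OF near]])
           (use ta t tc c'(2) l'(2) in \<open>auto simp: r_def\<close>)
    qed
  qed simp
  have fh: "finite_hausdorff_dist (\<beta> ` {0..}) ((\<lambda>t. \<phi> h (\<alpha> t)) ` {0..})"
    using close by (rule finite_hausdorff_dist_pointwise)
  show thesis
  proof (rule that)
    show "ray_end \<oo> 0 \<beta> \<in> \<Lambda>" using b(6) unfolding \<Lambda>_def .
    fix \<alpha>' \<beta>' assume a': "\<alpha>' \<in> morse_rays_from \<oo>" "ray_end \<oo> 0 \<alpha>' = x"
      and b': "\<beta>' \<in> morse_rays_from \<oo>" "ray_end \<oo> 0 \<beta>' = ray_end \<oo> 0 \<beta>"
    have "finite_hausdorff_dist (\<alpha> ` {0..}) (\<alpha>' ` {0..})" using ray_end_eqD[OF l(6), of 0 \<alpha>'] a' l(7) by simp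
    then obtain E where E: "near E (\<alpha> ` {0..}) (\<alpha>' ` {0..})" "near E (\<alpha>' ` {0..}) (\<alpha> ` {0..})"
      unfolding finite_hausdorff_dist_iff_near by blast
    have "near E ((\<lambda>t. \<phi> h (\<alpha> t)) ` {0..}) ((\<lambda>t. \<phi> h (\<alpha>' t)) ` {0..})" "near E ((\<lambda>t. \<phi> h (\<alpha>' t)) ` {0..}) ((\<lambda>t. \<phi> h (\<alpha> t)) ` {0..})"
      using E h unfolding near_def by auto
    then have "finite_hausdorff_dist ((\<lambda>t. \<phi> h (\<alpha> t)) ` {0..}) ((\<lambda>t. \<phi> h (\<alpha>' t)) ` {0..})"
      unfolding finite_hausdorff_dist_iff_near by blast
    moreover have "finite_hausdorff_dist (\<beta>' ` {0..}) (\<beta> ` {0..})" by (rule ray_end_eqD[OF b'])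
    ultimately show "finite_hausdorff_dist (\<beta>' ` {0..}) ((\<lambda>t. \<phi> h (\<alpha>' t)) ` {0..})"
      using fh finite_hausdorff_dist_trans by blast
  qed
qed

lemma compact_imp_uniform_orbit_gauge:
  assumes ne: "\<Lambda> \<noteq> {}" and co: "compactin (morse_boundary_topology \<oo>) \<Lambda>"
  obtains M where "uniform_gauge M"
proof -
  obtain M where M: "\<And>x. x \<in> \<Lambda> \<Longrightarrow> \<exists>\<beta>\<in>morse_rays_from \<oo>. ray_end \<oo> 0 \<beta> = x \<and> morse_pairs M (\<beta> ` {0..})"
    using compact_imp_uniform_gauge[OF co] by blast
  obtain x where x: "x \<in> \<Lambda>" using ne by blast
  obtain \<beta> where \<beta>: "\<beta> \<in> morse_rays_from \<oo>" "ray_end \<oo> 0 \<beta> = x" "morse_pairs M (\<beta> ` {0..})" using M[OF x] by blast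
  have base: "morse_pairs (ideal_gauge M) (\<gamma> ` {0..dist \<oo> (\<phi> h \<oo>)})" if h: "h \<in> carrier H" and \<gamma>: "geodesic_segment \<oo> (\<phi> h \<oo>) \<gamma>" for h \<gamma>
  proof -
    \<comment> \<open>A uniformly Morse ray from \<open>\<oo>\<close> to the translate of
      \<open>x\<close> by \<open>inv h\<close>, moved by \<open>h\<close>, becomes a ray from
      \<open>\<phi> h \<oo>\<close> asymptotic to \<open>\<beta>\<close>. Both rays have gauge
      \<open>M\<close>, since both limit points lie in \<open>\<Lambda>\<close>.\<close>
    obtain x' where x': "x' \<in> \<Lambda>" "\<And>\<alpha> \<beta>. \<alpha> \<in> morse_rays_from \<oo> \<Longrightarrow> ray_end \<oo> 0 \<alpha> = x \<Longrightarrow> \<beta> \<in> morse_rays_from \<oo> \<Longrightarrow>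
      ray_end \<oo> 0 \<beta> = x' \<Longrightarrow> finite_hausdorff_dist (\<beta> ` {0..}) ((\<lambda>t. \<phi> (inv h) (\<alpha> t)) ` {0..})"
      by (rule limit_set_translate[OF x inv_carrier[OF h]]) blast
    obtain \<beta>' where \<beta>': "\<beta>' \<in> morse_rays_from \<oo>" "ray_end \<oo> 0 \<beta>' = x'" "morse_pairs M (\<beta>' ` {0..})" using M[OF x'(1)] by blast
    define \<sigma> where "\<sigma> t = \<phi> h (\<beta>' t)" for t
    have b0: "geodesic {0..} \<beta>'" "\<beta>' 0 = \<oo>" "geodesic {0..} \<beta>" "\<beta> 0 = \<oo>" using \<beta>'(1) \<beta>(1) unfolding morse_rays_from_iff by auto
    have s: "geodesic {0..} \<sigma>" unfolding \<sigma>_def by (rule geodesic_isometry[OF act_dist[OF h] b0(1)])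
    have hs: "morse_pairs M (\<sigma> ` {0..})" unfolding \<sigma>_def by (rule morse_pairs_act[OF h \<beta>'(3)])
    obtain E where E: "near E (\<beta>' ` {0..}) ((\<lambda>t. \<phi> (inv h) (\<beta> t)) ` {0..})" "near E ((\<lambda>t. \<phi> (inv h) (\<beta> t)) ` {0..}) (\<beta>' ` {0..})"
      using x'(2)[OF \<beta>(1,2) \<beta>'(1,2)] unfolding finite_hausdorff_dist_iff_near by blast
    have sw: "dist (\<beta>' s) (\<phi> (inv h) (\<beta> t)) = dist (\<sigma> s) (\<beta> t)" for s t
      using act_dist[OF h, of "\<beta>' s" "\<phi> (inv h) (\<beta> t)"] act_inv(2)[OF h] unfolding \<sigma>_def by simp
    have "near E (\<sigma> ` {0..}) (\<beta> ` {0..})" "near E (\<beta> ` {0..}) (\<sigma> ` {0..})"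
      using E unfolding near_def by (auto simp: sw dist_commute[of "\<phi> _ _" "\<beta>' _"] dist_commute[of "\<beta> _" "\<sigma> _"])
    then have "finite_hausdorff_dist (\<beta> ` {0..}) (\<sigma> ` {0..})" unfolding finite_hausdorff_dist_iff_near by blast
    then have "morse_pairs (ideal_gauge M) (\<gamma> ` {0..dist (\<beta> 0) (\<sigma> 0)})"
      by (rule morse_pairs_ideal_triangle[OF b0(3) \<beta>(3) s hs]) (use b0 \<gamma> in \<open>simp add: \<sigma>_def\<close>)
    then show ?thesis using b0 unfolding \<sigma>_def by simp
  qed
  have "uniform_gauge (ideal_gauge M)"
    unfolding uniform_gauge_def
  proof (intro ballI allI impI)
    fix p q \<gamma> assume p: "p \<in> X" and q: "q \<in> X" and \<gamma>: "geodesic_segment p q \<gamma>"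
    obtain g h where g: "g \<in> carrier H" "p = \<phi> g \<oo>" "h \<in> carrier H" "q = \<phi> h \<oo>" using p q unfolding X_iff by blast
    let ?g = "inv g"
    have gp: "\<phi> ?g p = \<oo>" using g act_inv by simp
    obtain k where k: "k \<in> carrier H" "\<phi> ?g q = \<phi> k \<oo>" using act_X[of ?g q] g(1) q unfolding X_iff by auto
    have "geodesic_segment (\<phi> ?g p) (\<phi> ?g q) (\<lambda>t. \<phi> ?g (\<gamma> t))" by (rule geodesic_segment_isometry) (use g \<gamma> in auto)
    then have "morse_pairs (ideal_gauge M) ((\<lambda>t. \<phi> ?g (\<gamma> t)) ` {0..dist \<oo> (\<phi> k \<oo>)})" using base[OF k(1)] gp k(2) by simp
    moreover have "dist \<oo> (\<phi> k \<oo>) = dist p q" using gp k(2) act_dist[of ?g p q] g(1) by simp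
    ultimately have "morse_pairs (ideal_gauge M) ((\<lambda>t. \<phi> g (\<phi> ?g (\<gamma> t))) ` {0..dist p q})" using morse_pairs_act[OF g(1)] by simp
    then show "morse_pairs (ideal_gauge M) (\<gamma> ` {0..dist p q})" using act_inv(2)[OF g(1)] by simp
  qed
  then show thesis using that by blast
qed

section \<open>Quasiconvexity of the orbit, and escaping rays when it fails\<close>

definition quasiconvex :: "real \<Rightarrow> bool" where
  "quasiconvex R \<longleftrightarrow> (\<forall>p\<in>X. \<forall>q\<in>X. \<forall>\<gamma>. geodesic_segment p q \<gamma> \<longrightarrow> near R (\<gamma> ` {0..dist p q}) X)"

lemma not_quasiconvex:
  assumes M: "uniform_gauge M" and no: "\<And>R. \<not> quasiconvex R"
  obtains \<beta> c where "geodesic {0..} \<beta>" "\<beta> 0 = \<oo>" "morse_pairs (perturbed 1 M) (\<beta> ` {0..})" "ray_end \<oo> 0 \<beta> \<in> \<Lambda>"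
    "\<And>t y. t \<ge> 0 \<Longrightarrow> y \<in> X \<Longrightarrow> dist (\<beta> t) y \<ge> t - c"
proof -
  define D where "D = M 3 2"
  have "\<exists>a \<delta> s. a \<in> X \<and> geodesic_segment \<oo> a \<delta> \<and> s \<in> {0..dist \<oo> a} \<and> s \<ge> real k - D \<and> (\<forall>y\<in>X. dist (\<delta> s) y \<ge> s - (2 * D + 1))" for k :: nat
  proof -
    obtain p q \<gamma> t where p: "p \<in> X" "q \<in> X" "geodesic_segment p q \<gamma>" "t \<in> {0..dist p q}" "\<forall>y\<in>X. dist (\<gamma> t) y > real k"
      using no[of "real k"] unfolding quasiconvex_def near_def by force
    obtain y0 where y0: "y0 \<in> X" "\<forall>y\<in>X. dist (\<gamma> t) y0 \<le> dist (\<gamma> t) y + 1"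
      using approx_minimizer[of X "dist (\<gamma> t)" 1] base_in_X by auto
    obtain g where g: "g \<in> carrier H" "y0 = \<phi> g \<oo>" using y0(1) unfolding X_iff by blast
    define f where "f = \<phi> (inv g)"
    have fd: "dist (f u) (f v) = dist u v" for u v unfolding f_def using g(1) by simp
    have fX: "f u \<in> X" if "u \<in> X" for u unfolding f_def using act_X that g(1) by simp
    have fo: "f y0 = \<oo>" unfolding f_def using g act_inv by simp
    have gX: "\<phi> g u \<in> X" "f (\<phi> g u) = u" if "u \<in> X" for u unfolding f_def using act_X act_inv that g(1) by auto
    define x where "x = f (\<gamma> t)"
    have seg: "geodesic_segment (f p) (f q) (\<lambda>t. f (\<gamma> t))" by (rule geodesic_segment_isometry[OF fd p(3)])
    have x1: "dist x \<oo> > real k" using p(5) y0(1) fd[of "\<gamma> t" y0] fo unfolding x_def by auto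
    have x2: "dist x \<oo> \<le> dist x y + 1" if y: "y \<in> X" for y
      using y0(2) gX[OF y] fd[of "\<gamma> t" "\<phi> g y"] fd[of "\<gamma> t" y0] fo unfolding x_def by auto
    obtain g1 g2 where g12: "geodesic_segment (f p) \<oo> g1" "geodesic_segment (f q) \<oo> g2" using geodesic_space by blast
    have gd: "morse_pair M (f p) \<oo>" "morse_pair M (f q) \<oo>"
      using M fX[OF p(1)] fX[OF p(2)] base_in_X g12 morse_pairsD geodesic_segment_endpoints unfolding uniform_gauge_def by meson+
    have "near D ((\<lambda>t. f (\<gamma> t)) ` {0..dist (f p) (f q)}) (g1 ` {0..dist (f p) \<oo>} \<union> g2 ` {0..dist (f q) \<oo>})"
      unfolding D_def by (rule thin_triangle[OF gd seg g12])
    then obtain z where z: "z \<in> g1 ` {0..dist (f p) \<oo>} \<union> g2 ` {0..dist (f q) \<oo>}" "dist x z \<le> D"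
      using nearD[of D _ _ x] p(4) fd unfolding x_def by (metis imageI)
    have "\<exists>a \<delta>. a \<in> X \<and> geodesic_segment \<oo> a \<delta> \<and> z \<in> \<delta> ` {0..dist \<oo> a}"
      using z(1) geodesic_segment_reverse[OF g12(1)] geodesic_segment_reverse[OF g12(2)] fX[OF p(1)] fX[OF p(2)] by blast
    then obtain a \<delta> s where a: "a \<in> X" "geodesic_segment \<oo> a \<delta>" "s \<in> {0..dist \<oo> a}" "z = \<delta> s" by blast
    have so: "dist (\<delta> s) \<oo> = s" using geodesicD[OF geodesic_segmentD(1)[OF a(2)], of s 0] geodesic_segmentD(2)[OF a(2)] a(3) by auto
    have so: "dist z \<oo> = s" using so a(4) by simp
    have "s \<ge> real k - D" using so x1 z(2) by metric
    \<comment> \<open>The basepoint is an orbit point nearest to \<open>x\<close> up to 1. Replacing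
      \<open>x\<close> by the point \<open>z\<close> of the segment changes both distances in that
      comparison by at most \<open>D\<close>.\<close>
    moreover have "dist (\<delta> s) y \<ge> s - (2 * D + 1)" if "y \<in> X" for y
      unfolding a(4)[symmetric] using x2[OF that] so z(2) by metric
    ultimately show ?thesis using a by blast
  qed
  then obtain a \<delta> s where a: "\<And>k::nat. a k \<in> X" "\<And>k. geodesic_segment \<oo> (a k) (\<delta> k)" "\<And>k. s k \<in> {0..dist \<oo> (a k)}"
    "\<And>k. s k \<ge> real k - D" "\<And>k y. y \<in> X \<Longrightarrow> dist (\<delta> k (s k)) y \<ge> s k - (2 * D + 1)" by metis
  have sinf: "filterlim s at_top sequentially"
  proof (rule filterlim_at_top_mono)
    show "filterlim (\<lambda>k. - D + real k) at_top sequentially"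
      by (intro filterlim_tendsto_add_at_top[OF tendsto_const] filterlim_real_sequentially)
  qed (use a(4) in \<open>auto simp: algebra_simps\<close>)
  have inf: "filterlim (\<lambda>k. dist \<oo> (a k)) at_top sequentially"
    by (rule filterlim_at_top_mono[OF sinf]) (use a(3) in auto)
  have h: "morse_pairs M (\<delta> k ` {0..dist \<oo> (a k)})" for k using M a(1,2) base_in_X unfolding uniform_gauge_def by blast
  obtain \<rho> \<beta> where b: "strict_mono \<rho>" "geodesic {0..} \<beta>" "\<beta> 0 = \<oo>" "morse_pairs (perturbed 1 M) (\<beta> ` {0..})"
    "\<And>t. t \<ge> 0 \<Longrightarrow> (\<lambda>k. \<delta> (\<rho> k) t) \<longlonglongrightarrow> \<beta> t" "ray_end \<oo> 0 \<beta> \<in> limit_set \<oo> X"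
    by (rule segments_limit[of a X \<delta> M, OF a(1,2) h inf]) blast
  have "dist (\<beta> t) y \<ge> t - (2 * D + 1)" if t: "t \<ge> 0" and y: "y \<in> X" for t y
  proof (rule tendsto_lowerbound)
    show "(\<lambda>k. dist (\<delta> (\<rho> k) t) y) \<longlonglongrightarrow> dist (\<beta> t) y" by (intro tendsto_dist b(5) t tendsto_const)
    have "\<forall>\<^sub>F k in sequentially. t \<le> s k" using sinf unfolding filterlim_at_top by blast
    then have "\<forall>\<^sub>F k in sequentially. t \<le> s (\<rho> k)" by (rule eventually_subseq[OF b(1)])
    then show "\<forall>\<^sub>F k in sequentially. dist (\<delta> (\<rho> k) t) y \<ge> t - (2 * D + 1)"
    proof (rule eventually_mono)
      fix k assume k: "t \<le> s (\<rho> k)"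
      \<comment> \<open>Going back from \<open>s\<close> to \<open>t\<close> along the segment loses
        exactly \<open>s - t\<close>, so the lower bound at the escaping parameter \<open>s\<close>
        holds with the same constant at every earlier \<open>t\<close>, and hence in the
        limit.\<close>
      have "dist (\<delta> (\<rho> k) (s (\<rho> k))) (\<delta> (\<rho> k) t) = s (\<rho> k) - t"
        using geodesicD[OF geodesic_segmentD(1)[OF a(2)[of "\<rho> k"]], of "s (\<rho> k)" t] k t a(3)[of "\<rho> k"] by auto
      then show "dist (\<delta> (\<rho> k) t) y \<ge> t - (2 * D + 1)"
        using a(5)[OF y, of "\<rho> k"] by metric
    qed
  qed simp
  then show thesis using that[OF b(2,3,4)] b(6) unfolding \<Lambda>_def by blast
qed

end

section \<open>Conical limit points are horospherical\<close>

lemma finite_hausdorff_dist_subray: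
  assumes "geodesic {a..} \<alpha>" "a \<le> b"
  shows "finite_hausdorff_dist (\<alpha> ` {b..}) (\<alpha> ` {a..})"
  unfolding finite_hausdorff_dist_iff_near
proof (intro exI conjI)
  have "\<alpha> ` {b..} \<subseteq> \<alpha> ` {a..}" using assms(2) by (intro image_mono) auto
  then show "near (b - a) (\<alpha> ` {b..}) (\<alpha> ` {a..})" using assms(2) unfolding near_def
    by (intro ballI, rule_tac x = x in bexI) auto
  show "near (b - a) (\<alpha> ` {a..}) (\<alpha> ` {b..})" unfolding near_def
  proof
    fix x assume "x \<in> \<alpha> ` {a..}"
    then obtain t where t: "t \<ge> a" "x = \<alpha> t" by auto
    then have "dist x (\<alpha> (max b t)) \<le> b - a" using geodesicD[OF assms(1), of t "max b t"] assms(2) by auto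
    then show "\<exists>y\<in>\<alpha> ` {b..}. dist x y \<le> b - a" by auto
  qed
qed

lemma geodesic_subray: "geodesic {a..} \<alpha> \<Longrightarrow> a \<le> b \<Longrightarrow> geodesic {b..} \<alpha>"
  by (erule geodesic_sub) (auto simp: is_interval_ci)

context proper_geodesic_space
begin

text \<open>Elsewhere approximately nearest points suffice. Here the point of the segment nearest to
  \<open>\<alpha> t0\<close> is exact, which gives a (3,0)-quasi-geodesic with endpoints on \<alpha>; the bound must involve only
  values of the gauge that occur in \<^const>\<open>morse_delta\<close>.\<close>

lemma segment_to_ray_close:
  fixes \<alpha> f :: "real \<Rightarrow> 'x"
  assumes N: "morse_gauge N" and \<alpha>: "geodesic {a..} \<alpha>" "is_morse N (\<alpha> ` {a..})"
    and t0: "t0 \<ge> a" and f: "geodesic {b..n} f" "f b = y" "f n = \<alpha> n" and b: "b \<le> n" "b \<le> t0 + L" "t0 - L \<le> b" "t0 \<le> n"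
    and y: "dist y (\<alpha> t0) \<le> L" and s: "t0 + 3 * L \<le> s" "N 3 0 + 1 + s + 2 * L \<le> n"
  shows "dist (f s) (\<alpha> s) \<le> 2 * N 3 0"
proof (rule field_le_epsilon)
  fix e :: real assume e: "e > 0"
  \<comment> \<open>The bound 1 enters the comparison of \<open>s'\<close> with \<open>n\<close>;
    the bound \<open>e / 2\<close> is for the final estimate, where \<open>e'\<close> is counted
    twice.\<close>
  define e' where "e' = min 1 (e / 2)"
  have e': "e' > 0" "e' \<le> 1" "2 * e' \<le> e" using e unfolding e'_def by auto
  have N0: "N 3 0 \<ge> 0" using N unfolding morse_gauge_def by simp
  have L0: "L \<ge> 0" using y zero_le_dist order_trans by blast
  have "continuous_on {b..n} (\<lambda>u. dist (\<alpha> t0) (f u))"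
  proof (intro continuous_on_dist continuous_on_const)
    show "continuous_on {b..n} f" unfolding continuous_on_iff
      using geodesicD[OF f(1)] by (metis dist_real_def)
  qed
  then obtain u where u: "u \<in> {b..n}" "\<And>t. t \<in> {b..n} \<Longrightarrow> dist (\<alpha> t0) (f u) \<le> dist (\<alpha> t0) (f t)"
    using continuous_attains_inf[of "{b..n}" "\<lambda>u. dist (\<alpha> t0) (f u)"] b(1) by auto
  have "dist (\<alpha> t0) (f u) \<le> L" using u(2)[of b] b(1) f(2) y by (simp add: dist_commute)
  then have "dist (f b) (f u) \<le> 2 * L" using y f(2) dist_triangle[of y "f u" "\<alpha> t0"] by simp
  then have us: "u \<le> s" using geodesicD[OF f(1), of b u] u(1) b s by auto
  define h where "h t = f (- t)" for t
  \<comment> \<open>The segment is run backwards from \<open>\<alpha> n\<close>, left at its point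
    nearest to \<open>\<alpha> t0\<close> and joined to \<open>\<alpha> t0\<close>. Nearest is
    exact, so \<open>qg_path_concat\<close> applies with \<open>e = 0\<close> and gives constants
    \<open>(3, 0)\<close>.\<close>
  have q1: "qg_path 1 0 (- n) (- b) h (\<alpha> n) y"
    using qg_path_reverse[OF geodesic_qg_path[OF f(1) b(1)]] f unfolding h_def by simp
  obtain g where g: "geodesic_segment (h (- u)) (\<alpha> t0) g" using geodesic_space by blast
  have "qg_path (3 * 1) (0 + 2 * 0) (- n) (- u + dist (h (- u)) (\<alpha> t0)) (concat_at (- u) h g) (\<alpha> n) (\<alpha> t0)"
    by (rule qg_path_concat[OF q1 _ g]) (use u in \<open>auto simp: h_def\<close>)
  then have "concat_at (- u) h g ` {- n..- u + dist (h (- u)) (\<alpha> t0)} \<subseteq> closed_nbhd (N 3 0) (\<alpha> ` {a..})"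
    using \<alpha>(2) t0 b(4) unfolding is_morse_def qg_path_def by auto
  moreover have "concat_at (- u) h g (- s) = f s" using us unfolding concat_at_def h_def by simp
  moreover from s N0 L0 have sn: "s \<le> n" by linarith
  moreover have "- s \<in> {- n..- u + dist (h (- u)) (\<alpha> t0)}" unfolding atLeastAtMost_iff
    using us sn zero_le_dist[of "h (- u)" "\<alpha> t0"] by linarith
  ultimately have "f s \<in> closed_nbhd (N 3 0) (\<alpha> ` {a..})" by (metis image_eqI subsetD)
  then obtain s' where s': "s' \<ge> a" "dist (f s) (\<alpha> s') \<le> N 3 0 + e'" using closed_nbhdD[OF _ e'(1)] by blast
  have bs: "b \<le> s" using b s L0 by linarith
  have d1: "dist (f s) (\<alpha> n) = n - s" using geodesicD[OF f(1), of s n] f(3) bs sn by auto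
  have d2: "dist (f s) y = s - b" using geodesicD[OF f(1), of s b] f(2) bs sn by auto
  have d3: "dist (\<alpha> s') (\<alpha> t0) = \<bar>s' - t0\<bar>" "dist (\<alpha> s') (\<alpha> n) = \<bar>s' - n\<bar>"
    using geodesicD[OF \<alpha>(1)] s'(1) t0 b(4) by auto
  \<comment> \<open>This places \<open>s'\<close> before \<open>n\<close>. Only then do the
    distances to \<open>\<alpha> n\<close>, namely \<open>n - s\<close> and \<open>n - s'\<close>,
    compare \<open>s\<close> with \<open>s'\<close> without sign ambiguity.\<close>
  have "\<bar>s' - t0\<bar> \<le> N 3 0 + e' + (s - b) + L"
    using d2 d3(1) s'(2) y by metric
  then have s'n: "s' \<le> n" using s(2) b e' by linarith
  have "\<bar>s - s'\<bar> \<le> N 3 0 + e'"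
    using d1 d3(2) s'n s'(2) by metric
  moreover have "dist (\<alpha> s') (\<alpha> s) = \<bar>s' - s\<bar>" using geodesicD[OF \<alpha>(1), of s' s] s'(1) s(1) t0 L0 by auto
  ultimately show "dist (f s) (\<alpha> s) \<le> 2 * N 3 0 + e"
    using s'(2) e'(3) abs_minus_commute[of s s'] by metric
qed

text \<open>A ray from \<open>y\<close> is obtained as a limit of segments to points
  \<open>\<alpha> n\<close>, with parameters aligned at the far end. The alignment makes comparison
  at equal parameters possible, as \<open>rays_asymptotic\<close> demands, and the bound
  \<open>2 * N 3 0\<close> is below \<open>morse_delta N\<close>.\<close>

lemma asymptotic_ray_from:
  fixes \<alpha> :: "real \<Rightarrow> 'x"
  assumes N: "morse_gauge N" and \<alpha>: "geodesic {a..} \<alpha>" "is_morse N (\<alpha> ` {a..})"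
    and t0: "t0 \<ge> a" and y: "dist y (\<alpha> t0) \<le> L"
  obtains b \<beta> where "b \<ge> t0 - L" "geodesic {b..} \<beta>" "\<beta> b = y" "\<And>s. s \<ge> t0 + 3 * L \<Longrightarrow> dist (\<beta> s) (\<alpha> s) \<le> 2 * N 3 0"
proof -
  define n where "n k = t0 + real k" for k
  have n: "n k \<ge> t0" "n k \<ge> a" for k using t0 unfolding n_def by auto
  have L0: "L \<ge> 0" using y zero_le_dist order_trans by blast
  have "\<forall>k. \<exists>c. geodesic_segment y (\<alpha> (n k)) c" using geodesic_space by blast
  then obtain c where c: "\<And>k. geodesic_segment y (\<alpha> (n k)) (c k)" by metis
  note c' = geodesic_segmentD[OF c]
  define d where "d k = dist y (\<alpha> (n k))" for k
  \<comment> \<open>Starting parameter for which the segment from \<open>y\<close> reaches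
    \<open>\<alpha> (n k)\<close> at parameter \<open>n k\<close>. It stays within \<open>L\<close>
    of \<open>t0\<close>, so it converges along a subsequence; the limit is a value of a Busemann
    function of \<open>\<alpha>\<close> up to sign.\<close>
  define b where "b k = n k - d k" for k
  have d0: "d k \<ge> 0" for k unfolding d_def by simp
  have bb: "b k \<in> {t0 - L..t0 + L}" "b k \<le> n k" for k
  proof -
    have "dist (\<alpha> t0) (\<alpha> (n k)) = n k - t0" using geodesicD[OF \<alpha>(1), of t0 "n k"] t0 n[of k] by auto
    then show "b k \<in> {t0 - L..t0 + L}" "b k \<le> n k"
      using y d0[of k] dist_triangle[of y "\<alpha> (n k)" "\<alpha> t0"] dist_triangle[of "\<alpha> t0" "\<alpha> (n k)" y] dist_commute[of y "\<alpha> t0"]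
      unfolding b_def d_def by auto
  qed
  define f0 where "f0 k s = c k (s - b k)" for k s
  define f where "f k = clamp_seg (b k) (n k) (f0 k)" for k
  have f0: "geodesic {b k..n k} (f0 k)" "f0 k (b k) = y" "f0 k (n k) = \<alpha> (n k)" for k
  proof -
    show "geodesic {b k..n k} (f0 k)"
    proof (rule geodesic_iccI[OF bb(2)])
      fix s t assume "b k \<le> s" "s \<le> t" "t \<le> n k"
      then show "dist (f0 k s) (f0 k t) = t - s"
        using geodesicD[OF c'(1), of "s - b k" k "t - b k"] unfolding f0_def d_def[symmetric] b_def by auto
    qed
  qed (use c'(2,3) in \<open>auto simp: f0_def b_def d_def\<close>)
  have feq: "f k s = f0 k s" if "s \<in> {b k..n k}" for k s using clamp_seg_eq[OF that] unfolding f_def by blast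
  have lip: "dist (f k s) (f k t) \<le> \<bar>s - t\<bar>" for k s t unfolding f_def by (rule clamp_seg_lipschitz[OF f0(1)])
  have fb: "f k (b k) = y" for k using feq[of "b k" k] bb(2)[of k] f0(2) by auto
  have fd: "dist (f k s) (f k t) = \<bar>max (b k) (min (n k) s) - max (b k) (min (n k) t)\<bar>" for k s t
    unfolding f_def clamp_seg_def by (rule geodesicD[OF f0(1)]) (use bb(2)[of k] in auto)
  have "seq_compact {t0 - L..t0 + L}" using compact_imp_seq_compact[OF compact_Icc] .
  then obtain bl \<rho>1 where r1: "bl \<in> {t0 - L..t0 + L}" "strict_mono \<rho>1" "(b \<circ> \<rho>1) \<longlonglongrightarrow> bl" using bb(1) seq_compactE by metis
  have "dist y (f (\<rho>1 k) 0) \<le> \<bar>t0\<bar> + L" for k using lip[of "\<rho>1 k" "b (\<rho>1 k)" 0] fb bb(1)[of "\<rho>1 k"] by auto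
  then obtain \<rho>2 \<beta> where r2: "strict_mono \<rho>2" "\<And>t. (\<lambda>k. f (\<rho>1 (\<rho>2 k)) t) \<longlonglongrightarrow> \<beta> t"
    using arzela_ascoli_lipschitz[of "\<lambda>k. f (\<rho>1 k)" y, OF lip] by blast
  define \<rho> where "\<rho> k = \<rho>1 (\<rho>2 k)" for k
  have r: "strict_mono \<rho>" using strict_mono_o[OF r1(2) r2(1)] unfolding \<rho>_def o_def .
  have lim: "(\<lambda>k. f (\<rho> k) t) \<longlonglongrightarrow> \<beta> t" for t using r2(2) unfolding \<rho>_def .
  have blim: "(\<lambda>k. b (\<rho> k)) \<longlonglongrightarrow> bl" using LIMSEQ_subseq_LIMSEQ[OF r1(3) r2(1)] unfolding \<rho>_def o_def .
  have ev: "\<forall>\<^sub>F k in sequentially. s \<le> n (\<rho> k)" for s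
  proof -
    have "\<forall>\<^sub>F k in sequentially. s \<le> n k" using eventually_ge_at_top[of "nat \<lceil>s - t0\<rceil>"]
      by (rule eventually_mono) (unfold n_def, linarith)
    then show ?thesis by (rule eventually_subseq[OF r])
  qed
  have ylim: "\<beta> bl = y"
  proof -
    have "(\<lambda>k. \<bar>bl - b (\<rho> k)\<bar>) \<longlonglongrightarrow> \<bar>bl - bl\<bar>" by (intro tendsto_intros blim)
    then have hlim: "(\<lambda>k. \<bar>bl - b (\<rho> k)\<bar>) \<longlonglongrightarrow> 0" by simp
    have le: "dist (f (\<rho> k) bl) y \<le> \<bar>bl - b (\<rho> k)\<bar>" for k using lip[of "\<rho> k" bl "b (\<rho> k)"] fb by simp
    have "(\<lambda>k. dist (f (\<rho> k) bl) y) \<longlonglongrightarrow> 0"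
      by (rule tendsto_sandwich[OF _ _ tendsto_const hlim]) (use le in auto)
    then have "(\<lambda>k. f (\<rho> k) bl) \<longlonglongrightarrow> y" by (rule iffD2[OF tendsto_dist_iff])
    then show ?thesis by (rule LIMSEQ_unique[OF lim])
  qed
  have geo: "geodesic {bl..} \<beta>"
  proof (rule geodesic_iciI)
    fix s t assume st: "bl \<le> s" "s \<le> t"
    have "(\<lambda>k. \<bar>max (b (\<rho> k)) s - max (b (\<rho> k)) t\<bar>) \<longlonglongrightarrow> \<bar>max bl s - max bl t\<bar>" by (intro tendsto_intros blim)
    moreover have "\<forall>\<^sub>F k in sequentially. \<bar>max (b (\<rho> k)) s - max (b (\<rho> k)) t\<bar> = dist (f (\<rho> k) s) (f (\<rho> k) t)"
      using ev[of t] by (rule eventually_mono) (use st fd in auto)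
    ultimately have "(\<lambda>k. dist (f (\<rho> k) s) (f (\<rho> k) t)) \<longlonglongrightarrow> \<bar>max bl s - max bl t\<bar>" by (rule Lim_transform_eventually)
    then have "dist (\<beta> s) (\<beta> t) = \<bar>max bl s - max bl t\<bar>" by (rule LIMSEQ_unique[OF tendsto_dist[OF lim lim]])
    then show "dist (\<beta> s) (\<beta> t) = t - s" using st by auto
  qed
  have "dist (\<beta> s) (\<alpha> s) \<le> 2 * N 3 0" if s: "s \<ge> t0 + 3 * L" for s
  proof (rule tendsto_upperbound[OF tendsto_dist[OF lim tendsto_const]])
    show "\<forall>\<^sub>F k in sequentially. dist (f (\<rho> k) s) (\<alpha> s) \<le> 2 * N 3 0"
      using ev[of "N 3 0 + 1 + s + 2 * L"]
    proof (rule eventually_mono)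
      fix k assume k: "N 3 0 + 1 + s + 2 * L \<le> n (\<rho> k)"
      have N0: "N 3 0 \<ge> 0" using N unfolding morse_gauge_def by simp
      have "f (\<rho> k) s = f0 (\<rho> k) s" by (rule feq) (use bb[of "\<rho> k"] s k N0 L0 in auto)
      then show "dist (f (\<rho> k) s) (\<alpha> s) \<le> 2 * N 3 0"
        using segment_to_ray_close[OF N \<alpha> t0 f0, where L = L and s = s] bb[of "\<rho> k"] n y s k by auto
    qed
  qed simp
  then show thesis using that[OF _ geo ylim] r1(1) by auto
qed

text \<open>A segment is bounded, so it has a gauge depending on its length. This is enough for
  horospherical limit points, where the gauge is chosen after the ray.\<close>

lemma point_in_stratum: "\<exists>N. morse_gauge N \<and> (y::'x) \<in> stratum \<oo> N"
proof -
  obtain \<gamma> where g: "geodesic_segment \<oo> y \<gamma>" using geodesic_space by blast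
  note g' = geodesic_segmentD[OF g]
  have "dist p q \<le> dist \<oo> y" if "p \<in> \<gamma> ` {0..dist \<oo> y}" "q \<in> \<gamma> ` {0..dist \<oo> y}" for p q
    using that geodesicD[OF g'(1)] by auto
  then have "morse_pairs (pos_gauge (\<lambda>K C. K * (K * (dist \<oo> y + C)) + C)) (\<gamma> ` {0..dist \<oo> y})"
    by (intro morse_pairs_pos_gauge bounded_morse_pairs)
  then show ?thesis using morse_pairs_imp_is_morse[OF g'(1)] morse_gauge_pos_gauge g unfolding stratum_def by blast
qed

lemma conical_imp_horospherical:
  assumes c: "conical_limit_point \<oo> A x"
  shows "horospherical_limit_point \<oo> A x"
  unfolding horospherical_limit_point_def
proof (intro conjI allI impI)
  show "x \<in> morse_boundary \<oo>" using c unfolding conical_limit_point_def by blast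
  obtain K where K: "K > 0" "\<And>a \<alpha>. morse_ray a \<alpha> \<Longrightarrow> ray_end \<oo> a \<alpha> = x \<Longrightarrow> closed_nbhd K (\<alpha> ` {a..}) \<inter> A \<noteq> {}"
    using c unfolding conical_limit_point_def by blast
  fix N' a \<alpha> assume "morse_gauge N' \<and> geodesic {a..} \<alpha> \<and> is_morse N' (\<alpha> ` {a..}) \<and> ray_end \<oo> a \<alpha> = x"
  then have N: "morse_gauge N'" and \<alpha>: "geodesic {a..} \<alpha>" "is_morse N' (\<alpha> ` {a..})" "ray_end \<oo> a \<alpha> = x" by auto
  \<comment> \<open>Conicality is applied to a subray. The ray found from the orbit point near it
    starts at a parameter at least \<open>T - (K + 1) = a + 1\<close>, hence inside the horoball of
    the original ray.\<close>
  define T where "T = a + K + 2"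
  have T: "T \<ge> a" using K(1) unfolding T_def by simp
  have "morse_pairs (pair_gauge 1 0 N') (\<alpha> ` {T..})"
    by (rule morse_pairs_subset[OF is_morse_imp_morse_pairs[OF N geodesic_is_quasi_geodesic[OF \<alpha>(1)] \<alpha>(2)]]) (use T in auto)
  then have "morse_ray T \<alpha>" using geodesic_subray[OF \<alpha>(1) T] unfolding morse_ray_iff_morse_pairs by blast
  moreover have "ray_end \<oo> T \<alpha> = x" using ray_end_eqI[OF finite_hausdorff_dist_subray[OF \<alpha>(1) T]] \<alpha>(3) by blast
  ultimately obtain y where y: "y \<in> A" "y \<in> closed_nbhd K (\<alpha> ` {T..})" using K(2) by blast
  then obtain t0 where t0: "t0 \<ge> T" "dist y (\<alpha> t0) \<le> K + 1" using closed_nbhdD[of y K _ 1] by auto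
  have t0a: "t0 \<ge> a" using t0 T by simp
  obtain b \<beta> where b: "b \<ge> t0 - (K + 1)" "geodesic {b..} \<beta>" "\<beta> b = y" "\<And>s. s \<ge> t0 + 3 * (K + 1) \<Longrightarrow> dist (\<beta> s) (\<alpha> s) \<le> 2 * N' 3 0"
    by (rule asymptotic_ray_from[OF N \<alpha>(1,2) t0a t0(2)]) blast
  have ba: "b \<ge> a" using b(1) t0(1) unfolding T_def by simp
  have pos: "N' 3 0 \<ge> 0" "N' 5 0 \<ge> 0" using N unfolding morse_gauge_def by auto
  then have "2 * N' 3 0 \<le> morse_delta N'" unfolding morse_delta_def by simp
  then have "rays_asymptotic (morse_delta N') b \<beta> a \<alpha>"
    unfolding rays_asymptotic_def using b(4)
    by (intro exI[of _ "max (max b a) (t0 + 3 * (K + 1))"]) force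
  moreover obtain N where "morse_gauge N" "y \<in> stratum \<oo> N" using point_in_stratum by blast
  ultimately have "y \<in> morse_horoball \<oo> N N' a \<alpha>" using b ba unfolding morse_horoball_def by blast
  then show "\<exists>N. morse_gauge N \<and> morse_horoball \<oo> N N' a \<alpha> \<inter> A \<noteq> {}" using \<open>morse_gauge N\<close> y(1) by blast
qed

end

context proper_orbit
begin

lemma horospherical_imp_quasiconvex:
  assumes M: "uniform_gauge M" and h: "\<And>x. x \<in> \<Lambda> \<Longrightarrow> horospherical_limit_point \<oo> X x"
  shows "\<exists>R. quasiconvex R"
proof (rule ccontr)
  assume "\<nexists>R. quasiconvex R"
  then obtain \<beta> c where b: "geodesic {0..} \<beta>" "\<beta> 0 = \<oo>" "morse_pairs (perturbed 1 M) (\<beta> ` {0..})" "ray_end \<oo> 0 \<beta> \<in> \<Lambda>"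
    "\<And>t y. t \<ge> 0 \<Longrightarrow> y \<in> X \<Longrightarrow> dist (\<beta> t) y \<ge> t - c" using not_quasiconvex[OF M] by blast
  define N where "N = pos_gauge (perturbed 1 M)"
  \<comment> \<open>A horoball point \<open>y\<close> lies on a ray starting at or after parameter
    \<open>a\<close>, so far out its distance from \<open>\<beta> T\<close> is at most
    \<open>morse_delta N + (T - a)\<close>. The escaping ray has distance at least
    \<open>T - c\<close> from the orbit, which is impossible once \<open>a\<close> exceeds
    \<open>c + morse_delta N\<close>.\<close>
  define a where "a = max 0 (c + morse_delta N + 1)"
  have a: "a \<ge> 0" unfolding a_def by simp
  have ga: "geodesic {a..} \<beta>" by (rule geodesic_subray[OF b(1) a])
  have "morse_pairs N (\<beta> ` {a..})" unfolding N_def by (rule morse_pairs_pos_gauge[OF morse_pairs_subset[OF b(3)]]) (use a in auto)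
  then have "is_morse N (\<beta> ` {a..})" by (rule morse_pairs_imp_is_morse[OF ga])
  moreover have "morse_gauge N" unfolding N_def by (rule morse_gauge_pos_gauge)
  moreover have "ray_end \<oo> a \<beta> = ray_end \<oo> 0 \<beta>" by (rule ray_end_eqI[OF finite_hausdorff_dist_subray[OF b(1) a]])
  ultimately obtain N' where "morse_horoball \<oo> N' N a \<beta> \<inter> X \<noteq> {}"
    using h[OF b(4)] ga unfolding horospherical_limit_point_def by blast
  then obtain y bb \<beta>' where y: "y \<in> X" "geodesic {bb..} \<beta>'" "rays_asymptotic (morse_delta N) bb \<beta>' a \<beta>" "bb \<ge> a" "\<beta>' bb = y"
    unfolding morse_horoball_def by auto
  obtain T where T: "T \<ge> max bb a" "dist (\<beta>' T) (\<beta> T) \<le> morse_delta N" using y(3) unfolding rays_asymptotic_def by auto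
  have "dist (\<beta>' T) y = T - bb" using geodesicD[OF y(2), of T bb] T(1) y(5) by auto
  then have "dist (\<beta> T) y \<le> morse_delta N + (T - a)"
    using T(2) y(4) by metric
  moreover have "dist (\<beta> T) y \<ge> T - c" by (rule b(5)[OF _ y(1)]) (use T a in auto)
  ultimately show False unfolding a_def by linarith
qed

end

section \<open>Lines in the weak convex hull\<close>

text \<open>Segments and rays have an endpoint in the space and drop out, leaving the lines.\<close>

lemma weak_convex_hull_boundary_iff:
  "x \<in> weak_convex_hull \<oo> (Inr ` L) \<longleftrightarrow> (\<exists>\<gamma>. geodesic UNIV \<gamma> \<and> morse_ray 0 \<gamma> \<and> ray_end \<oo> 0 \<gamma> \<in> L \<and>
     morse_ray 0 (\<lambda>t. \<gamma> (- t)) \<and> ray_end \<oo> 0 (\<lambda>t. \<gamma> (- t)) \<in> L \<and> x \<in> range \<gamma>)"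
proof -
  have no: "Inl z \<notin> Inr ` L" for z :: 'a by auto
  have mem: "Inr e \<in> Inr ` L \<longleftrightarrow> e \<in> L" for e by auto
  show ?thesis unfolding weak_convex_hull_def mem using no by (simp only: simp_thms Un_iff Union_iff mem_Collect_eq) blast
qed

text \<open>A point at parameter \<open>D + 1\<close> has distance more than \<open>D\<close> from
  the whole opposite half-line. Membership in the boundary provides a Morse ray through which equal
  classes translate into finite Hausdorff distance.\<close>

lemma line_ends_distinct:
  fixes \<gamma> :: "real \<Rightarrow> 'x::metric_space"
  assumes g: "geodesic UNIV \<gamma>" and e: "ray_end \<oo> 0 \<gamma> \<in> morse_boundary \<oo>"
  shows "ray_end \<oo> 0 \<gamma> \<noteq> ray_end \<oo> 0 (\<lambda>t. \<gamma> (- t))"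
proof
  assume eq: "ray_end \<oo> 0 \<gamma> = ray_end \<oo> 0 (\<lambda>t. \<gamma> (- t))"
  obtain \<beta> where \<beta>: "\<beta> \<in> morse_rays_from \<oo>" "ray_end \<oo> 0 \<beta> = ray_end \<oo> 0 \<gamma>" using ray_end_repr[OF e] .
  have "finite_hausdorff_dist (\<beta> ` {0..}) (\<gamma> ` {0..})" "finite_hausdorff_dist (\<beta> ` {0..}) ((\<lambda>t. \<gamma> (- t)) ` {0..})"
    using ray_end_eqD[OF \<beta>(1)] \<beta>(2) eq by auto
  then have "finite_hausdorff_dist (\<gamma> ` {0..}) ((\<lambda>t. \<gamma> (- t)) ` {0..})"
    using finite_hausdorff_dist_trans finite_hausdorff_dist_sym by blast
  then obtain D where D: "near D (\<gamma> ` {0..}) ((\<lambda>t. \<gamma> (- t)) ` {0..})" unfolding finite_hausdorff_dist_iff_near by blast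
  have D0: "D \<ge> 0" using near_nonneg[OF D] by auto
  then obtain s where s: "s \<ge> 0" "dist (\<gamma> (D + 1)) (\<gamma> (- s)) \<le> D" using nearD[OF D, of "\<gamma> (D + 1)"] by auto
  then show False using geodesicD[OF g, of "D + 1" "- s"] D0 by simp
qed

lemma line_reverse: "geodesic UNIV \<gamma> \<Longrightarrow> geodesic UNIV (\<lambda>t. \<gamma> (- t))"
  unfolding geodesic_def by (auto simp: abs_minus_commute)

lemma line_half: "geodesic UNIV \<gamma> \<Longrightarrow> geodesic {0..} \<gamma>"
  by (erule geodesic_sub) (auto simp: is_interval_ci)

lemma (in proper_geodesic_space) choose_segments: "\<exists>\<gamma>. \<forall>k. geodesic_segment (a k :: 'x) (b k) (\<gamma> k)"
  by (rule choice) (use geodesic_space in blast)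

context proper_orbit
begin

text \<open>Used for each half of a limit line. Segments that start near the basepoint and end in
  the orbit fellow travel the segments from the basepoint itself, so their limits are Morse and end
  in the limit set.\<close>

lemma half_line_limit:
  fixes l :: "nat \<Rightarrow> real \<Rightarrow> 'x"
  assumes M: "uniform_gauge M" and l: "\<And>k. geodesic {0..B k} (l k)" "\<And>k. B k \<ge> 0" "filterlim B at_top sequentially"
    and r: "\<And>k. dist (l k 0) \<oo> \<le> r" and X: "\<And>k. l k (B k) \<in> X" "\<And>k. geodesic_segment \<oo> (l k (B k)) (\<gamma> k)"
    and g: "geodesic {0..} g" "\<And>t. t \<ge> 0 \<Longrightarrow> (\<lambda>k. l k t) \<longlonglongrightarrow> g t"
  obtains \<rho> \<beta> where "strict_mono \<rho>" "\<beta> \<in> morse_rays_from \<oo>" "\<And>t. t \<ge> 0 \<Longrightarrow> (\<lambda>k. \<gamma> (\<rho> k) t) \<longlonglongrightarrow> \<beta> t"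
    "ray_end \<oo> 0 \<beta> \<in> \<Lambda>" "ray_end \<oo> 0 g = ray_end \<oo> 0 \<beta>" "morse_ray 0 g"
proof -
  define D where "D = M 1 (2 * r + 2)"
  have r0: "r \<ge> 0" using r[of 0] zero_le_dist order_trans by blast
  note \<gamma>' = geodesic_segmentD[OF X(2)]
  have h: "morse_pairs M (\<gamma> k ` {0..dist \<oo> (l k (B k))})" for k using M X base_in_X unfolding uniform_gauge_def by blast
  have dB: "dist \<oo> (l k (B k)) \<ge> B k - r" for k
    using geodesicD[OF l(1), of 0 k "B k"] l(2)[of k] r[of k] dist_triangle[of "l k 0" "l k (B k)" \<oo>] by auto
  have inf: "filterlim (\<lambda>k. dist \<oo> (l k (B k))) at_top sequentially"
    by (rule filterlim_at_top_mono[OF filterlim_tendsto_add_at_top[OF tendsto_const[of "- r"] l(3)]]) (use dB in \<open>auto simp: algebra_simps\<close>)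
  have near: "near D (l k ` {0..B k}) (\<gamma> k ` {0..dist \<oo> (l k (B k))})" for k
    unfolding D_def
    by (rule segment_near[OF \<gamma>'(1) h geodesic_segment_endpoints[OF X(2)] l(1)]) (use l(2) r r0 in auto)
  obtain \<rho> \<beta> where b: "strict_mono \<rho>" "geodesic {0..} \<beta>" "\<beta> 0 = \<oo>" "morse_pairs (perturbed 1 M) (\<beta> ` {0..})"
    "\<And>t. t \<ge> 0 \<Longrightarrow> (\<lambda>k. \<gamma> (\<rho> k) t) \<longlonglongrightarrow> \<beta> t" "ray_end \<oo> 0 \<beta> \<in> limit_set \<oo> X"
    by (rule segments_limit[of "\<lambda>k. l k (B k)" X \<gamma> M, OF X h inf]) blast
  have close: "dist (g t) (\<beta> t) \<le> 2 * D + r" if t: "t \<in> {0..}" for t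
  proof (rule tendsto_upperbound)
    have "(\<lambda>k. l (\<rho> k) t) \<longlonglongrightarrow> g t" using LIMSEQ_subseq_LIMSEQ[OF g(2) b(1)] t unfolding o_def by auto
    then show "(\<lambda>k. dist (l (\<rho> k) t) (\<gamma> (\<rho> k) t)) \<longlonglongrightarrow> dist (g t) (\<beta> t)" using tendsto_dist b(5)[of t] t by auto
    have "\<forall>\<^sub>F k in sequentially. t + r \<le> B k" using l(3) unfolding filterlim_at_top by blast
    then have "\<forall>\<^sub>F k in sequentially. t + r \<le> B (\<rho> k)" by (rule eventually_subseq[OF b(1)])
    then show "\<forall>\<^sub>F k in sequentially. dist (l (\<rho> k) t) (\<gamma> (\<rho> k) t) \<le> 2 * D + r"
    proof (rule eventually_mono)
      fix k assume k: "t + r \<le> B (\<rho> k)"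
      have tB: "t \<in> {0..B (\<rho> k)}" "t \<in> {0..dist \<oo> (l (\<rho> k) (B (\<rho> k)))}" using k r0 t dB[of "\<rho> k"] by auto
      show "dist (l (\<rho> k) t) (\<gamma> (\<rho> k) t) \<le> 2 * D + r"
        by (rule fellow_travel[OF l(1) \<gamma>'(1) near_subset[OF near]])
           (use tB t \<gamma>'(2) r in auto)
    qed
  qed simp
  have "ray_end \<oo> 0 g = ray_end \<oo> 0 \<beta>" using close by (intro ray_end_eqI finite_hausdorff_dist_pointwise)
  moreover have "morse_pairs (perturbed (2 * D + r) (perturbed 1 M)) (g ` {0..})" by (rule morse_pairs_pointwise[OF b(4) close])
  then have "morse_ray 0 g" using g(1) unfolding morse_ray_iff_morse_pairs by blast
  moreover have "\<beta> \<in> morse_rays_from \<oo>" using b unfolding morse_rays_from_iff by blast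
  ultimately show thesis using that[OF b(1) _ b(5)] b(6) unfolding \<Lambda>_def by blast
qed

text \<open>Passing within \<open>r\<close> of the basepoint prevents the segments from escaping,
  and distant endpoints make both halves infinitely long in the limit.\<close>

lemma line_limit:
  assumes M: "uniform_gauge M" and X: "\<And>k::nat. a k \<in> X" "\<And>k. b k \<in> X" and c: "\<And>k. geodesic_segment (a k) (b k) (c k)"
    and u: "\<And>k. u k \<in> {0..dist (a k) (b k)}" "\<And>k. dist (c k (u k)) \<oo> \<le> r"
    and inf: "\<And>k. dist \<oo> (a k) \<ge> real k" "\<And>k. dist \<oo> (b k) \<ge> real k" and \<gamma>: "\<And>k. geodesic_segment \<oo> (b k) (\<gamma> k)"
  obtains l \<rho> \<beta> where "geodesic UNIV l" "range l \<subseteq> weak_convex_hull \<oo> (Inr ` \<Lambda>)" "morse_ray 0 l"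
    "strict_mono \<rho>" "\<beta> \<in> morse_rays_from \<oo>" "\<And>t. t \<ge> 0 \<Longrightarrow> (\<lambda>k. \<gamma> (\<rho> k) t) \<longlonglongrightarrow> \<beta> t" "ray_end \<oo> 0 l = ray_end \<oo> 0 \<beta>"
proof -
  note c' = geodesic_segmentD[OF c]
  define d where "d k = dist (a k) (b k)" for k
  \<comment> \<open>Parameter 0 is moved to the point near the basepoint, as Arzela-Ascoli
    requires.\<close>
  define f where "f k t = clamp_seg 0 (d k) (c k) (u k + t)" for k t
  have u': "u k \<in> {0..d k}" for k using u(1) unfolding d_def .
  have lip: "dist (f k s) (f k t) \<le> \<bar>s - t\<bar>" for k s t
    using clamp_seg_lipschitz[OF c'(1)[of k], of "u k + s" "u k + t"] unfolding f_def d_def by simp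
  have feq: "f k t = c k (u k + t)" if "u k + t \<in> {0..d k}" for k t unfolding f_def by (rule clamp_seg_eq[OF that])
  have f0: "dist \<oo> (f k 0) \<le> r" for k using feq[of k 0] u'[of k] u(2)[of k] by (simp add: dist_commute)
  obtain \<rho> l where l: "strict_mono \<rho>" "\<And>t. (\<lambda>k. f (\<rho> k) t) \<longlonglongrightarrow> l t"
    using arzela_ascoli_lipschitz[of f \<oo> r, OF lip f0] by blast
  have geo: "dist (f k s) (f k t) = \<bar>s - t\<bar>" if "u k + s \<in> {0..d k}" "u k + t \<in> {0..d k}" for k s t
    using geodesicD[OF c'(1), of "u k + s" k "u k + t"] that feq unfolding d_def[symmetric] by auto
  have ul: "u k \<ge> real k - r" "d k - u k \<ge> real k - r" for k
  proof -
    have "dist (c k 0) (c k (u k)) = u k" "dist (c k (u k)) (c k (d k)) = d k - u k"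
      using geodesicD[OF c'(1)[of k], of 0 "u k"] geodesicD[OF c'(1)[of k], of "u k" "d k"] u'[of k] unfolding d_def by auto
    then show "u k \<ge> real k - r" "d k - u k \<ge> real k - r"
      using inf[of k] u(2)[of k] c'(2,3)[of k] dist_triangle[of \<oo> "a k" "c k (u k)"] dist_triangle[of \<oo> "b k" "c k (u k)"]
        dist_commute[of \<oo> "c k (u k)"] dist_commute[of "a k" "c k (u k)"] unfolding d_def by auto
  qed
  have tends: "filterlim g at_top sequentially" if "\<And>k. g k \<ge> real k - r" for g :: "nat \<Rightarrow> real"
    by (rule filterlim_at_top_mono[OF filterlim_tendsto_add_at_top[OF tendsto_const[of "- r"] filterlim_real_sequentially]])
       (use that in \<open>auto simp: algebra_simps\<close>)
  have rk: "real (\<rho> k) \<ge> real k" for k using seq_suble[OF l(1), of k] by simp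
  have linf: "filterlim (\<lambda>k. d (\<rho> k) - u (\<rho> k)) at_top sequentially" "filterlim (\<lambda>k. u (\<rho> k)) at_top sequentially"
    by (rule tends; use ul rk in \<open>meson diff_right_mono order_trans\<close>)+
  have line: "geodesic UNIV l"
  proof -
    have "dist (l s) (l t) = \<bar>s - t\<bar>" for s t
    proof (rule geodesic_limit[OF l(2) l(2)])
      have "\<forall>\<^sub>F k in sequentially. \<bar>s\<bar> + \<bar>t\<bar> \<le> d (\<rho> k) - u (\<rho> k) \<and> \<bar>s\<bar> + \<bar>t\<bar> \<le> u (\<rho> k)"
        using linf unfolding filterlim_at_top by (simp add: eventually_conj)
      then show "\<forall>\<^sub>F k in sequentially. dist (f (\<rho> k) s) (f (\<rho> k) t) = \<bar>s - t\<bar>"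
        by (rule eventually_mono) (rule geo, auto)
    qed
    then show ?thesis unfolding geodesic_def by simp
  qed
  have fB: "f k (d k - u k) = b k" "f k (- u k) = a k" for k
    using feq[of k "d k - u k"] feq[of k "- u k"] u'[of k] c'(2,3)[of k] unfolding d_def by auto
  obtain \<gamma>' where \<gamma>': "\<And>k. geodesic_segment \<oo> (a k) (\<gamma>' k)" using choose_segments[of "\<lambda>_. \<oo>" a] by blast
  have f0': "dist (f (\<rho> k) 0) \<oo> \<le> r" for k using f0[of "\<rho> k"] by (simp add: dist_commute)
  obtain \<rho>' \<beta> where 1: "strict_mono \<rho>'" "\<beta> \<in> morse_rays_from \<oo>" "\<And>t. t \<ge> 0 \<Longrightarrow> (\<lambda>k. \<gamma> (\<rho> (\<rho>' k)) t) \<longlonglongrightarrow> \<beta> t"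
    "ray_end \<oo> 0 \<beta> \<in> \<Lambda>" "ray_end \<oo> 0 l = ray_end \<oo> 0 \<beta>" "morse_ray 0 l"
  proof (rule half_line_limit[OF M, of "\<lambda>k. d (\<rho> k) - u (\<rho> k)" "\<lambda>k. f (\<rho> k)" r "\<lambda>k. \<gamma> (\<rho> k)" l])
    show "geodesic {0..d (\<rho> k) - u (\<rho> k)} (f (\<rho> k))" for k
      by (rule geodesic_iccI) (use u'[of "\<rho> k"] geo[of "\<rho> k"] in auto)
  qed (use u' linf f0' fB X \<gamma> line_half[OF line] l(2) in auto)
  obtain \<rho>'' \<beta>'' where 2: "ray_end \<oo> 0 \<beta>'' \<in> \<Lambda>" "ray_end \<oo> 0 (\<lambda>t. l (- t)) = ray_end \<oo> 0 \<beta>''" "morse_ray 0 (\<lambda>t. l (- t))"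
  proof (rule half_line_limit[OF M, of "\<lambda>k. u (\<rho> k)" "\<lambda>k t. f (\<rho> k) (- t)" r "\<lambda>k. \<gamma>' (\<rho> k)" "\<lambda>t. l (- t)"])
    show "geodesic {0..u (\<rho> k)} (\<lambda>t. f (\<rho> k) (- t))" for k
      by (rule geodesic_iccI) (use u'[of "\<rho> k"] geo[of "\<rho> k"] in auto)
  qed (use u' linf f0' fB X \<gamma>' line_half[OF line_reverse[OF line]] l(2) in auto)
  have "range l \<subseteq> weak_convex_hull \<oo> (Inr ` \<Lambda>)"
    unfolding weak_convex_hull_boundary_iff subset_iff using line 1 2 by auto
  moreover have "strict_mono (\<lambda>k. \<rho> (\<rho>' k))" using strict_mono_o[OF l(1) 1(1)] unfolding o_def .
  ultimately show thesis using that[OF line _ 1(6) _ 1(2,3,5)] by blast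
qed

text \<open>Segments between orbit points converging to distinct limit points pass boundedly close to the
  basepoint; otherwise the two rays would fellow travel for ever.\<close>

lemma line_to_limit_point:
  assumes M: "uniform_gauge M" and x: "\<xi> \<in> \<Lambda>" "\<eta> \<in> \<Lambda>" "\<xi> \<noteq> \<eta>"
  obtains l where "geodesic UNIV l" "range l \<subseteq> weak_convex_hull \<oo> (Inr ` \<Lambda>)" "ray_end \<oo> 0 l = \<xi>"
proof -
  define D where "D = M 3 2"
  obtain \<beta>1 where b1: "\<beta>1 \<in> morse_rays_from \<oo>" "ray_end \<oo> 0 \<beta>1 = \<xi>" "coarse_limit X 1 \<beta>1"
    by (rule limit_set_coarse[OF x(1)[unfolded \<Lambda>_def]]) blast
  obtain \<beta>2 where b2: "\<beta>2 \<in> morse_rays_from \<oo>" "ray_end \<oo> 0 \<beta>2 = \<eta>" "coarse_limit X 1 \<beta>2"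
    by (rule limit_set_coarse[OF x(2)[unfolded \<Lambda>_def]]) blast
  \<comment> \<open>\<open>4 * D + 2\<close> is what fellow travelling would allow at
    \<open>s0\<close>: \<open>2 * D\<close> to each of the two segments and 1 from each segment to
    its ray.\<close>
  have "\<exists>s0\<ge>0. dist (\<beta>1 s0) (\<beta>2 s0) > 4 * D + 2"
  proof (rule ccontr)
    assume "\<not> ?thesis"
    then have "ray_end \<oo> 0 \<beta>1 = ray_end \<oo> 0 \<beta>2" 
      by (intro ray_end_eqI finite_hausdorff_dist_pointwise[where D = "4 * D + 2"]) (auto simp: not_less)
    then show False using x b1 b2 by simp
  qed
  then obtain s0 where s0: "s0 \<ge> 0" "dist (\<beta>1 s0) (\<beta>2 s0) > 4 * D + 2" by blast
  define T where "T k = max (real k) s0" for k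
  have T: "T k \<ge> 0" "T k \<ge> real k" "T k \<ge> s0" for k using s0 unfolding T_def by auto
  have ex: "\<exists>b \<gamma>. b \<in> X \<and> geodesic_segment \<oo> b \<gamma> \<and> T k \<le> dist \<oo> b \<and> (\<forall>t\<in>{0..T k}. dist (\<gamma> t) (\<beta> t) \<le> 1)"
    if "coarse_limit X 1 \<beta>" for \<beta> k using that T(1)[of k] unfolding coarse_limit_def by blast
  obtain b \<gamma> where b: "\<And>k::nat. b k \<in> X" "\<And>k. geodesic_segment \<oo> (b k) (\<gamma> k)" "\<And>k. T k \<le> dist \<oo> (b k)"
    "\<And>k t. t \<in> {0..T k} \<Longrightarrow> dist (\<gamma> k t) (\<beta>1 t) \<le> 1" using ex[OF b1(3)] by metis
  obtain a \<gamma>' where a: "\<And>k::nat. a k \<in> X" "\<And>k. geodesic_segment \<oo> (a k) (\<gamma>' k)" "\<And>k. T k \<le> dist \<oo> (a k)"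
    "\<And>k t. t \<in> {0..T k} \<Longrightarrow> dist (\<gamma>' k t) (\<beta>2 t) \<le> 1" using ex[OF b2(3)] by metis
  obtain c where c: "\<And>k. geodesic_segment (a k) (b k) (c k)" using choose_segments by blast
  have "\<exists>u\<in>{0..dist (a k) (b k)}. dist (c k u) \<oo> \<le> s0" for k
  proof -
    note ga = geodesic_segment_reverse[OF a(2)[of k]] and gb = geodesic_segment_reverse[OF b(2)[of k]]
    have gd: "morse_pair M (a k) \<oo>" "morse_pair M (b k) \<oo>"
      using M a(1) b(1) base_in_X ga(1) gb(1) morse_pairsD geodesic_segment_endpoints unfolding uniform_gauge_def by meson+
    obtain u f where u: "u \<in> {0..dist (a k) (b k)}" "geodesic_segment (c k u) \<oo> f"
      "near D (c k ` {0..u} \<union> f ` {0..dist (c k u) \<oo>}) ((\<lambda>t. \<gamma>' k (dist \<oo> (a k) - t)) ` {0..dist (a k) \<oo>})"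
      "near D (c k ` {u..dist (a k) (b k)} \<union> f ` {0..dist (c k u) \<oo>}) ((\<lambda>t. \<gamma> k (dist \<oo> (b k) - t)) ` {0..dist (b k) \<oo>})"
      unfolding D_def by (rule triangle_center[OF gd c ga(1) gb(1)]) blast
    have "dist (c k u) \<oo> \<le> s0"
    proof (rule ccontr)
      assume "\<not> ?thesis"
      then have e: "dist (c k u) \<oo> > s0" by simp
      note f' = geodesic_segmentD[OF u(2)]
      \<comment> \<open>If the centre is farther than \<open>s0\<close> from the basepoint, the
        segment \<open>f\<close> has a point at distance exactly \<open>s0\<close>. It is near both
        sides of the triangle, hence near both at parameter \<open>s0\<close>.\<close>
      define z where "z = f (dist (c k u) \<oo> - s0)"
      have zf: "z \<in> f ` {0..dist (c k u) \<oo>}" using e s0 unfolding z_def by auto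
      have z0: "dist z \<oo> = s0" using geodesicD[OF f'(1), of "dist (c k u) \<oo> - s0" "dist (c k u) \<oo>"] f'(3) e s0 unfolding z_def by auto
      have *: "dist z (\<delta> s0) \<le> 2 * D" if d: "geodesic_segment \<oo> p \<delta>" "\<exists>y\<in>\<delta> ` {0..dist \<oo> p}. dist z y \<le> D" "T k \<le> dist \<oo> p" for \<delta> p
      proof -
        obtain s where s: "s \<in> {0..dist \<oo> p}" "dist z (\<delta> s) \<le> D" using d(2) by auto
        note d' = geodesic_segmentD[OF d(1)]
        have "dist (\<delta> s) \<oo> = s" "dist (\<delta> s) (\<delta> s0) = \<bar>s - s0\<bar>"
          using geodesicD[OF d'(1), of s 0] geodesicD[OF d'(1), of s s0] d'(2) s(1) s0(1) T(3)[of k] d(3) by auto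
        then show ?thesis using s(2) z0 by metric
      qed
      have "dist z (\<gamma>' k s0) \<le> 2 * D" by (rule *[OF a(2) _ a(3)]) (use nearD[OF u(3)] zf ga(2) in auto)
      moreover have "dist z (\<gamma> k s0) \<le> 2 * D" by (rule *[OF b(2) _ b(3)]) (use nearD[OF u(4)] zf gb(2) in auto)
      moreover have "dist (\<gamma> k s0) (\<beta>1 s0) \<le> 1" "dist (\<gamma>' k s0) (\<beta>2 s0) \<le> 1" using a(4)[of s0 k] b(4)[of s0 k] T(3)[of k] s0 by auto
      ultimately show False using s0(2) by metric
    qed
    then show ?thesis using u(1) by blast
  qed
  then obtain u where u: "\<And>k. u k \<in> {0..dist (a k) (b k)}" "\<And>k. dist (c k (u k)) \<oo> \<le> s0" by metis
  have inf: "dist \<oo> (a k) \<ge> real k" "dist \<oo> (b k) \<ge> real k" for k using a(3)[of k] b(3)[of k] T(2)[of k] by auto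
  obtain l \<rho> \<beta> where l: "geodesic UNIV l" "range l \<subseteq> weak_convex_hull \<oo> (Inr ` \<Lambda>)"
    "strict_mono \<rho>" "\<And>t. t \<ge> 0 \<Longrightarrow> (\<lambda>k. \<gamma> (\<rho> k) t) \<longlonglongrightarrow> \<beta> t" "ray_end \<oo> 0 l = ray_end \<oo> 0 \<beta>"
    by (rule line_limit[OF M a(1) b(1) c u inf b(2)]) blast
  have "dist (\<beta> t) (\<beta>1 t) \<le> 1" if t: "t \<in> {0..}" for t
  proof (rule tendsto_upperbound[OF tendsto_dist[OF l(4) tendsto_const]])
    have "\<forall>\<^sub>F k in sequentially. t \<le> real k" using eventually_ge_at_top[of "nat \<lceil>t\<rceil>"] by (rule eventually_mono) linarith
    then have "\<forall>\<^sub>F k in sequentially. t \<le> real (\<rho> k)" by (rule eventually_subseq[OF l(3)])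
    then show "\<forall>\<^sub>F k in sequentially. dist (\<gamma> (\<rho> k) t) (\<beta>1 t) \<le> 1"
    proof (rule eventually_mono)
      fix k assume "t \<le> real (\<rho> k)"
      then show "dist (\<gamma> (\<rho> k) t) (\<beta>1 t) \<le> 1" using b(4)[of t "\<rho> k"] t T(2)[of "\<rho> k"] by auto
    qed
  qed (use t in auto)
  then have "ray_end \<oo> 0 \<beta> = \<xi>" using ray_end_eqI[OF finite_hausdorff_dist_pointwise] b1(2) by blast
  then show thesis using that l by simp
qed

text \<open>Coboundedness keeps the hull within bounded distance of the orbit. A line of the hull
  ending where the escaping ray \<open>\<beta>\<close> ends would keep \<open>\<beta>\<close> near
  the orbit too. The other end of such a line is chosen among the two distinct ends of a line
  through \<open>x0\<close>, at least one of which differs from the end of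
  \<open>\<beta>\<close>.\<close>

lemma cobounded_hull_imp_quasiconvex:
  assumes M: "uniform_gauge M" and cob: "cobounded_on H \<phi> (weak_convex_hull \<oo> (Inr ` \<Lambda>))"
  shows "\<exists>R. quasiconvex R"
proof (rule ccontr)
  assume "\<nexists>R. quasiconvex R"
  then obtain \<beta> c where b: "geodesic {0..} \<beta>" "\<beta> 0 = \<oo>" "morse_pairs (perturbed 1 M) (\<beta> ` {0..})" "ray_end \<oo> 0 \<beta> \<in> \<Lambda>"
    "\<And>t y. t \<ge> 0 \<Longrightarrow> y \<in> X \<Longrightarrow> dist (\<beta> t) y \<ge> t - c" using not_quasiconvex[OF M] by blast
  have \<beta>: "\<beta> \<in> morse_rays_from \<oo>" using b morse_rays_from_iff by blast
  obtain x0 R where x0: "x0 \<in> weak_convex_hull \<oo> (Inr ` \<Lambda>)" "weak_convex_hull \<oo> (Inr ` \<Lambda>) \<subseteq> (\<Union>h\<in>carrier H. \<phi> h ` cball x0 R)"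
    using cob unfolding cobounded_on_def by blast
  define R1 where "R1 = R + dist x0 \<oo>"
  have hullX: "\<exists>y\<in>X. dist z y \<le> R1" if "z \<in> weak_convex_hull \<oo> (Inr ` \<Lambda>)" for z
  proof -
    obtain h w where h: "h \<in> carrier H" "z = \<phi> h w" "dist x0 w \<le> R" using x0(2) \<open>z \<in> _\<close> by auto
    have "dist z (\<phi> h \<oo>) \<le> R1" using h dist_triangle[of w \<oo> x0] dist_commute[of w x0] unfolding R1_def by simp
    then show ?thesis using h(1) X_iff by blast
  qed
  obtain \<gamma> where \<gamma>: "geodesic UNIV \<gamma>" "ray_end \<oo> 0 \<gamma> \<in> \<Lambda>" "ray_end \<oo> 0 (\<lambda>t. \<gamma> (- t)) \<in> \<Lambda>"
    using x0(1) unfolding weak_convex_hull_boundary_iff by blast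
  have "\<Lambda> \<subseteq> morse_boundary \<oo>" unfolding \<Lambda>_def limit_set_def by blast
  then have "ray_end \<oo> 0 \<gamma> \<noteq> ray_end \<oo> 0 (\<lambda>t. \<gamma> (- t))" using line_ends_distinct[OF \<gamma>(1)] \<gamma>(2) by blast
  then obtain \<eta> where \<eta>: "\<eta> \<in> \<Lambda>" "ray_end \<oo> 0 \<beta> \<noteq> \<eta>" using \<gamma>(2,3) by metis
  obtain l where l: "geodesic UNIV l" "range l \<subseteq> weak_convex_hull \<oo> (Inr ` \<Lambda>)" "ray_end \<oo> 0 l = ray_end \<oo> 0 \<beta>"
    by (rule line_to_limit_point[OF M b(4) \<eta>]) blast
  have "finite_hausdorff_dist (\<beta> ` {0..}) (l ` {0..})" by (rule ray_end_eqD[OF \<beta> l(3)[symmetric]])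
  then obtain E where E: "near E (\<beta> ` {0..}) (l ` {0..})" unfolding finite_hausdorff_dist_iff_near by blast
  define t where "t = max 0 (E + R1 + c + 1)"
  have "\<beta> t \<in> \<beta> ` {0..}" unfolding t_def by simp
  then obtain z where z: "z \<in> l ` {0..}" "dist (\<beta> t) z \<le> E" using nearD[OF E] by blast
  obtain y where y: "y \<in> X" "dist z y \<le> R1" using hullX z(1) l(2) by blast
  have "dist (\<beta> t) y \<ge> t - c" by (rule b(5)[OF _ y(1)]) (simp add: t_def)
  moreover have "dist (\<beta> t) y \<le> E + R1" using z(2) y(2) by metric
  ultimately show False unfolding t_def by linarith
qed

text \<open>If the orbit were bounded, every group element would move some fixed ball to a set
  meeting it, and properness would make the group finite.\<close>

lemma orbit_unbounded:
  assumes "infinite (carrier H)"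
  shows "\<exists>y\<in>X. dist \<oo> y \<ge> T"
proof (rule ccontr)
  assume "\<not> ?thesis"
  then have b: "\<And>y. y \<in> X \<Longrightarrow> dist \<oo> y < T" by force
  have "T \<ge> 0" using b[OF base_in_X] by simp
  then have "\<phi> h \<oo> \<in> \<phi> h ` cball \<oo> T \<inter> cball \<oo> T" if "h \<in> carrier H" for h
    using b[of "\<phi> h \<oo>"] that X_iff by force
  then have "carrier H \<subseteq> {h \<in> carrier H. \<phi> h ` cball \<oo> T \<inter> cball \<oo> T \<noteq> {}}" by blast
  moreover have "finite {h \<in> carrier H. \<phi> h ` cball \<oo> T \<inter> cball \<oo> T \<noteq> {}}"
    using proper proper_space unfolding proper_action_def by blast
  ultimately show False using assms finite_subset by blast
qed

section \<open>Consequences of a uniform gauge and quasiconvexity\<close>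

context
  fixes M R
  assumes M: "uniform_gauge M" and R: "quasiconvex R" and inf_group: "infinite (carrier H)"
begin

lemma segments_morse_pairs: "a \<in> X \<Longrightarrow> geodesic_segment \<oo> a \<gamma> \<Longrightarrow> morse_pairs M (\<gamma> ` {0..dist \<oo> a})"
  using M base_in_X unfolding uniform_gauge_def by blast

lemma limit_set_nonempty: "\<Lambda> \<noteq> {}"
proof -
  have "\<forall>k::nat. \<exists>y. y \<in> X \<and> dist \<oo> y \<ge> real k" using orbit_unbounded[OF inf_group] by blast
  then obtain a where a: "\<And>k::nat. a k \<in> X" "\<And>k. dist \<oo> (a k) \<ge> real k" by metis
  obtain \<gamma> where \<gamma>: "\<And>k. geodesic_segment \<oo> (a k) (\<gamma> k)" using choose_segments[of "\<lambda>_. \<oo>" a] by blast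
  have "filterlim (\<lambda>k. dist \<oo> (a k)) at_top sequentially"
    by (rule filterlim_at_top_mono[OF filterlim_real_sequentially]) (use a(2) in auto)
  then obtain \<rho> \<beta> where "ray_end \<oo> 0 \<beta> \<in> limit_set \<oo> X"
    by (rule segments_limit[of a X \<gamma> M, OF a(1) \<gamma> segments_morse_pairs[OF a(1) \<gamma>]]) blast
  then show ?thesis unfolding \<Lambda>_def by blast
qed

lemma limit_set_compact: "compactin (morse_boundary_topology \<oo>) \<Lambda>"
proof -
  \<comment> \<open>One gauge for coarse limits with error 1 and with error 2. The value 2 is put in
    so that \<open>N 5 0\<close>, a summand of \<open>morse_delta N\<close>, is large enough for
    \<open>compactin_ends\<close>.\<close>
  define N where "N K C = max 2 (max (perturbed 1 (perturbed 1 M) K C) (perturbed 2 (perturbed 1 M) K C))" for K C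
  have N: "morse_gauge N" unfolding morse_gauge_def N_def by auto
  have N2: "N 1 (2 * N 5 0) \<ge> 0" "N 5 0 \<ge> 2" unfolding N_def by auto
  then have delta: "morse_delta N \<ge> 2" unfolding morse_delta_def by (simp add: max_def)
  have gr: "\<beta> \<in> gauge_rays_from \<oo> N" if c: "coarse_limit X r \<beta>" "r = 1 \<or> r = 2" for \<beta> r
  proof -
    have "morse_pairs (perturbed r (perturbed 1 M)) (\<beta> ` {0..})" by (rule coarse_limit_imp(2)[OF segments_morse_pairs c(1)])
    then have "morse_pairs N (\<beta> ` {0..})" by (rule morse_pairs_mono) (use c(2) in \<open>auto simp: N_def\<close>)
    then show ?thesis using c(1) morse_pairs_imp_is_morse unfolding coarse_limit_def gauge_rays_from_def by blast
  qed
  have lam: "ray_end \<oo> 0 \<beta> \<in> \<Lambda>" if "coarse_limit X r \<beta>" for r \<beta>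
    using coarse_limit_imp(1)[OF segments_morse_pairs that] unfolding \<Lambda>_def .
  define RR where "RR = Collect (coarse_limit X 1)"
  show ?thesis
  proof (rule compactin_ends[OF N delta, of RR])
    show "RR \<subseteq> gauge_rays_from \<oo> N" using gr unfolding RR_def by blast
    show "ray_end \<oo> 0 ` RR = \<Lambda>"
    proof
      show "ray_end \<oo> 0 ` RR \<subseteq> \<Lambda>" using lam unfolding RR_def by blast
      show "\<Lambda> \<subseteq> ray_end \<oo> 0 ` RR"
      proof
        fix x assume "x \<in> \<Lambda>"
        then obtain \<beta> where "ray_end \<oo> 0 \<beta> = x" "coarse_limit X 1 \<beta>" unfolding \<Lambda>_def using limit_set_coarse by blast
        then show "x \<in> ray_end \<oo> 0 ` RR" unfolding RR_def by blast
      qed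
    qed
    fix f \<beta> assume f: "\<And>k::nat. f k \<in> RR" and \<beta>: "geodesic {0..} \<beta>" "\<beta> 0 = \<oo>"
      and lim: "\<And>T. T \<ge> 0 \<Longrightarrow> uniform_limit {0..T} f \<beta> sequentially"
    \<comment> \<open>The family \<open>RR\<close> need not be closed, as limits lose 1 in the
      error. \<open>compactin_ends\<close> only asks that a limit be an \<open>N\<close>-Morse ray
      ending in \<open>\<Lambda>\<close>, and error 2 is good enough for that.\<close>
    have "coarse_limit X 2 \<beta>" unfolding coarse_limit_def
    proof (intro conjI allI impI \<beta>)
      fix T :: real assume T: "T \<ge> 0"
      obtain k where k: "\<forall>t\<in>{0..T}. dist (f k t) (\<beta> t) < 1"
        using uniform_limitD[OF lim[OF T], of 1] unfolding eventually_sequentially by auto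
      obtain a \<gamma> where a: "a \<in> X" "geodesic_segment \<oo> a \<gamma>" "T \<le> dist \<oo> a" "\<forall>t\<in>{0..T}. dist (\<gamma> t) (f k t) \<le> 1"
        using f[of k] T unfolding RR_def coarse_limit_def by blast
      have "dist (\<gamma> t) (\<beta> t) \<le> 2" if "t \<in> {0..T}" for t
        using bspec[OF k that] bspec[OF a(4) that] by metric
      then show "\<exists>a\<in>X. \<exists>\<gamma>. geodesic_segment \<oo> a \<gamma> \<and> T \<le> dist \<oo> a \<and> (\<forall>t\<in>{0..T}. dist (\<gamma> t) (\<beta> t) \<le> 2)" using a by blast
    qed
    then show "\<beta> \<in> gauge_rays_from \<oo> N \<and> ray_end \<oo> 0 \<beta> \<in> \<Lambda>" using gr lam by blast
  qed
qed

text \<open>Only \<open>S\<close> depends on the ray. From there on it is near the coarse limit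
  \<open>\<beta>\<close> by \<open>rays_close\<close>, which is 1-close to a segment from the
  basepoint into the orbit, which is \<open>R\<close>-close to the orbit. A single constant for all
  rays is what conicality and coboundedness of the hull call for.\<close>

lemma limit_ray_near_orbit:
  assumes x: "x \<in> \<Lambda>" and \<tau>: "geodesic {a..} \<tau>" "ray_end \<oo> a \<tau> = x"
  shows "\<exists>S\<ge>a. \<forall>s\<ge>S. \<exists>y\<in>X. dist (\<tau> s) y \<le> perturbed 1 (perturbed 1 M) 9 4 + 1 + R"
proof -
  obtain \<beta> where b: "\<beta> \<in> morse_rays_from \<oo>" "ray_end \<oo> 0 \<beta> = x" "coarse_limit X 1 \<beta>"
    by (rule limit_set_coarse[OF x[unfolded \<Lambda>_def]]) blast
  have hb: "morse_pairs (perturbed 1 (perturbed 1 M)) (\<beta> ` {0..})" by (rule coarse_limit_imp(2)[OF segments_morse_pairs b(3)])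
  have gb: "geodesic {0..} \<beta>" using b(1) unfolding morse_rays_from_iff by blast
  have "finite_hausdorff_dist (\<beta> ` {0..}) (\<tau> ` {a..})" by (rule ray_end_eqD[OF b(1)]) (use b \<tau> in simp)
  then obtain D where D: "near D (\<beta> ` {0..}) (\<tau> ` {a..})" unfolding finite_hausdorff_dist_iff_near by blast
  obtain S where S: "S \<ge> a" "\<forall>s\<ge>S. \<exists>s'\<ge>0. dist (\<tau> s) (\<beta> s') \<le> perturbed 1 (perturbed 1 M) 9 4"
    using rays_close[OF gb hb \<tau>(1) D] by blast
  have "\<exists>y\<in>X. dist (\<tau> s) y \<le> perturbed 1 (perturbed 1 M) 9 4 + 1 + R" if s: "s \<ge> S" for s
  proof -
    obtain s' where s': "s' \<ge> 0" "dist (\<tau> s) (\<beta> s') \<le> perturbed 1 (perturbed 1 M) 9 4" using S(2) s by blast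
    obtain p \<gamma> where p: "p \<in> X" "geodesic_segment \<oo> p \<gamma>" "s' \<le> dist \<oo> p" "\<forall>t\<in>{0..s'}. dist (\<gamma> t) (\<beta> t) \<le> 1"
      using b(3) s'(1) unfolding coarse_limit_def by blast
    have "near R (\<gamma> ` {0..dist \<oo> p}) X" using R p(1,2) base_in_X unfolding quasiconvex_def by blast
    then obtain y where y: "y \<in> X" "dist (\<gamma> s') y \<le> R" using nearD[of R "\<gamma> ` {0..dist \<oo> p}" X "\<gamma> s'"] s'(1) p(3) by auto
    have "dist (\<gamma> s') (\<beta> s') \<le> 1" using p(4) s'(1) by auto
    then show ?thesis using y s'(2) dist_triangle[of "\<tau> s" y "\<beta> s'"] dist_triangle[of "\<beta> s'" y "\<gamma> s'"] dist_commute[of "\<beta> s'" "\<gamma> s'"]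
      by (intro bexI[OF _ y(1)]) linarith
  qed
  then show ?thesis using S(1) by blast
qed

lemma limit_points_conical: "x \<in> \<Lambda> \<Longrightarrow> conical_limit_point \<oo> X x"
  unfolding conical_limit_point_def
proof (intro conjI)
  assume x: "x \<in> \<Lambda>"
  then show "x \<in> morse_boundary \<oo>" unfolding \<Lambda>_def limit_set_def by blast
  let ?K = "perturbed 1 (perturbed 1 M) 9 4 + 1 + R"
  have "closed_nbhd (max 1 ?K) (\<alpha> ` {a..}) \<inter> X \<noteq> {}" if m: "morse_ray a \<alpha>" and e: "ray_end \<oo> a \<alpha> = x" for a \<alpha>
  proof -
    have g: "geodesic {a..} \<alpha>" using m unfolding morse_ray_def by blast
    obtain S where "S \<ge> a" "\<exists>y\<in>X. dist (\<alpha> S) y \<le> ?K" using limit_ray_near_orbit[OF x g e] by blast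
    then obtain y where "S \<ge> a" "y \<in> X" "dist (\<alpha> S) y \<le> ?K" by blast
    then have "y \<in> closed_nbhd (max 1 ?K) (\<alpha> ` {a..})" by (intro closed_nbhdI[of "\<alpha> S"]) (auto simp: dist_commute)
    then show ?thesis using \<open>y \<in> X\<close> by blast
  qed
  then show "\<exists>K>0. \<forall>a \<alpha>. morse_ray a \<alpha> \<and> ray_end \<oo> a \<alpha> = x \<longrightarrow> closed_nbhd K (\<alpha> ` {a..}) \<inter> X \<noteq> {}"
    by (intro exI[of _ "max 1 ?K"]) auto
qed

text \<open>Midpoints of long segments from the basepoint to the orbit are near orbit points.
  Translating these to the basepoint gives segments whose middles stay near the basepoint while both
  ends go to infinity.\<close>

lemma hull_nonempty: "weak_convex_hull \<oo> (Inr ` \<Lambda>) \<noteq> {}"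
proof -
  have "\<exists>a b c u. a \<in> X \<and> b \<in> X \<and> geodesic_segment a b c \<and> u \<in> {0..dist a b} \<and> dist (c u) \<oo> \<le> R \<and>
    dist \<oo> a \<ge> real k \<and> dist \<oo> b \<ge> real k" for k :: nat
  proof -
    obtain p where p: "p \<in> X" "dist \<oo> p \<ge> 2 * (real k + \<bar>R\<bar>)" using orbit_unbounded[OF inf_group] by blast
    obtain \<gamma> where \<gamma>: "geodesic_segment \<oo> p \<gamma>" using geodesic_space by blast
    \<comment> \<open>At the midpoint both halves have length at least
      \<open>k + \<bar>R\<bar>\<close>, so both ends stay at distance at least \<open>k\<close> from
      the orbit point near it.\<close>
    define u where "u = dist \<oo> p / 2"
    have u: "u \<in> {0..dist \<oo> p}" "u \<ge> real k + \<bar>R\<bar>" using p(2) unfolding u_def by auto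
    have "near R (\<gamma> ` {0..dist \<oo> p}) X" using R p(1) \<gamma> base_in_X unfolding quasiconvex_def by blast
    then obtain y where y: "y \<in> X" "dist (\<gamma> u) y \<le> R" using nearD[of R "\<gamma> ` {0..dist \<oo> p}" X "\<gamma> u"] u(1) by auto
    then obtain g where g: "g \<in> carrier H" "y = \<phi> g \<oo>" unfolding X_iff by blast
    define f where "f = \<phi> (inv g)"
    have fd: "dist (f v) (f w) = dist v w" for v w unfolding f_def using g(1) by simp
    have fX: "f v \<in> X" if "v \<in> X" for v unfolding f_def using act_X that g(1) by simp
    have fy: "f y = \<oo>" unfolding f_def using g act_inv by simp
    note \<gamma>' = geodesic_segmentD[OF \<gamma>]
    have "dist \<oo> (\<gamma> u) = u" "dist (\<gamma> u) p = u"
      using geodesicD[OF \<gamma>'(1), of 0 u] geodesicD[OF \<gamma>'(1), of u "dist \<oo> p"] \<gamma>'(2,3) u(1) unfolding u_def by auto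
    then have "dist y \<oo> \<ge> real k" "dist y p \<ge> real k"
      using y(2) u(2) by metric+
    then have "dist \<oo> (f \<oo>) \<ge> real k" "dist \<oo> (f p) \<ge> real k" using fd[of y \<oo>] fd[of y p] fy by auto
    moreover have "geodesic_segment (f \<oo>) (f p) (\<lambda>t. f (\<gamma> t))" by (rule geodesic_segment_isometry[OF fd \<gamma>])
    moreover have "u \<in> {0..dist (f \<oo>) (f p)}" using u(1) fd by simp
    moreover have "dist (f (\<gamma> u)) \<oo> \<le> R" using y(2) fd[of "\<gamma> u" y] fy by simp
    ultimately show ?thesis using fX[OF base_in_X] fX[OF p(1)] by blast
  qed
  then obtain a b c u where *: "\<And>k::nat. a k \<in> X" "\<And>k. b k \<in> X" "\<And>k. geodesic_segment (a k) (b k) (c k)"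
    "\<And>k. u k \<in> {0..dist (a k) (b k)}" "\<And>k. dist (c k (u k)) \<oo> \<le> R" "\<And>k. dist \<oo> (a k) \<ge> real k" "\<And>k. dist \<oo> (b k) \<ge> real k" by metis
  obtain \<gamma> where \<gamma>: "\<And>k. geodesic_segment \<oo> (b k) (\<gamma> k)" using choose_segments[of "\<lambda>_. \<oo>" b] by blast
  obtain l where "range l \<subseteq> weak_convex_hull \<oo> (Inr ` \<Lambda>)" by (rule line_limit[OF M * \<gamma>]) blast
  then show ?thesis by blast
qed

text \<open>Far out in both directions a line of the hull is near orbit points \<open>p\<close> and
  \<open>q\<close>. The part between follows a segment from \<open>p\<close> to \<open>q\<close>,
  which quasiconvexity keeps near the orbit.\<close>

lemma hull_cobounded: "cobounded_on H \<phi> (weak_convex_hull \<oo> (Inr ` \<Lambda>))"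
proof -
  let ?K = "perturbed 1 (perturbed 1 M) 9 4 + 1 + R"
  define R2 where "R2 = M 1 (2 * ?K + 2) + R"
  have near: "\<exists>y\<in>X. dist x y \<le> R2" if x: "x \<in> weak_convex_hull \<oo> (Inr ` \<Lambda>)" for x
  proof -
    obtain l t0 where l: "geodesic UNIV l" "ray_end \<oo> 0 l \<in> \<Lambda>" "ray_end \<oo> 0 (\<lambda>t. l (- t)) \<in> \<Lambda>" "x = l t0"
      using x unfolding weak_convex_hull_boundary_iff by blast
    obtain S1 where S1: "\<And>s. s \<ge> S1 \<Longrightarrow> \<exists>y\<in>X. dist (l s) y \<le> ?K" using limit_ray_near_orbit[OF l(2) line_half[OF l(1)] refl] by blast
    obtain S2 where S2: "\<And>s. s \<ge> S2 \<Longrightarrow> \<exists>y\<in>X. dist (l (- s)) y \<le> ?K"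
      using limit_ray_near_orbit[OF l(3) line_half[OF line_reverse[OF l(1)]] refl] by blast
    define s1 s2 where "s1 = max S1 \<bar>t0\<bar>" and "s2 = max S2 \<bar>t0\<bar>"
    obtain p where p: "p \<in> X" "dist (l (- s2)) p \<le> ?K" using S2[of s2] unfolding s2_def by auto
    obtain q where q: "q \<in> X" "dist (l s1) q \<le> ?K" using S1[of s1] unfolding s1_def by auto
    obtain c where c: "geodesic_segment p q c" using geodesic_space by blast
    have t0: "t0 \<in> {- s2..s1}" unfolding s1_def s2_def by auto
    have "near (M 1 (2 * ?K + 2)) (l ` {- s2..s1}) (c ` {0..dist p q})"
      by (rule segment_near[OF geodesic_segmentD(1)[OF c] _ geodesic_segment_endpoints[OF c] l(1)])
         (use M p q c t0 in \<open>auto simp: uniform_gauge_def\<close>)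
    moreover have "near R (c ` {0..dist p q}) X" using R p(1) q(1) c unfolding quasiconvex_def by blast
    ultimately have "near R2 (l ` {- s2..s1}) X" unfolding R2_def by (rule near_trans)
    then show ?thesis using nearD[of R2 _ X x] t0 l(4) by auto
  qed
  obtain x0 where x0: "x0 \<in> weak_convex_hull \<oo> (Inr ` \<Lambda>)" using hull_nonempty by blast
  have "weak_convex_hull \<oo> (Inr ` \<Lambda>) \<subseteq> (\<Union>h\<in>carrier H. \<phi> h ` cball x0 (R2 + dist x0 \<oo>))"
  proof
    fix x assume "x \<in> weak_convex_hull \<oo> (Inr ` \<Lambda>)"
    then obtain y where "y \<in> X" "dist x y \<le> R2" using near by blast
    then obtain h where h: "h \<in> carrier H" "dist x (\<phi> h \<oo>) \<le> R2" unfolding X_iff by blast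
    define w where "w = \<phi> (inv h) x"
    have w: "\<phi> h w = x" unfolding w_def using act_inv(2)[OF h(1)] .
    then have "dist w \<oo> \<le> R2" using act_dist[OF h(1), of w \<oo>] h(2) by simp
    then have "w \<in> cball x0 (R2 + dist x0 \<oo>)" using dist_triangle[of x0 w \<oo>] dist_commute[of w \<oo>] by simp
    then show "x \<in> (\<Union>h\<in>carrier H. \<phi> h ` cball x0 (R2 + dist x0 \<oo>))" using w h(1) by blast
  qed
  then show ?thesis unfolding cobounded_on_def using x0 by blast
qed

end

end

section \<open>Word metrics and stability\<close>

locale generated_orbit = proper_orbit \<oo> H \<phi> for \<oo> :: "'x::metric_space"
    and H :: "('g, 'r) monoid_scheme" (structure) and \<phi> :: "'g \<Rightarrow> 'x \<Rightarrow> 'x" +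
  fixes S :: "'g set"
  assumes finite_S: "finite S" and S_carrier: "S \<subseteq> carrier H" and generate_S: "generate H S = carrier H"
begin

lemma orbitI: "h \<in> carrier H \<Longrightarrow> \<phi> h \<oo> \<in> X"
  unfolding X_iff by blast

section \<open>Word length of a finite generating set\<close>

definition letters :: "'g set" where "letters = S \<union> m_inv H ` S"
definition word_value :: "'g list \<Rightarrow> 'g" where "word_value ws = foldr (mult H) ws \<one>"

lemma letters_carrier: "letters \<subseteq> carrier H" and finite_letters: "finite letters"
  unfolding letters_def using S_carrier finite_S by auto

lemma word_value_Nil [simp]: "word_value [] = \<one>" and
  word_value_Cons [simp]: "word_value (s # ws) = s \<otimes> word_value ws"
  unfolding word_value_def by auto

lemma one_closed: "\<one> \<in> carrier H" and m_closed: "g \<in> carrier H \<Longrightarrow> h \<in> carrier H \<Longrightarrow> g \<otimes> h \<in> carrier H"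
  using group group.is_monoid monoid.one_closed monoid.m_closed by metis+

lemma m_assoc: "x \<in> carrier H \<Longrightarrow> y \<in> carrier H \<Longrightarrow> z \<in> carrier H \<Longrightarrow> (x \<otimes> y) \<otimes> z = x \<otimes> (y \<otimes> z)"
  by (rule monoid.m_assoc[OF group.is_monoid[OF group]])

lemma word_value_carrier: "set ws \<subseteq> letters \<Longrightarrow> word_value ws \<in> carrier H"
  using letters_carrier by (induction ws) (auto intro: one_closed m_closed)

lemma word_value_append:
  "set us \<subseteq> letters \<Longrightarrow> set vs \<subseteq> letters \<Longrightarrow> word_value (us @ vs) = word_value us \<otimes> word_value vs"
proof (induction us)
  case Nil
  then show ?case using monoid.l_one[OF group.is_monoid[OF group] word_value_carrier[of vs]] by simp
next
  case (Cons s us)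
  have "s \<in> carrier H" "word_value us \<in> carrier H" "word_value vs \<in> carrier H"
    using Cons.prems letters_carrier word_value_carrier[of us] word_value_carrier[of vs] by auto
  then show ?case using Cons by (simp add: m_assoc)
qed

lemma ex_word: "h \<in> carrier H \<Longrightarrow> \<exists>ws. set ws \<subseteq> letters \<and> word_value ws = h"
  unfolding generate_S[symmetric]
proof (induction rule: generate.induct)
  case one
  show ?case by (intro exI[of _ "[]"]) simp
next
  case (incl h)
  then show ?case using S_carrier monoid.r_one[OF group.is_monoid[OF group], of h] by (intro exI[of _ "[h]"]) (auto simp: letters_def)
next
  case (inv h)
  then show ?case using S_carrier monoid.r_one[OF group.is_monoid[OF group], of "inv h"] inv_carrier[of h]
    by (intro exI[of _ "[inv h]"]) (auto simp: letters_def)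
next
  case (eng h1 h2)
  then obtain us vs where "set us \<subseteq> letters" "word_value us = h1" "set vs \<subseteq> letters" "word_value vs = h2" by blast
  then show ?case using word_value_append[of us vs] by (intro exI[of _ "us @ vs"]) simp
qed

abbreviation wl :: "'g \<Rightarrow> nat" where "wl \<equiv> word_length H S"

lemma wl_eq: "wl h = (LEAST n. \<exists>ws. length ws = n \<and> set ws \<subseteq> letters \<and> word_value ws = h)"
  unfolding word_length_def letters_def word_value_def ..

lemma wl_word:
  assumes "h \<in> carrier H"
  obtains ws where "length ws = wl h" "set ws \<subseteq> letters" "word_value ws = h"
proof -
  have "\<exists>n ws. length ws = n \<and> set ws \<subseteq> letters \<and> word_value ws = h" using ex_word[OF assms] by blast
  then have "\<exists>ws. length ws = wl h \<and> set ws \<subseteq> letters \<and> word_value ws = h" unfolding wl_eq by (rule LeastI_ex)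
  then show thesis using that by blast
qed

lemma wl_le: "set ws \<subseteq> letters \<Longrightarrow> wl (word_value ws) \<le> length ws"
  unfolding wl_eq by (rule Least_le) blast

lemma wl_mult: "g \<in> carrier H \<Longrightarrow> h \<in> carrier H \<Longrightarrow> wl (g \<otimes> h) \<le> wl g + wl h"
proof -
  assume "g \<in> carrier H" "h \<in> carrier H"
  then obtain us vs where u: "length us = wl g" "set us \<subseteq> letters" "word_value us = g"
    and v: "length vs = wl h" "set vs \<subseteq> letters" "word_value vs = h" using wl_word by metis
  then show ?thesis using wl_le[of "us @ vs"] word_value_append[of us vs] by simp
qed

lemma inv_mult_cancel:
  assumes "g \<in> carrier H" "h \<in> carrier H" "k \<in> carrier H"
  shows "(inv g \<otimes> h) \<otimes> (inv h \<otimes> k) = inv g \<otimes> k"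
proof -
  have "h \<otimes> (inv h \<otimes> k) = k"
    using assms m_assoc[of h "inv h" k] group.r_inv[OF group] monoid.l_one[OF group.is_monoid[OF group]] by simp
  then show ?thesis using assms m_assoc[of "inv g" h "inv h \<otimes> k"] m_closed by simp
qed

text \<open>The points are given by the prefixes of a shortest word. A subword that could be
  shortened would shorten the whole word, by subadditivity of word length.\<close>

lemma geodesic_word:
  assumes g: "g \<in> carrier H" and h: "h \<in> carrier H"
  obtains w and n :: nat where "w 0 = g" "w n = h" "\<And>i. i \<le> n \<Longrightarrow> w i \<in> carrier H"
    "\<And>i j. i \<le> j \<Longrightarrow> j \<le> n \<Longrightarrow> word_dist H S (w i) (w j) = real (j - i)"
proof -
  let ?d = "inv g \<otimes> h"
  have d: "?d \<in> carrier H" using g h by (simp add: m_closed)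
  obtain ws where ws: "length ws = wl ?d" "set ws \<subseteq> letters" "word_value ws = ?d" by (rule wl_word[OF d])
  define n where "n = length ws"
  define w where "w i = g \<otimes> word_value (take i ws)" for i
  have sub: "set (take i ws) \<subseteq> letters" "set (drop i ws) \<subseteq> letters" "set (drop i (take j ws)) \<subseteq> letters" for i j
    using ws(2) set_take_subset set_drop_subset order_trans by metis+
  have wc: "w i \<in> carrier H" for i unfolding w_def by (intro m_closed g word_value_carrier sub)
  have w0: "w 0 = g" unfolding w_def using monoid.r_one[OF group.is_monoid[OF group] g] by simp
  have wn: "w n = h"
    unfolding w_def n_def using ws(3) m_assoc[OF g inv_carrier[OF g] h] group.r_inv[OF group g] monoid.l_one[OF group.is_monoid[OF group] h] by simp
  have step: "inv (w i) \<otimes> w j = word_value (drop i (take j ws))" if "i \<le> j" for i j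
  proof -
    have "take j ws = take i ws @ drop i (take j ws)" using that by (metis append_take_drop_id min.absorb1 take_take)
    then have "w j = w i \<otimes> word_value (drop i (take j ws))"
      unfolding w_def using word_value_append[OF sub(1)[of i] sub(3)[of i j]] m_assoc[OF g word_value_carrier[OF sub(1)] word_value_carrier[OF sub(3)]]
      by simp
    then show ?thesis using m_assoc[OF inv_carrier[OF wc] wc word_value_carrier[OF sub(3)[of i j]], of i i] group.l_inv[OF group wc[of i]]
        monoid.l_one[OF group.is_monoid[OF group] word_value_carrier[OF sub(3)[of i j]]] by simp
  qed
  have "word_dist H S (w i) (w j) = real (j - i)" if ij: "i \<le> j" "j \<le> n" for i j
  proof -
    have le: "wl (inv (w a) \<otimes> w b) \<le> b - a" if "a \<le> b" "b \<le> n" for a b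
      using wl_le[OF sub(3)[of a b]] step[OF that(1)] that unfolding n_def by simp
    have c: "inv (w a) \<otimes> w b \<in> carrier H" for a b by (intro m_closed inv_carrier wc)
    have "wl ?d = wl (inv (w 0) \<otimes> w n)" using w0 wn by simp
    also have "inv (w 0) \<otimes> w n = (inv (w 0) \<otimes> w i) \<otimes> ((inv (w i) \<otimes> w j) \<otimes> (inv (w j) \<otimes> w n))"
      by (simp add: inv_mult_cancel wc)
    also have "wl \<dots> \<le> wl (inv (w 0) \<otimes> w i) + (wl (inv (w i) \<otimes> w j) + wl (inv (w j) \<otimes> w n))"
      by (rule order_trans[OF wl_mult[OF c m_closed[OF c c]] add_left_mono[OF wl_mult[OF c c]]])
    finally have "wl ?d \<le> i + (wl (inv (w i) \<otimes> w j) + (n - j))" using le[of 0 i] le[of j n] ij by linarith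
    then have "j - i \<le> wl (inv (w i) \<otimes> w j)" using ws(1) ij unfolding n_def by linarith
    then show ?thesis using le[OF ij] unfolding word_dist_def by simp
  qed
  then show thesis using that[OF w0 wn wc] by blast
qed

lemma orbit_map_lipschitz:
  obtains L where "L \<ge> 1" "\<And>g h. g \<in> carrier H \<Longrightarrow> h \<in> carrier H \<Longrightarrow> dist (\<phi> g x) (\<phi> h x) \<le> L * word_dist H S g h"
proof -
  define L where "L = Max (insert 1 ((\<lambda>s. dist (\<phi> s x) x) ` letters))"
  have L: "L \<ge> 1" "\<And>s. s \<in> letters \<Longrightarrow> dist (\<phi> s x) x \<le> L" unfolding L_def using finite_letters by auto
  have word: "dist (\<phi> (word_value ws) x) x \<le> L * length ws" if "set ws \<subseteq> letters" for ws
    using that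
  proof (induction ws)
    case Nil
    then show ?case by (simp add: act_one)
  next
    case (Cons s ws)
    have s: "s \<in> letters" "s \<in> carrier H" and v: "word_value ws \<in> carrier H" using Cons.prems letters_carrier word_value_carrier[of ws] by auto
    have "dist (\<phi> (word_value (s # ws)) x) x \<le> dist (\<phi> s (\<phi> (word_value ws) x)) (\<phi> s x) + dist (\<phi> s x) x"
      using act_mult[OF s(2) v] dist_triangle by simp
    also have "\<dots> \<le> L * length ws + L" using Cons act_dist[OF s(2)] L(2)[OF s(1)] by simp
    finally show ?case by (simp add: algebra_simps)
  qed
  have "dist (\<phi> g x) (\<phi> h x) \<le> L * word_dist H S g h" if gh: "g \<in> carrier H" "h \<in> carrier H" for g h
  proof -
    have d: "inv g \<otimes> h \<in> carrier H" using gh by (simp add: m_closed)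
    obtain ws where ws: "length ws = wl (inv g \<otimes> h)" "set ws \<subseteq> letters" "word_value ws = inv g \<otimes> h"
      by (rule wl_word[OF d])
    have "dist (\<phi> g x) (\<phi> h x) = dist x (\<phi> (inv g) (\<phi> h x))"
      using act_dist[OF inv_carrier[OF gh(1)], of "\<phi> g x" "\<phi> h x"] act_inv(1)[OF gh(1)] by simp
    also have "\<dots> = dist (\<phi> (word_value ws) x) x" using ws(3) act_mult[OF inv_carrier[OF gh(1)] gh(2)] by (simp add: dist_commute)
    also have "\<dots> \<le> L * word_dist H S g h" using word[OF ws(2)] ws(1) unfolding word_dist_def by simp
    finally show ?thesis .
  qed
  then show thesis using that L(1) by blast
qed

text \<open>A Morse quasi-geodesic between orbit points makes all pairs of its points Morse, and any
  geodesic with the same endpoints stays near it by its own Morse property.\<close>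

lemma stable_imp_uniform:
  assumes st: "stable_embedding (carrier H) (word_dist H S) (\<lambda>h. \<phi> h \<oo>)"
  obtains M where "uniform_gauge M"
proof -
  obtain N K C where N: "morse_gauge N" and paths: "\<forall>p\<in>(\<lambda>h. \<phi> h \<oo>) ` carrier H. \<forall>q\<in>(\<lambda>h. \<phi> h \<oo>) ` carrier H. \<exists>a b \<gamma>. a \<le> b \<and>
        quasi_geodesic K C {a..b} \<gamma> \<and> \<gamma> a = p \<and> \<gamma> b = q \<and> is_morse N (\<gamma> ` {a..b})"
    using st unfolding stable_embedding_def by blast
  have "uniform_gauge (perturbed (N 1 0 + 1) (pair_gauge K C N))"
    unfolding uniform_gauge_def
  proof (intro ballI allI impI)
    fix p q c assume "p \<in> X" "q \<in> X" and c: "geodesic_segment p q c"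
    then have "p \<in> (\<lambda>h. \<phi> h \<oo>) ` carrier H" "q \<in> (\<lambda>h. \<phi> h \<oo>) ` carrier H" unfolding X_iff by blast+
    then obtain a b \<gamma> where \<gamma>: "a \<le> b" "quasi_geodesic K C {a..b} \<gamma>" "\<gamma> a = p" "\<gamma> b = q" "is_morse N (\<gamma> ` {a..b})"
      using paths by meson
    have h: "morse_pairs (pair_gauge K C N) (\<gamma> ` {a..b})" by (rule is_morse_imp_morse_pairs[OF N \<gamma>(2,5)])
    have "p \<in> \<gamma> ` {a..b}" "q \<in> \<gamma> ` {a..b}" unfolding \<gamma>(3,4)[symmetric] using \<gamma>(1) by auto
    then have "c ` {0..dist p q} \<subseteq> closed_nbhd (N 1 0) (\<gamma> ` {a..b})"
      using \<gamma>(5) geodesic_segmentD[OF c] unfolding is_morse_def qg_path_def by auto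
    then have "near (N 1 0 + 1) (c ` {0..dist p q}) (\<gamma> ` {a..b})" by (rule closed_nbhd_imp_near) simp
    then show "morse_pairs (perturbed (N 1 0 + 1) (pair_gauge K C N)) (c ` {0..dist p q})" by (rule morse_pairs_near[OF h])
  qed
  then show thesis using that by blast
qed

text \<open>The orbit map carries a word geodesic to a quasi-geodesic running inside the orbit; a
  segment with the same endpoints is uniformly close to it.\<close>

lemma qi_embedded_imp_quasiconvex:
  assumes M: "uniform_gauge M" and qi: "qi_embedding (carrier H) (word_dist H S) (\<lambda>h. \<phi> h \<oo>)"
  shows "\<exists>R. quasiconvex R"
proof -
  obtain K C where K: "K \<ge> 1" "C \<ge> 0" and q: "\<And>g h. g \<in> carrier H \<Longrightarrow> h \<in> carrier H \<Longrightarrow>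
     1 / K * word_dist H S g h - C \<le> dist (\<phi> g \<oo>) (\<phi> h \<oo>) \<and> dist (\<phi> g \<oo>) (\<phi> h \<oo>) \<le> K * word_dist H S g h + C"
    using qi unfolding qi_embedding_def by blast
  have "near (M K (C + K)) (c ` {0..dist p q}) X" if pq: "p \<in> X" "q \<in> X" and c: "geodesic_segment p q c" for p q c
  proof -
    obtain g h where g: "g \<in> carrier H" "p = \<phi> g \<oo>" and h: "h \<in> carrier H" "q = \<phi> h \<oo>" using pq unfolding X_iff by blast
    obtain w and n :: nat where w: "w 0 = g" "w n = h" "\<And>i. i \<le> n \<Longrightarrow> w i \<in> carrier H"
      "\<And>i j. i \<le> j \<Longrightarrow> j \<le> n \<Longrightarrow> word_dist H S (w i) (w j) = real (j - i)" by (rule geodesic_word[OF g(1) h(1)]) blast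
    \<comment> \<open>A step function is admissible because quasi-geodesics may jump. Rounding the
      parameters costs at most \<open>K\<close> in the additive constant.\<close>
    define \<psi> where "\<psi> t = \<phi> (w (nat \<lfloor>t\<rfloor>)) \<oo>" for t :: real
    have fl: "nat \<lfloor>t\<rfloor> \<le> n" if "t \<le> real n" for t using that by (simp add: nat_le_iff floor_le_iff)
    have path: "qg_path K (C + K) 0 (real n) \<psi> p q"
    proof (rule qg_pathI)
      fix s t :: real assume st: "0 \<le> s" "s \<le> t" "t \<le> real n"
      define i j where "i = nat \<lfloor>s\<rfloor>" and "j = nat \<lfloor>t\<rfloor>"
      have ij: "i \<le> j" "j \<le> n" using st fl[of t] floor_mono[of s t] unfolding i_def j_def by (auto intro: nat_mono)
      have r: "real i \<le> s" "s < real i + 1" "real j \<le> t" "t < real j + 1" using st unfolding i_def j_def by linarith+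
      have D: "1 / K * (real j - real i) - C \<le> dist (\<psi> s) (\<psi> t)" "dist (\<psi> s) (\<psi> t) \<le> K * (real j - real i) + C"
        using q[of "w i" "w j"] w(3)[of i] w(3)[of j] w(4)[OF ij] ij unfolding \<psi>_def i_def[symmetric] j_def[symmetric] by auto
      have "(t - s) / K \<le> (real j - real i + 1) / K" using r K by (intro divide_right_mono) auto
      also have "\<dots> = 1 / K * (real j - real i) + 1 / K" by (simp add: add_divide_distrib)
      finally have "(t - s) / K \<le> 1 / K * (real j - real i) + 1 / K" .
      moreover have "1 / K \<le> K" using K mult_mono[of 1 K 1 K] by (simp add: divide_le_eq)
      ultimately show "(t - s) / K - (C + K) \<le> dist (\<psi> s) (\<psi> t)" using D(1) by linarith
      have "K * (real j - real i) \<le> K * (t - s + 1)" using r K by (intro mult_left_mono) auto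
      then show "dist (\<psi> s) (\<psi> t) \<le> K * (t - s) + (C + K)" using D(2) by (simp add: algebra_simps)
    qed (use K w g h in \<open>auto simp: \<psi>_def\<close>)
    have "morse_pair M p q" using M pq c morse_pairsD geodesic_segment_endpoints[OF c] unfolding uniform_gauge_def by blast
    moreover have "qg_path K (C + K) 0 (dist p q) c p q" by (rule qg_path_mono[OF geodesic_segmentD(4)[OF c]]) (use K in auto)
    ultimately have "near (M K (C + K)) (c ` {0..dist p q}) (\<psi> ` {0..real n})" using path unfolding morse_pair_def by blast
    moreover have "\<psi> ` {0..real n} \<subseteq> X" using orbitI[OF w(3)[OF fl]] unfolding \<psi>_def by auto
    ultimately show ?thesis unfolding near_def by blast
  qed
  then have "quasiconvex (M K (C + K))" unfolding quasiconvex_def by blast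
  then show ?thesis by blast
qed

text \<open>The Milnor-Svarc argument: walk along the segment in steps of length at most 1 and pick
  an orbit point near each stop. Consecutive choices differ by an element of \<open>F\<close>, which
  is finite by properness and so has bounded word length.\<close>

lemma word_dist_bound:
  assumes R: "quasiconvex R"
  obtains W where "W \<ge> 1" "\<And>g h. g \<in> carrier H \<Longrightarrow> h \<in> carrier H \<Longrightarrow> word_dist H S g h \<le> W * (dist (\<phi> g \<oo>) (\<phi> h \<oo>) + 1)"
proof -
  define F where "F = {f \<in> carrier H. dist \<oo> (\<phi> f \<oo>) \<le> 2 * \<bar>R\<bar> + 1}"
  have "F \<subseteq> {h \<in> carrier H. \<phi> h ` cball \<oo> (2 * \<bar>R\<bar> + 1) \<inter> cball \<oo> (2 * \<bar>R\<bar> + 1) \<noteq> {}}"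
  proof
    fix f assume "f \<in> F"
    then have "f \<in> carrier H" "\<phi> f \<oo> \<in> \<phi> f ` cball \<oo> (2 * \<bar>R\<bar> + 1) \<inter> cball \<oo> (2 * \<bar>R\<bar> + 1)"
      unfolding F_def by auto
    then show "f \<in> {h \<in> carrier H. \<phi> h ` cball \<oo> (2 * \<bar>R\<bar> + 1) \<inter> cball \<oo> (2 * \<bar>R\<bar> + 1) \<noteq> {}}" by blast
  qed
  then have fin: "finite F" using proper proper_space finite_subset unfolding proper_action_def by blast
  define W where "W = real (Max (insert 1 (wl ` F)))"
  have W: "W \<ge> 1" "\<And>f. f \<in> F \<Longrightarrow> wl f \<le> W" unfolding W_def using fin by auto
  have "word_dist H S g h \<le> W * (dist (\<phi> g \<oo>) (\<phi> h \<oo>) + 1)" if gh: "g \<in> carrier H" "h \<in> carrier H" for g h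
  proof -
    define d where "d = dist (\<phi> g \<oo>) (\<phi> h \<oo>)"
    define n where "n = nat \<lceil>d\<rceil>"
    have d0: "d \<ge> 0" unfolding d_def by simp
    have nd: "d \<le> real n" "real n \<le> d + 1" using d0 unfolding n_def by linarith+
    obtain c where c: "geodesic_segment (\<phi> g \<oo>) (\<phi> h \<oo>) c" using geodesic_space by blast
    note c' = geodesic_segmentD[OF c]
    have nr: "near R (c ` {0..d}) X" using R orbitI[OF gh(1)] orbitI[OF gh(2)] c unfolding quasiconvex_def d_def by blast
    have R0: "R \<ge> 0" using near_nonneg[OF nr] d0 by auto
    have "\<forall>i::nat. \<exists>k. k \<in> carrier H \<and> dist (c (min d i)) (\<phi> k \<oo>) \<le> R"
    proof
      fix i :: nat
      have "c (min d i) \<in> c ` {0..d}" using d0 by auto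
      then obtain y where "y \<in> X" "dist (c (min d i)) y \<le> R" using nearD[OF nr] by blast
      then show "\<exists>k. k \<in> carrier H \<and> dist (c (min d i)) (\<phi> k \<oo>) \<le> R" unfolding X_iff by blast
    qed
    then have "\<exists>k :: nat \<Rightarrow> 'g. \<forall>i::nat. k i \<in> carrier H \<and> dist (c (min d i)) (\<phi> (k i) \<oo>) \<le> R" by (rule choice)
    then obtain k0 :: "nat \<Rightarrow> 'g" where k0': "\<forall>i::nat. k0 i \<in> carrier H \<and> dist (c (min d i)) (\<phi> (k0 i) \<oo>) \<le> R" ..
    have k0: "k0 i \<in> carrier H" "dist (c (min d i)) (\<phi> (k0 i) \<oo>) \<le> R" for i :: nat
      using k0'[rule_format, of i] by simp_all
    \<comment> \<open>The chosen elements are replaced by \<open>g\<close> and \<open>h\<close> at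
      the two ends, so that the product of the steps is exactly \<open>inv g \<otimes> h\<close>.
      For \<open>n = 0\<close> the first clause wins, and that case is handled at the end.\<close>
    define k where "k i = (if i = 0 then g else if i = n then h else k0 i)" for i
    have k: "k i \<in> carrier H" "i \<le> n \<Longrightarrow> dist (c (min d i)) (\<phi> (k i) \<oo>) \<le> R" for i
      using k0[of i] gh c'(2,3) R0 d0 nd(1) unfolding k_def d_def[symmetric] by (auto simp: min_def)
    have inF: "inv (k i) \<otimes> k (Suc i) \<in> F" if i: "i < n" for i
    proof -
      have "dist (c (min d i)) (c (min d (Suc i))) \<le> 1"
        using geodesicD[OF c'(1), of "min d i" "min d (Suc i)"] d0 unfolding d_def[symmetric] by auto
      then have "dist (\<phi> (k i) \<oo>) (\<phi> (k (Suc i)) \<oo>) \<le> 2 * R + 1"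
        using k(2)[of i] k(2)[of "Suc i"] i dist_triangle[of "\<phi> (k i) \<oo>" "\<phi> (k (Suc i)) \<oo>" "c (min d i)"]
          dist_triangle[of "c (min d i)" "\<phi> (k (Suc i)) \<oo>" "c (min d (Suc i))"] dist_commute[of "c (min d i)" "\<phi> (k i) \<oo>"] by linarith
      moreover have "dist \<oo> (\<phi> (inv (k i) \<otimes> k (Suc i)) \<oo>) = dist (\<phi> (k i) \<oo>) (\<phi> (k (Suc i)) \<oo>)"
        using act_dist[OF inv_carrier[OF k(1)[of i]], of "\<phi> (k i) \<oo>" "\<phi> (k (Suc i)) \<oo>"] act_inv(1)[OF k(1)]
          act_mult[OF inv_carrier[OF k(1)[of i]] k(1)[of "Suc i"]] by simp
      ultimately show ?thesis unfolding F_def using R0 m_closed[OF inv_carrier[OF k(1)] k(1)] by simp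
    qed
    have "wl (inv (k 0) \<otimes> k i) \<le> W * i" if "i \<le> n" for i
      using that
    proof (induction i)
      case 0
      have "inv (k 0) \<otimes> k 0 = word_value []" using group.l_inv[OF group k(1)] by simp
      then have "wl (inv (k 0) \<otimes> k 0) \<le> 0" using wl_le[of "[]"] by simp
      then show ?case by simp
    next
      case (Suc i)
      have "wl (inv (k 0) \<otimes> k (Suc i)) \<le> wl (inv (k 0) \<otimes> k i) + wl (inv (k i) \<otimes> k (Suc i))"
        using wl_mult[OF m_closed[OF inv_carrier[OF k(1)] k(1)] m_closed[OF inv_carrier[OF k(1)] k(1)], of 0 i i "Suc i"]
          inv_mult_cancel[OF k(1) k(1) k(1), of 0 i "Suc i"] by simp
      also have "real \<dots> \<le> W * i + W" using Suc W(2)[OF inF[of i]] by simp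
      finally show ?case by (simp add: algebra_simps)
    qed
    from this[of n] have "word_dist H S g (k n) \<le> W * n" unfolding word_dist_def k_def by simp
    also have "\<dots> \<le> W * (d + 1)" using nd W(1) by (intro mult_left_mono) auto
    finally have *: "word_dist H S g (k n) \<le> W * (d + 1)" .
    show ?thesis
    proof (cases "n = 0")
      case False
      then show ?thesis using * unfolding k_def d_def by simp
    next
      \<comment> \<open>Then \<open>inv g \<otimes> h\<close> fixes the basepoint. It need not be
        trivial, but it lies in \<open>F\<close>.\<close>
      case True
      then have "d = 0" using nd d0 by simp
      then have "dist \<oo> (\<phi> (inv g \<otimes> h) \<oo>) = 0"
        using act_dist[OF inv_carrier[OF gh(1)], of "\<phi> g \<oo>" "\<phi> h \<oo>"] act_mult[OF inv_carrier[OF gh(1)] gh(2)]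
        unfolding d_def act_inv(1)[OF gh(1)] by simp
      then have "inv g \<otimes> h \<in> F" unfolding F_def using m_closed[OF inv_carrier[OF gh(1)] gh(2)] by simp
      then show ?thesis using W(2) \<open>d = 0\<close> unfolding word_dist_def d_def by simp
    qed
  qed
  then show thesis using that W(1) by blast
qed

text \<open>Orbit points of \<open>x\<close> and of the basepoint belonging to the same group
  element are at distance \<open>r\<close>. This costs \<open>2 * r\<close> in the distance
  estimates, and the segments between points of one orbit follow those of the other.\<close>

lemma uniform_imp_stable:
  assumes M: "uniform_gauge M" and R: "quasiconvex R"
  shows "stable_embedding (carrier H) (word_dist H S) (\<lambda>h. \<phi> h x)"
proof -
  define r where "r = dist x \<oo>"
  have r0: "r \<ge> 0" unfolding r_def by simp
  have xo: "dist (\<phi> h x) (\<phi> h \<oo>) = r" if "h \<in> carrier H" for h using that unfolding r_def by simp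
  obtain L where L: "L \<ge> 1" "\<And>g h. g \<in> carrier H \<Longrightarrow> h \<in> carrier H \<Longrightarrow> dist (\<phi> g x) (\<phi> h x) \<le> L * word_dist H S g h"
    by (rule orbit_map_lipschitz) blast
  obtain W where W: "W \<ge> 1" "\<And>g h. g \<in> carrier H \<Longrightarrow> h \<in> carrier H \<Longrightarrow> word_dist H S g h \<le> W * (dist (\<phi> g \<oo>) (\<phi> h \<oo>) + 1)"
    by (rule word_dist_bound[OF R]) blast
  have "qi_embedding (carrier H) (word_dist H S) (\<lambda>h. \<phi> h x)"
    unfolding qi_embedding_def
  proof (rule exI[of _ "max L W"], intro conjI exI[of _ "2 * r + 1"] ballI)
    fix g h assume gh: "g \<in> carrier H" "h \<in> carrier H"
    have wd: "word_dist H S g h \<ge> 0" unfolding word_dist_def by simp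
    have "dist (\<phi> g \<oo>) (\<phi> h \<oo>) \<le> dist (\<phi> g x) (\<phi> h x) + 2 * r"
      using xo[OF gh(1)] xo[OF gh(2)] by metric
    then have "W * (dist (\<phi> g \<oo>) (\<phi> h \<oo>) + 1) \<le> W * (dist (\<phi> g x) (\<phi> h x) + (2 * r + 1))" using W(1) by (intro mult_left_mono) auto
    also have "\<dots> \<le> max L W * (dist (\<phi> g x) (\<phi> h x) + (2 * r + 1))" using r0 by (intro mult_right_mono) auto
    finally have "word_dist H S g h \<le> (dist (\<phi> g x) (\<phi> h x) + (2 * r + 1)) * max L W"
      using W(2)[OF gh] by (simp add: mult.commute)
    then have "word_dist H S g h / max L W \<le> dist (\<phi> g x) (\<phi> h x) + (2 * r + 1)"
      using L(1) by (simp add: pos_divide_le_eq max_def split: if_splits)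
    then show "1 / max L W * word_dist H S g h - (2 * r + 1) \<le> dist (\<phi> g x) (\<phi> h x)" by simp
    have "L * word_dist H S g h \<le> max L W * word_dist H S g h" using wd by (intro mult_right_mono) auto
    then show "dist (\<phi> g x) (\<phi> h x) \<le> max L W * word_dist H S g h + (2 * r + 1)" using L(2)[OF gh] r0 by linarith
  qed (use L r0 in auto)
  moreover have "\<exists>a b \<gamma>. a \<le> b \<and> quasi_geodesic 1 0 {a..b} \<gamma> \<and> \<gamma> a = p \<and> \<gamma> b = q \<and>
      is_morse (pos_gauge (perturbed (M 1 (2 * r + 2)) M)) (\<gamma> ` {a..b})"
    if pq: "p \<in> (\<lambda>h. \<phi> h x) ` carrier H" "q \<in> (\<lambda>h. \<phi> h x) ` carrier H" for p q
  proof -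
    obtain g h where g: "g \<in> carrier H" "p = \<phi> g x" and h: "h \<in> carrier H" "q = \<phi> h x" using pq by blast
    obtain c c0 where c: "geodesic_segment p q c" and c0: "geodesic_segment (\<phi> g \<oo>) (\<phi> h \<oo>) c0" using geodesic_space by metis
    note c' = geodesic_segmentD[OF c]
    have h0: "morse_pairs M (c0 ` {0..dist (\<phi> g \<oo>) (\<phi> h \<oo>)})" using M c0 orbitI[OF g(1)] orbitI[OF h(1)] unfolding uniform_gauge_def by blast
    have "near (M 1 (2 * r + 2)) (c ` {0..dist p q}) (c0 ` {0..dist (\<phi> g \<oo>) (\<phi> h \<oo>)})"
      by (rule segment_near[OF geodesic_segmentD(1)[OF c0] h0 geodesic_segment_endpoints[OF c0] c'(1)])
         (use c' g h xo in auto)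
    then have "morse_pairs (pos_gauge (perturbed (M 1 (2 * r + 2)) M)) (c ` {0..dist p q})" by (intro morse_pairs_pos_gauge morse_pairs_near[OF h0])
    then have "is_morse (pos_gauge (perturbed (M 1 (2 * r + 2)) M)) (c ` {0..dist p q})" by (rule morse_pairs_imp_is_morse[OF c'(1)])
    then show ?thesis using c'(2,3,4) unfolding qg_path_def by blast
  qed
  ultimately show ?thesis unfolding stable_embedding_def using morse_gauge_pos_gauge by blast
qed

end

text \<open>For a finite group the orbit would be bounded, hence stably embedded, while its limit
  set would be empty; \<open>infinite_group\<close> excludes this.\<close>

theorem theorem1p2:
  fixes H :: "('g, 'r) monoid_scheme"
    and S :: "'g set"
    and \<phi> :: "'g \<Rightarrow> 'x::metric_space \<Rightarrow> 'x"
    and \<oo> :: 'x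
  assumes proper_space: "\<And>(x::'x) r. compact (cball x r)"
    and geodesic_space: "\<And>x y::'x. \<exists>\<gamma>. geodesic_segment x y \<gamma>"
    and group: "group H"
    and finitely_generated: "finite S" "S \<subseteq> carrier H" "generate H S = carrier H"
    and infinite_group: "infinite (carrier H)"
    and isometries: "isometric_action H \<phi>"
    and proper: "proper_action H \<phi>"
  shows "let \<Lambda> = group_limit_set H \<phi> \<oo>;
             stable = (\<forall>x. stable_embedding (carrier H) (word_dist H S) (\<lambda>h. \<phi> h x));
             convex_cocompact = boundary_convex_cocompact H \<phi> \<oo>;
             conical = ((\<forall>x\<in>\<Lambda>. conical_limit_point \<oo> (orbit H \<phi> \<oo>) x) \<and>
                        \<Lambda> \<noteq> {} \<and> compactin (morse_boundary_topology \<oo>) \<Lambda>);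
             horospherical = ((\<forall>x\<in>\<Lambda>. horospherical_limit_point \<oo> (orbit H \<phi> \<oo>) x) \<and>
                        \<Lambda> \<noteq> {} \<and> compactin (morse_boundary_topology \<oo>) \<Lambda>)
         in (stable \<longleftrightarrow> convex_cocompact) \<and> (convex_cocompact \<longleftrightarrow> conical) \<and>
            (conical \<longleftrightarrow> horospherical)"
proof -
  interpret generated_orbit \<oo> H \<phi> S
    by (intro generated_orbit.intro proper_orbit.intro proper_geodesic_space.intro proper_orbit_axioms.intro
        generated_orbit_axioms.intro) (fact assms)+
  have X: "orbit H \<phi> \<oo> = X" unfolding X_def ..
  have L: "group_limit_set H \<phi> \<oo> = \<Lambda>" unfolding group_limit_set_def \<Lambda>_def X_def ..
  define stable where "stable = (\<forall>x. stable_embedding (carrier H) (word_dist H S) (\<lambda>h. \<phi> h x))"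
  define conical where "conical = ((\<forall>x\<in>\<Lambda>. conical_limit_point \<oo> X x) \<and> \<Lambda> \<noteq> {} \<and> compactin (morse_boundary_topology \<oo>) \<Lambda>)"
  define horospherical where "horospherical = ((\<forall>x\<in>\<Lambda>. horospherical_limit_point \<oo> X x) \<and> \<Lambda> \<noteq> {} \<and> compactin (morse_boundary_topology \<oo>) \<Lambda>)"
  \<comment> \<open>The hub of the equivalences. The first condition is equivalent to it directly,
    and the other three imply it through the uniform gauge that compactness provides.\<close>
  define quasi where "quasi = (\<exists>M R. uniform_gauge M \<and> quasiconvex R)"
  have 1: "stable \<longleftrightarrow> quasi"
  proof
    assume stable
    then have st: "stable_embedding (carrier H) (word_dist H S) (\<lambda>h. \<phi> h \<oo>)" unfolding stable_def by blast
    obtain M where M: "uniform_gauge M" by (rule stable_imp_uniform[OF st])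
    moreover have "\<exists>R. quasiconvex R" using qi_embedded_imp_quasiconvex[OF M] st unfolding stable_embedding_def by blast
    ultimately show quasi unfolding quasi_def by blast
  next
    assume quasi
    then show stable unfolding stable_def quasi_def using uniform_imp_stable by blast
  qed
  have 2: "boundary_convex_cocompact H \<phi> \<oo> \<Longrightarrow> quasi"
    unfolding boundary_convex_cocompact_def L quasi_def
    using compact_imp_uniform_orbit_gauge cobounded_hull_imp_quasiconvex by metis
  have 3: "quasi \<Longrightarrow> boundary_convex_cocompact H \<phi> \<oo>"
    unfolding boundary_convex_cocompact_def L quasi_def
    using proper limit_set_nonempty limit_set_compact hull_cobounded infinite_group by metis
  have 4: "quasi \<Longrightarrow> conical"
    unfolding conical_def quasi_def
    using limit_set_nonempty limit_set_compact limit_points_conical infinite_group by metis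
  have 5: "conical \<Longrightarrow> horospherical"
    unfolding conical_def horospherical_def using conical_imp_horospherical by blast
  have 6: "horospherical \<Longrightarrow> quasi"
    unfolding horospherical_def quasi_def
    using compact_imp_uniform_orbit_gauge horospherical_imp_quasiconvex by metis
  show ?thesis unfolding Let_def X L stable_def[symmetric] conical_def[symmetric] horospherical_def[symmetric]
    using 1 2 3 4 5 6 by blast
qed

end
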